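(* Let $F$ and $f$ be the cdf and pdf of the finite mixed skew-$t$ distribution with $r$ components (parameters $0<v_1<\dots<v_r$, $\beta_i\in\mathbb{R}$, $p_i>0$, $\sum_ip_i=1$), and let $\kappa$, $a_n$, $\Phi_v$, $A_1,\dots,A_5$, $K_1,K_2,K_3$ and $\mathbf 1\{\cdot\}$ be as in the context. Let $g_n(x)=na_nF^{n-1}(a_nx)f(a_nx)$, $\Phi_v'(x)=vx^{-v-1}\Phi_v(x)$, and $\Delta_n(g_n,\Phi_v';x)=g_n(x)-\Phi_v'(x)$. Then for $x>0$, as $n\to\infty$, the following hold. (i) If $0<v_1<2$ and $v_2>2v_1$, set $\gamma_1=\min\{2,v_2-v_1,2v_1\}-v_1$. Then $$a_n^{\gamma_1}[a_n^{v_1}\Delta_n(g_n,\Phi_{v_1}';x)-s_1(x)\Phi_{v_1}'(x)]\to q_1(x)\Phi_{v_1}'(x),$$ where $s_1(x)=\kappa(2-x^{-v_1})x^{-v_1}$ and $$q_1(x)=\Big[\mathbf 1\{0<v_1<1,\,2v_1<v_2\le3v_1\}+\mathbf 1\{1\le v_1<2,\,2v_1<v_2\le v_1+2\}\Big]\Big(\tfrac{v_2}{v_1}x^{-(v_2-v_1)}-x^{-v_2}\Big)A_3$$ $$+\mathbf 1\{1\le v_1<2,\,v_2\ge v_1+2\}(K_1x^{-2}-A_1x^{-v_1-2})+\mathbf 1\{0<v_1\le1,\,v_2\ge3v_1\}\,\kappa^2\Big(4-\tfrac{10}{3}x^{-v_1}+\tfrac12x^{-2v_1}\Big)x^{-2v_1}.$$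 (ii) If $v_1>2$ and $v_2>v_1+2$, set $\gamma_2=\min\{4,v_2-v_1,v_1\}-2$. Then $$a_n^{\gamma_2}[a_n^2\Delta_n(g_n,\Phi_{v_1}';x)-s_2(x)\Phi_{v_1}'(x)]\to q_2(x)\Phi_{v_1}'(x),$$ where $s_2(x)=K_1x^{-2}-A_1x^{-v_1-2}$ and $$q_2(x)=\mathbf 1\{v_1\ge4,\,v_2\ge v_1+4\}\Big[K_3x^{-4}-(A_2+K_1A_1)x^{-v_1-4}+\tfrac12A_1^2x^{-2v_1-4}\Big]$$ $$+\Big(\mathbf 1\{v_1\ge4,\,v_1+2<v_2\le v_1+4\}+\mathbf 1\{2<v_1<4,\,v_1+2<v_2\le2v_1\}\Big)A_3\Big(\tfrac{v_2}{v_1}x^{-(v_2-v_1)}-x^{-v_2}\Big)$$ $$+\mathbf 1\{2<v_1\le4,\,v_2\ge2v_1\}\,\kappa(2-x^{-v_1})x^{-v_1}.$$ (iii) If $0<v_1<v_2<\min\{v_1+2,2v_1\}$, set $\gamma_3=\min\{2,v_1,2(v_2-v_1),v_3-v_1\}-v_2+v_1$. Then $$a_n^{\gamma_3}[a_n^{v_2-v_1}\Delta_n(g_n,\Phi_{v_1}';x)-s_3(x)\Phi_{v_1}'(x)]\to q_3(x)\Phi_{v_1}'(x),$$ where $s_3(x)=\big(\tfrac{v_2}{v_1}x^{-(v_2-v_1)}-x^{-v_2}\big)A_3$ and $$q_3(x)=\Big(\mathbf 1\{0<v_1<2,\,\tfrac{v_1+v_3}{2}\le v_2<2v_1,\,v_3\le2v_1\}+\mathbf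 1\{v_1\ge2,\,\tfrac{v_1+v_3}{2}\le v_2<v_1+2,\,v_3\le2+v_1\}\Big)\Big(\tfrac{v_3}{v_1}x^{-(v_3-v_1)}-x^{-v_3}\Big)A_5$$ $$+\mathbf 1\{0<v_1\le2,\,\tfrac32v_1\le v_2<2v_1,\,v_3\ge2v_1\}\,\kappa(2-x^{-v_1})x^{-v_1}+\mathbf 1\{v_1\ge2,\,v_1+1\le v_2<v_1+2,\,v_3\ge v_1+2\}(K_1x^{-2}-A_1x^{-v_1-2})$$ $$+\Big[\mathbf 1\{0<v_1<2,\,v_1<v_2\le\tfrac32v_1,\,v_3\ge2v_1\}+\mathbf 1\{0<v_1<2,\,v_1<v_2\le\tfrac{v_1+v_3}{2},\,v_2<v_3<2v_1\}$$ $$+\mathbf 1\{v_1\ge2,\,v_1<v_2\le v_1+1,\,v_3\ge2+v_1\}+\mathbf 1\{v_1>2,\,v_1<v_2\le\tfrac{v_1+v_3}{2},\,v_2<v_3\le v_1+2\}\Big]\Big(\frac{x^{-2v_2}}{2}-\frac{v_2}{v_1}x^{-2v_2+v_1}\Big)A_3^2.$$ (iv) If $v_1=2$ and $v_2>4$, set $\gamma_4=\min\{v_2-2,4\}-2$. Then $$a_n^{\gamma_4}[a_n^2\Delta_n(g_n,\Phi_{v_1}';x)-s_4(x)\Phi_{v_1}'(x)]\to q_4(x)\Phi_{v_1}'(x),$$ where $s_4(x)=-A_1x^{-4}-\frac12p_1T_3(\sqrt3\beta_1)x^{-4}+K_1x^{-2}+p_1T_3(\sqrt3\beta_1)x^{-2}$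 and $$q_4(x)=\mathbf 1\{4<v_2\le6\}A_3\Big(\tfrac{v_2}{2}x^{-(v_2-2)}-x^{-v_2}\Big)$$ $$+\mathbf 1\{v_2\ge6\}\Big[-\Big(A_2+A_1K_1+\big(2A_1+\tfrac{K_1}{2}\big)p_1T_3(\sqrt3\beta_1)+\tfrac56p_1^2T_3^2(\sqrt3\beta_1)\Big)x^{-6}$$ $$+\Big(K_3+(A_1+K_1)p_1T_3(\sqrt3\beta_1)+p_1^2T_3^2(\sqrt3\beta_1)\Big)x^{-4}+\tfrac18\big(2A_1+p_1T_3(\sqrt3\beta_1)\big)^2x^{-8}\Big].$$ (v) If $v_1>2$ and $v_2=v_1+2$, set $\gamma_5=\min\{v_1,4,v_3-v_1\}-2$. Then $$a_n^{\gamma_5}[a_n^2\Delta_n(g_n,\Phi_{v_1}';x)-s_5(x)\Phi_{v_1}'(x)]\to q_5(x)\Phi_{v_1}'(x),$$ where $s_5(x)=\big(K_1+A_3(1+\tfrac{2}{v_1})\big)x^{-2}-(A_1+A_3)x^{-v_1-2}$ and $$q_5(x)=\mathbf 1\{2<v_1\le4,\,v_3\ge2v_1\}\,\kappa(2x^{-v_1}-x^{-2v_1})$$ $$+\Big(\mathbf 1\{2<v_1<4,\,v_1+2<v_3\le2v_1\}+\mathbf 1\{v_1\ge4,\,v_1+2<v_3\le v_1+4\}\Big)\Big(\tfrac{v_3}{v_1}x^{-(v_3-v_1)}-x^{-v_3}\Big)A_5$$ $$+\mathbf 1\{v_1\ge4,\,v_3\ge v_1+4\}\Big[\tfrac12(A_1+A_3)^2x^{-2v_1-4}+(K_2+K_3)x^{-4}-\Big(\big((1+\tfrac2{v_1})A_3+K_1\big)(A_1+A_3)+A_2+A_4\Big)x^{-v_1-4}\Big].$$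 (vi) If $0<v_1<2$ and $v_2=2v_1$, set $\gamma_6=\min\{2,2v_1,v_3-v_1\}-v_1$. Then $$a_n^{\gamma_6}[a_n^{v_1}\Delta_n(g_n,\Phi_{v_1}';x)-s_6(x)\Phi_{v_1}'(x)]\to q_6(x)\Phi_{v_1}'(x),$$ where $s_6(x)=\kappa(2x^{-v_1}-x^{-2v_1})+A_3(2x^{-v_1}-x^{-2v_1})$ and $$q_6(x)=\mathbf 1\{1\le v_1<2,\,v_3\ge v_1+2\}(K_1x^{-2}-A_1x^{-v_1-2})$$ $$+\Big(\mathbf 1\{0<v_1<1,\,2v_1<v_3\le3v_1\}+\mathbf 1\{1\le v_1<2,\,2v_1<v_3\le v_1+2\}\Big)A_5\Big(\tfrac{v_3}{v_1}x^{-(v_3-v_1)}-x^{-v_3}\Big)$$ $$+\mathbf 1\{0<v_1\le1,\,v_3\ge3v_1\}\Big[\kappa^2x^{-2v_1}\big(4-\tfrac{10}{3}x^{-v_1}\big)+6\kappa A_3(-x^{-3v_1}+x^{-2v_1})-2A_3^2x^{-3v_1}+\tfrac12(A_3+\kappa)^2x^{-4v_1}\Big].$$ (vii) If $v_1=2$ and $v_2=4$, set $\gamma_7=\min\{v_3-v_1,4\}-2$. Then $$a_n^{\gamma_7}[a_n^2\Delta_n(g_n,\Phi_{v_1}';x)-s_7(x)\Phi_{v_1}'(x)]\to q_7(x)\Phi_{v_1}'(x),$$ where $s_7(x)=(K_1+2A_3+p_1T_3(\sqrt3\beta_1))x^{-2}-\big(A_1+A_3+\frac12p_1T_3(\sqrt3\beta_1)\big)x^{-4}$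 and $$q_7(x)=\mathbf 1\{4<v_3\le6\}A_5\Big(\tfrac{v_3}{2}x^{-(v_3-2)}-x^{-v_3}\Big)+\mathbf 1\{v_3\ge6\}\Big[\tfrac12\big(A_1+A_3+\tfrac12p_1T_3(\sqrt3\beta_1)\big)^2x^{-8}$$ $$-\Big(A_4+A_2+2A_3^2+2A_1A_3+A_1K_1+A_3K_1+\big(2A_1+3A_3+\tfrac{K_1}{2}\big)p_1T_3(\sqrt3\beta_1)+\tfrac56p_1^2T_3^2(\sqrt3\beta_1)\Big)x^{-6}$$ $$+\Big(K_2+K_3+(A_1+K_1+3A_3)p_1T_3(\sqrt3\beta_1)+p_1^2T_3^2(\sqrt3\beta_1)\Big)x^{-4}\Big].$$
   Context: Student $t$: for $v>0$, $t_v(x)=C_v(1+x^2/v)^{-(v+1)/2}$ with $C_v=\frac{\Gamma((v+1)/2)}{\Gamma(v/2)\sqrt{v\pi}}$ is the pdf, and $T_v$ is the cdf, of the standard Student $t$ distribution with $v$ degrees of freedom. Skew-$t$: $\mathrm{ST}_v(\beta)$ ($v>0$, $\beta\in\mathbb{R}$) is the distribution on $\mathbb{R}$ with pdf $2t_v(x)T_{v+1}\big(\beta x\sqrt{\tfrac{v+1}{x^2+v}}\big)$; its cdf is denoted $F_{v,\beta}$. Mixed skew-$t$ distribution (MSTD) with $r$ components: given $0<v_1<v_2<\dots<v_r$, $\beta_i\in\mathbb{R}$, $p_i>0$ with $\sum_{i=1}^rp_i=1$, it is the distribution with cdf $F(x)=\sum_{i=1}^rp_iF_{v_i,\beta_i}(x)$;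 $f=F'$ is its pdf. $\Phi_v(x)=\exp(-x^{-v})$ for $x>0$. $\mathbf 1\{\cdot\}$ equals $1$ if all listed conditions hold and $0$ otherwise. Abbreviation and norming constant: $$\kappa=p_1C_{v_1}v_1^{\frac{v_1-1}{2}}T_{v_1+1}(\beta_1\sqrt{v_1+1}),\qquad a_n=\big(2p_1C_{v_1}T_{v_1+1}(\beta_1\sqrt{v_1+1})\big)^{1/v_1}v_1^{\frac{v_1-1}{2v_1}}n^{1/v_1}\quad(\text{so } a_n^{v_1}=2\kappa n).$$ Constants: $$A_1=-\frac{C_{v_1+1}v_1^2\sqrt{v_1+1}\,\beta_1(1+\beta_1^2)^{-\frac{v_1+2}{2}}}{2T_{v_1+1}(\beta_1\sqrt{v_1+1})(v_1+2)}-\frac{v_1^2(v_1+1)}{2(v_1+2)},$$ $$A_2=\frac{C_{v_1+1}\sqrt{v_1+1}\,\beta_1(1+\beta_1^2)^{-\frac{v_1+2}{2}}}{T_{v_1+1}(\beta_1\sqrt{v_1+1})}\left[\frac{v_1^3(v_1-1)}{4(v_1+2)}+\frac{3v_1^2}{8}-\frac{3v_1^2}{(v_1+2)(v_1+4)}-\frac{(v_1+2)\beta_1^2v_1^3}{8(v_1+4)(1+\beta_1^2)}\right]$$ $$\qquad+\frac{v_1^2(v_1^2-1)}{8}+\frac{3v_1^2}{(v_1+2)(v_1+4)}+\frac{v_1^2(v_1-1)}{2(v_1+2)},$$ $$A_3=\frac{p_2C_{v_2}v_2^{\frac{v_2-1}{2}}T_{v_2+1}(\beta_2\sqrt{v_2+1})}{p_1C_{v_1}v_1^{\frac{v_1-1}{2}}T_{v_1+1}(\beta_1\sqrt{v_1+1})},$$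 $$A_4=-A_3\left(\frac{C_{v_2+1}v_2^2\sqrt{v_2+1}\,\beta_2(1+\beta_2^2)^{-\frac{v_2+2}{2}}}{2(v_2+2)T_{v_2+1}(\beta_2\sqrt{v_2+1})}+\frac{v_2^2(v_2+1)}{2(v_2+2)}\right),$$ $$A_5=\frac{p_3C_{v_3}v_3^{\frac{v_3-1}{2}}T_{v_3+1}(\beta_3\sqrt{v_3+1})}{p_1C_{v_1}v_1^{\frac{v_1-1}{2}}T_{v_1+1}(\beta_1\sqrt{v_1+1})},$$ $$K_1=-\frac{v_1\left(T_{v_1+1}(\beta_1\sqrt{v_1+1})(v_1+1)+C_{v_1+1}(1+\beta_1^2)^{-\frac{v_1+2}{2}}\beta_1\sqrt{v_1+1}\right)}{2T_{v_1+1}(\beta_1\sqrt{v_1+1})},$$ $$K_2=-\frac{p_2C_{v_2}v_2^{\frac{v_2+3}{2}}\left(T_{v_2+1}(\beta_2\sqrt{v_2+1})(v_2+1)+C_{v_2+1}\beta_2\sqrt{v_2+1}(1+\beta_2^2)^{-\frac{v_2+2}{2}}\right)}{2p_1C_{v_1}v_1^{\frac{v_1+1}{2}}T_{v_1+1}(\beta_1\sqrt{v_1+1})},$$ $$K_3=\frac{\frac{v_1^2(v_1+3)(v_1+1)}{8}T_{v_1+1}(\beta_1\sqrt{v_1+1})+C_{v_1+1}\beta_1\sqrt{v_1+1}(1+\beta_1^2)^{-\frac{v_1+2}{2}}\cdot\frac{2v_1^3+v_1^3\beta_1^2+3v_1^2\beta_1^2+5v_1^2}{8(1+\beta_1^2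)}}{T_{v_1+1}(\beta_1\sqrt{v_1+1})}.$$
   Formalization: In (iii), the last indicator of the A_3² group in q_3 is corrected to 1{v_1≥2, v_1<v_2≤(v_1+v_3)/2, v_2<v_3<v_1+2}; as printed, the term is missing when v_1=2, v_3<4 (e.g. v=(2,2.5,3.5)) and counted twice when v_1>2, v_3=v_1+2, v_2≤v_1+1. *)

theory Defs
  imports "HOL-Probability.Probability"
begin

definition student_C :: "real \<Rightarrow> real" where
  "student_C v = Gamma ((v + 1) / 2) / (Gamma (v / 2) * sqrt (v * pi))"

definition student_pdf :: "real \<Rightarrow> real \<Rightarrow> real" where
  "student_pdf v x = student_C v * (1 + x\<^sup>2 / v) powr (- ((v + 1) / 2))"

definition student_cdf :: "real \<Rightarrow> real \<Rightarrow> real" where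
  "student_cdf v = cdf (density lborel (\<lambda>x. ennreal (student_pdf v x)))"

definition skewt_pdf :: "real \<Rightarrow> real \<Rightarrow> real \<Rightarrow> real" where
  "skewt_pdf v \<beta> x =
     2 * student_pdf v x * student_cdf (v + 1) (\<beta> * x * sqrt ((v + 1) / (x\<^sup>2 + v)))"

definition skewt_cdf :: "real \<Rightarrow> real \<Rightarrow> real \<Rightarrow> real" where
  "skewt_cdf v \<beta> = cdf (density lborel (\<lambda>x. ennreal (skewt_pdf v \<beta> x)))"

text \<open>
  Parameters of a mixture with \<open>r\<close> components are sequences, of which only the entries with
  index in \<open>{1..r}\<close> are meaningful.
\<close>

definition mstd_parameters ::
    "nat \<Rightarrow> (nat \<Rightarrow> real) \<Rightarrow> (nat \<Rightarrow> real) \<Rightarrow> bool" where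
  "mstd_parameters r p v \<longleftrightarrow>
     (\<forall>i\<in>{1..r}. 0 < v i) \<and> strict_mono_on {1..r} v \<and>
     (\<forall>i\<in>{1..r}. 0 < p i) \<and> (\<Sum>i=1..r. p i) = 1"

definition mstd_cdf ::
    "nat \<Rightarrow> (nat \<Rightarrow> real) \<Rightarrow> (nat \<Rightarrow> real) \<Rightarrow> (nat \<Rightarrow> real) \<Rightarrow> real \<Rightarrow> real" where
  "mstd_cdf r p v \<beta> x = (\<Sum>i=1..r. p i * skewt_cdf (v i) (\<beta> i) x)"

definition mstd_pdf ::
    "nat \<Rightarrow> (nat \<Rightarrow> real) \<Rightarrow> (nat \<Rightarrow> real) \<Rightarrow> (nat \<Rightarrow> real) \<Rightarrow> real \<Rightarrow> real" where
  "mstd_pdf r p v \<beta> = deriv (mstd_cdf r p v \<beta>)"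

definition frechet_cdf :: "real \<Rightarrow> real \<Rightarrow> real" where
  "frechet_cdf v x = (if 0 < x then exp (- (x powr (- v))) else 0)"

definition frechet_pdf :: "real \<Rightarrow> real \<Rightarrow> real" where
  "frechet_pdf v x = v * x powr (- v - 1) * frechet_cdf v x"

definition kappa :: "(nat \<Rightarrow> real) \<Rightarrow> (nat \<Rightarrow> real) \<Rightarrow> (nat \<Rightarrow> real) \<Rightarrow> real" where
  "kappa p v \<beta> = p 1 * student_C (v 1) * v 1 powr ((v 1 - 1) / 2)
     * student_cdf (v 1 + 1) (\<beta> 1 * sqrt (v 1 + 1))"

definition norming ::
    "(nat \<Rightarrow> real) \<Rightarrow> (nat \<Rightarrow> real) \<Rightarrow> (nat \<Rightarrow> real) \<Rightarrow> nat \<Rightarrow> real" where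
  "norming p v \<beta> n =
     (2 * p 1 * student_C (v 1) * student_cdf (v 1 + 1) (\<beta> 1 * sqrt (v 1 + 1))) powr (1 / v 1)
     * v 1 powr ((v 1 - 1) / (2 * v 1)) * real n powr (1 / v 1)"

definition normalized_max_pdf ::
    "nat \<Rightarrow> (nat \<Rightarrow> real) \<Rightarrow> (nat \<Rightarrow> real) \<Rightarrow> (nat \<Rightarrow> real) \<Rightarrow> nat \<Rightarrow> real \<Rightarrow> real" where
  "normalized_max_pdf r p v \<beta> n x =
     real n * norming p v \<beta> n * mstd_cdf r p v \<beta> (norming p v \<beta> n * x) ^ (n - 1)
     * mstd_pdf r p v \<beta> (norming p v \<beta> n * x)"

definition pdf_error ::
    "nat \<Rightarrow> (nat \<Rightarrow> real) \<Rightarrow> (nat \<Rightarrow> real) \<Rightarrow> (nat \<Rightarrow> real) \<Rightarrow> nat \<Rightarrow> real \<Rightarrow> real" where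
  "pdf_error r p v \<beta> n x = normalized_max_pdf r p v \<beta> n x - frechet_pdf (v 1) x"

definition A1 :: "(nat \<Rightarrow> real) \<Rightarrow> (nat \<Rightarrow> real) \<Rightarrow> real" where
  "A1 v \<beta> =
     - (student_C (v 1 + 1) * (v 1)\<^sup>2 * sqrt (v 1 + 1) * \<beta> 1
          * (1 + (\<beta> 1)\<^sup>2) powr (- ((v 1 + 2) / 2)))
         / (2 * student_cdf (v 1 + 1) (\<beta> 1 * sqrt (v 1 + 1)) * (v 1 + 2))
     - (v 1)\<^sup>2 * (v 1 + 1) / (2 * (v 1 + 2))"

definition A2 :: "(nat \<Rightarrow> real) \<Rightarrow> (nat \<Rightarrow> real) \<Rightarrow> real" where
  "A2 v \<beta> =
     (student_C (v 1 + 1) * sqrt (v 1 + 1) * \<beta> 1 * (1 + (\<beta> 1)\<^sup>2) powr (- ((v 1 + 2) / 2)))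
       / student_cdf (v 1 + 1) (\<beta> 1 * sqrt (v 1 + 1))
     * ((v 1) ^ 3 * (v 1 - 1) / (4 * (v 1 + 2)) + 3 * (v 1)\<^sup>2 / 8
        - 3 * (v 1)\<^sup>2 / ((v 1 + 2) * (v 1 + 4))
        - (v 1 + 2) * (\<beta> 1)\<^sup>2 * (v 1) ^ 3 / (8 * (v 1 + 4) * (1 + (\<beta> 1)\<^sup>2)))
     + (v 1)\<^sup>2 * ((v 1)\<^sup>2 - 1) / 8 + 3 * (v 1)\<^sup>2 / ((v 1 + 2) * (v 1 + 4))
     + (v 1)\<^sup>2 * (v 1 - 1) / (2 * (v 1 + 2))"

definition A3 :: "(nat \<Rightarrow> real) \<Rightarrow> (nat \<Rightarrow> real) \<Rightarrow> (nat \<Rightarrow> real) \<Rightarrow> real" where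
  "A3 p v \<beta> =
     (p 2 * student_C (v 2) * v 2 powr ((v 2 - 1) / 2)
        * student_cdf (v 2 + 1) (\<beta> 2 * sqrt (v 2 + 1)))
     / (p 1 * student_C (v 1) * v 1 powr ((v 1 - 1) / 2)
        * student_cdf (v 1 + 1) (\<beta> 1 * sqrt (v 1 + 1)))"

definition A4 :: "(nat \<Rightarrow> real) \<Rightarrow> (nat \<Rightarrow> real) \<Rightarrow> (nat \<Rightarrow> real) \<Rightarrow> real" where
  "A4 p v \<beta> =
     - A3 p v \<beta> *
       ((student_C (v 2 + 1) * (v 2)\<^sup>2 * sqrt (v 2 + 1) * \<beta> 2
           * (1 + (\<beta> 2)\<^sup>2) powr (- ((v 2 + 2) / 2)))
          / (2 * (v 2 + 2) * student_cdf (v 2 + 1) (\<beta> 2 * sqrt (v 2 + 1)))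
        + (v 2)\<^sup>2 * (v 2 + 1) / (2 * (v 2 + 2)))"

definition A5 :: "(nat \<Rightarrow> real) \<Rightarrow> (nat \<Rightarrow> real) \<Rightarrow> (nat \<Rightarrow> real) \<Rightarrow> real" where
  "A5 p v \<beta> =
     (p 3 * student_C (v 3) * v 3 powr ((v 3 - 1) / 2)
        * student_cdf (v 3 + 1) (\<beta> 3 * sqrt (v 3 + 1)))
     / (p 1 * student_C (v 1) * v 1 powr ((v 1 - 1) / 2)
        * student_cdf (v 1 + 1) (\<beta> 1 * sqrt (v 1 + 1)))"

definition K1 :: "(nat \<Rightarrow> real) \<Rightarrow> (nat \<Rightarrow> real) \<Rightarrow> real" where
  "K1 v \<beta> =
     - (v 1 * (student_cdf (v 1 + 1) (\<beta> 1 * sqrt (v 1 + 1)) * (v 1 + 1)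
         + student_C (v 1 + 1) * (1 + (\<beta> 1)\<^sup>2) powr (- ((v 1 + 2) / 2))
           * \<beta> 1 * sqrt (v 1 + 1)))
       / (2 * student_cdf (v 1 + 1) (\<beta> 1 * sqrt (v 1 + 1)))"

definition K2 :: "(nat \<Rightarrow> real) \<Rightarrow> (nat \<Rightarrow> real) \<Rightarrow> (nat \<Rightarrow> real) \<Rightarrow> real" where
  "K2 p v \<beta> =
     - (p 2 * student_C (v 2) * v 2 powr ((v 2 + 3) / 2)
         * (student_cdf (v 2 + 1) (\<beta> 2 * sqrt (v 2 + 1)) * (v 2 + 1)
            + student_C (v 2 + 1) * \<beta> 2 * sqrt (v 2 + 1)
              * (1 + (\<beta> 2)\<^sup>2) powr (- ((v 2 + 2) / 2))))
       / (2 * p 1 * student_C (v 1) * v 1 powr ((v 1 + 1) / 2)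
          * student_cdf (v 1 + 1) (\<beta> 1 * sqrt (v 1 + 1)))"

definition K3 :: "(nat \<Rightarrow> real) \<Rightarrow> (nat \<Rightarrow> real) \<Rightarrow> real" where
  "K3 v \<beta> =
     ((v 1)\<^sup>2 * (v 1 + 3) * (v 1 + 1) / 8 * student_cdf (v 1 + 1) (\<beta> 1 * sqrt (v 1 + 1))
      + student_C (v 1 + 1) * \<beta> 1 * sqrt (v 1 + 1) * (1 + (\<beta> 1)\<^sup>2) powr (- ((v 1 + 2) / 2))
        * ((2 * (v 1) ^ 3 + (v 1) ^ 3 * (\<beta> 1)\<^sup>2 + 3 * (v 1)\<^sup>2 * (\<beta> 1)\<^sup>2 + 5 * (v 1)\<^sup>2)
           / (8 * (1 + (\<beta> 1)\<^sup>2))))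
     / student_cdf (v 1 + 1) (\<beta> 1 * sqrt (v 1 + 1))"

definition s1 ::
    "(nat \<Rightarrow> real) \<Rightarrow> (nat \<Rightarrow> real) \<Rightarrow> (nat \<Rightarrow> real) \<Rightarrow> real \<Rightarrow> real" where
  "s1 p v \<beta> x = kappa p v \<beta> * (2 - x powr (- v 1)) * x powr (- v 1)"

definition q1 ::
    "(nat \<Rightarrow> real) \<Rightarrow> (nat \<Rightarrow> real) \<Rightarrow> (nat \<Rightarrow> real) \<Rightarrow> real \<Rightarrow> real" where
  "q1 p v \<beta> x =
     (of_bool (0 < v 1 \<and> v 1 < 1 \<and> 2 * v 1 < v 2 \<and> v 2 \<le> 3 * v 1)
      + of_bool (1 \<le> v 1 \<and> v 1 < 2 \<and> 2 * v 1 < v 2 \<and> v 2 \<le> v 1 + 2))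
       * (v 2 / v 1 * x powr (- (v 2 - v 1)) - x powr (- v 2)) * A3 p v \<beta>
     + of_bool (1 \<le> v 1 \<and> v 1 < 2 \<and> v 2 \<ge> v 1 + 2)
       * (K1 v \<beta> * x powr (- 2) - A1 v \<beta> * x powr (- v 1 - 2))
     + of_bool (0 < v 1 \<and> v 1 \<le> 1 \<and> v 2 \<ge> 3 * v 1)
       * (kappa p v \<beta>)\<^sup>2
       * (4 - 10 / 3 * x powr (- v 1) + 1 / 2 * x powr (- 2 * v 1)) * x powr (- 2 * v 1)"

definition s2 :: "(nat \<Rightarrow> real) \<Rightarrow> (nat \<Rightarrow> real) \<Rightarrow> real \<Rightarrow> real" where
  "s2 v \<beta> x = K1 v \<beta> * x powr (- 2) - A1 v \<beta> * x powr (- v 1 - 2)"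

definition q2 ::
    "(nat \<Rightarrow> real) \<Rightarrow> (nat \<Rightarrow> real) \<Rightarrow> (nat \<Rightarrow> real) \<Rightarrow> real \<Rightarrow> real" where
  "q2 p v \<beta> x =
     of_bool (v 1 \<ge> 4 \<and> v 2 \<ge> v 1 + 4)
       * (K3 v \<beta> * x powr (- 4) - (A2 v \<beta> + K1 v \<beta> * A1 v \<beta>) * x powr (- v 1 - 4)
          + 1 / 2 * (A1 v \<beta>)\<^sup>2 * x powr (- 2 * v 1 - 4))
     + (of_bool (v 1 \<ge> 4 \<and> v 1 + 2 < v 2 \<and> v 2 \<le> v 1 + 4)
        + of_bool (2 < v 1 \<and> v 1 < 4 \<and> v 1 + 2 < v 2 \<and> v 2 \<le> 2 * v 1))
       * A3 p v \<beta> * (v 2 / v 1 * x powr (- (v 2 - v 1)) - x powr (- v 2))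
     + of_bool (2 < v 1 \<and> v 1 \<le> 4 \<and> v 2 \<ge> 2 * v 1)
       * kappa p v \<beta> * (2 - x powr (- v 1)) * x powr (- v 1)"

definition s3 ::
    "(nat \<Rightarrow> real) \<Rightarrow> (nat \<Rightarrow> real) \<Rightarrow> (nat \<Rightarrow> real) \<Rightarrow> real \<Rightarrow> real" where
  "s3 p v \<beta> x = (v 2 / v 1 * x powr (- (v 2 - v 1)) - x powr (- v 2)) * A3 p v \<beta>"

text \<open>
  The second-order term with coefficient \<open>(A3 p v \<beta>)\<^sup>2\<close> is present exactly when
  \<open>2 * (v 2 - v 1)\<close> attains the minimum of \<open>2\<close>, \<open>v 1\<close>, \<open>2 * (v 2 - v 1)\<close>, \<open>v 3 - v 1\<close>, and then
  it is present once. The last of the four indicators of that term therefore reads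
  \<open>v 1 \<ge> 2\<close> and \<open>v 3 < v 1 + 2\<close>. The version with \<open>v 1 > 2\<close> and \<open>v 3 \<le> v 1 + 2\<close> found in the
  source drops the term for \<open>v 1 = 2\<close>, \<open>v 3 < 4\<close>, and counts it twice for \<open>v 1 > 2\<close>,
  \<open>v 3 = v 1 + 2\<close> (there the third indicator holds as well); elsewhere the two versions agree.
\<close>

definition q3 ::
    "(nat \<Rightarrow> real) \<Rightarrow> (nat \<Rightarrow> real) \<Rightarrow> (nat \<Rightarrow> real) \<Rightarrow> real \<Rightarrow> real" where
  "q3 p v \<beta> x =
     (of_bool (0 < v 1 \<and> v 1 < 2 \<and> (v 1 + v 3) / 2 \<le> v 2 \<and> v 2 < 2 * v 1 \<and> v 3 \<le> 2 * v 1)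
      + of_bool (v 1 \<ge> 2 \<and> (v 1 + v 3) / 2 \<le> v 2 \<and> v 2 < v 1 + 2 \<and> v 3 \<le> 2 + v 1))
       * (v 3 / v 1 * x powr (- (v 3 - v 1)) - x powr (- v 3)) * A5 p v \<beta>
     + of_bool (0 < v 1 \<and> v 1 \<le> 2 \<and> 3 / 2 * v 1 \<le> v 2 \<and> v 2 < 2 * v 1 \<and> v 3 \<ge> 2 * v 1)
       * kappa p v \<beta> * (2 - x powr (- v 1)) * x powr (- v 1)
     + of_bool (v 1 \<ge> 2 \<and> v 1 + 1 \<le> v 2 \<and> v 2 < v 1 + 2 \<and> v 3 \<ge> v 1 + 2)
       * (K1 v \<beta> * x powr (- 2) - A1 v \<beta> * x powr (- v 1 - 2))
     + (of_bool (0 < v 1 \<and> v 1 < 2 \<and> v 1 < v 2 \<and> v 2 \<le> 3 / 2 * v 1 \<and> v 3 \<ge> 2 * v 1)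
        + of_bool (0 < v 1 \<and> v 1 < 2 \<and> v 1 < v 2 \<and> v 2 \<le> (v 1 + v 3) / 2 \<and>
                   v 2 < v 3 \<and> v 3 < 2 * v 1)
        + of_bool (v 1 \<ge> 2 \<and> v 1 < v 2 \<and> v 2 \<le> v 1 + 1 \<and> v 3 \<ge> 2 + v 1)
        + of_bool (v 1 \<ge> 2 \<and> v 1 < v 2 \<and> v 2 \<le> (v 1 + v 3) / 2 \<and>
                   v 2 < v 3 \<and> v 3 < v 1 + 2))
       * (x powr (- 2 * v 2) / 2 - v 2 / v 1 * x powr (- 2 * v 2 + v 1)) * (A3 p v \<beta>)\<^sup>2"

definition s4 ::
    "(nat \<Rightarrow> real) \<Rightarrow> (nat \<Rightarrow> real) \<Rightarrow> (nat \<Rightarrow> real) \<Rightarrow> real \<Rightarrow> real" where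
  "s4 p v \<beta> x =
     - A1 v \<beta> * x powr (- 4) - 1 / 2 * p 1 * student_cdf 3 (sqrt 3 * \<beta> 1) * x powr (- 4)
     + K1 v \<beta> * x powr (- 2) + p 1 * student_cdf 3 (sqrt 3 * \<beta> 1) * x powr (- 2)"

definition q4 ::
    "(nat \<Rightarrow> real) \<Rightarrow> (nat \<Rightarrow> real) \<Rightarrow> (nat \<Rightarrow> real) \<Rightarrow> real \<Rightarrow> real" where
  "q4 p v \<beta> x =
     of_bool (4 < v 2 \<and> v 2 \<le> 6)
       * A3 p v \<beta> * (v 2 / 2 * x powr (- (v 2 - 2)) - x powr (- v 2))
     + of_bool (v 2 \<ge> 6)
       * (- (A2 v \<beta> + A1 v \<beta> * K1 v \<beta>
             + (2 * A1 v \<beta> + K1 v \<beta> / 2) * p 1 * student_cdf 3 (sqrt 3 * \<beta> 1)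
             + 5 / 6 * (p 1)\<^sup>2 * (student_cdf 3 (sqrt 3 * \<beta> 1))\<^sup>2) * x powr (- 6)
          + (K3 v \<beta> + (A1 v \<beta> + K1 v \<beta>) * p 1 * student_cdf 3 (sqrt 3 * \<beta> 1)
             + (p 1)\<^sup>2 * (student_cdf 3 (sqrt 3 * \<beta> 1))\<^sup>2) * x powr (- 4)
          + 1 / 8 * (2 * A1 v \<beta> + p 1 * student_cdf 3 (sqrt 3 * \<beta> 1))\<^sup>2 * x powr (- 8))"

definition s5 ::
    "(nat \<Rightarrow> real) \<Rightarrow> (nat \<Rightarrow> real) \<Rightarrow> (nat \<Rightarrow> real) \<Rightarrow> real \<Rightarrow> real" where
  "s5 p v \<beta> x =
     (K1 v \<beta> + A3 p v \<beta> * (1 + 2 / v 1)) * x powr (- 2)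
     - (A1 v \<beta> + A3 p v \<beta>) * x powr (- v 1 - 2)"

definition q5 ::
    "(nat \<Rightarrow> real) \<Rightarrow> (nat \<Rightarrow> real) \<Rightarrow> (nat \<Rightarrow> real) \<Rightarrow> real \<Rightarrow> real" where
  "q5 p v \<beta> x =
     of_bool (2 < v 1 \<and> v 1 \<le> 4 \<and> v 3 \<ge> 2 * v 1)
       * kappa p v \<beta> * (2 * x powr (- v 1) - x powr (- 2 * v 1))
     + (of_bool (2 < v 1 \<and> v 1 < 4 \<and> v 1 + 2 < v 3 \<and> v 3 \<le> 2 * v 1)
        + of_bool (v 1 \<ge> 4 \<and> v 1 + 2 < v 3 \<and> v 3 \<le> v 1 + 4))
       * (v 3 / v 1 * x powr (- (v 3 - v 1)) - x powr (- v 3)) * A5 p v \<beta>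
     + of_bool (v 1 \<ge> 4 \<and> v 3 \<ge> v 1 + 4)
       * (1 / 2 * (A1 v \<beta> + A3 p v \<beta>)\<^sup>2 * x powr (- 2 * v 1 - 4)
          + (K2 p v \<beta> + K3 v \<beta>) * x powr (- 4)
          - (((1 + 2 / v 1) * A3 p v \<beta> + K1 v \<beta>) * (A1 v \<beta> + A3 p v \<beta>) + A2 v \<beta> + A4 p v \<beta>)
            * x powr (- v 1 - 4))"

definition s6 ::
    "(nat \<Rightarrow> real) \<Rightarrow> (nat \<Rightarrow> real) \<Rightarrow> (nat \<Rightarrow> real) \<Rightarrow> real \<Rightarrow> real" where
  "s6 p v \<beta> x =
     kappa p v \<beta> * (2 * x powr (- v 1) - x powr (- 2 * v 1))
     + A3 p v \<beta> * (2 * x powr (- v 1) - x powr (- 2 * v 1))"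

definition q6 ::
    "(nat \<Rightarrow> real) \<Rightarrow> (nat \<Rightarrow> real) \<Rightarrow> (nat \<Rightarrow> real) \<Rightarrow> real \<Rightarrow> real" where
  "q6 p v \<beta> x =
     of_bool (1 \<le> v 1 \<and> v 1 < 2 \<and> v 3 \<ge> v 1 + 2)
       * (K1 v \<beta> * x powr (- 2) - A1 v \<beta> * x powr (- v 1 - 2))
     + (of_bool (0 < v 1 \<and> v 1 < 1 \<and> 2 * v 1 < v 3 \<and> v 3 \<le> 3 * v 1)
        + of_bool (1 \<le> v 1 \<and> v 1 < 2 \<and> 2 * v 1 < v 3 \<and> v 3 \<le> v 1 + 2))
       * A5 p v \<beta> * (v 3 / v 1 * x powr (- (v 3 - v 1)) - x powr (- v 3))
     + of_bool (0 < v 1 \<and> v 1 \<le> 1 \<and> v 3 \<ge> 3 * v 1)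
       * ((kappa p v \<beta>)\<^sup>2 * x powr (- 2 * v 1) * (4 - 10 / 3 * x powr (- v 1))
          + 6 * kappa p v \<beta> * A3 p v \<beta> * (- (x powr (- 3 * v 1)) + x powr (- 2 * v 1))
          - 2 * (A3 p v \<beta>)\<^sup>2 * x powr (- 3 * v 1)
          + 1 / 2 * (A3 p v \<beta> + kappa p v \<beta>)\<^sup>2 * x powr (- 4 * v 1))"

definition s7 ::
    "(nat \<Rightarrow> real) \<Rightarrow> (nat \<Rightarrow> real) \<Rightarrow> (nat \<Rightarrow> real) \<Rightarrow> real \<Rightarrow> real" where
  "s7 p v \<beta> x =
     (K1 v \<beta> + 2 * A3 p v \<beta> + p 1 * student_cdf 3 (sqrt 3 * \<beta> 1)) * x powr (- 2)
     - (A1 v \<beta> + A3 p v \<beta> + 1 / 2 * p 1 * student_cdf 3 (sqrt 3 * \<beta> 1)) * x powr (- 4)"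

definition q7 ::
    "(nat \<Rightarrow> real) \<Rightarrow> (nat \<Rightarrow> real) \<Rightarrow> (nat \<Rightarrow> real) \<Rightarrow> real \<Rightarrow> real" where
  "q7 p v \<beta> x =
     of_bool (4 < v 3 \<and> v 3 \<le> 6)
       * A5 p v \<beta> * (v 3 / 2 * x powr (- (v 3 - 2)) - x powr (- v 3))
     + of_bool (v 3 \<ge> 6)
       * (1 / 2 * (A1 v \<beta> + A3 p v \<beta> + 1 / 2 * p 1 * student_cdf 3 (sqrt 3 * \<beta> 1))\<^sup>2
            * x powr (- 8)
          - (A4 p v \<beta> + A2 v \<beta> + 2 * (A3 p v \<beta>)\<^sup>2 + 2 * A1 v \<beta> * A3 p v \<beta>
             + A1 v \<beta> * K1 v \<beta> + A3 p v \<beta> * K1 v \<beta>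
             + (2 * A1 v \<beta> + 3 * A3 p v \<beta> + K1 v \<beta> / 2) * p 1 * student_cdf 3 (sqrt 3 * \<beta> 1)
             + 5 / 6 * (p 1)\<^sup>2 * (student_cdf 3 (sqrt 3 * \<beta> 1))\<^sup>2) * x powr (- 6)
          + (K2 p v \<beta> + K3 v \<beta>
             + (A1 v \<beta> + K1 v \<beta> + 3 * A3 p v \<beta>) * p 1 * student_cdf 3 (sqrt 3 * \<beta> 1)
             + (p 1)\<^sup>2 * (student_cdf 3 (sqrt 3 * \<beta> 1))\<^sup>2) * x powr (- 4))"

end

theory Submission
  imports Defs "HOL-Real_Asymp.Real_Asymp"
begin

text \<open>
  Write \<open>a\<close> for the norming sequence, \<open>w = x powr (- v 1)\<close> and \<open>\<kappa> = kappa p v \<beta>\<close>, so that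
  \<open>a powr v 1 = 2 * \<kappa> * n\<close>. Everything rests on two expansions at infinity, for the tail and for the
  density of the mixture:
  \<open>1 - F y = 2 * \<kappa> * y powr (- v 1) * (1 + A y)\<close> and
  \<open>f y = 2 * \<kappa> * v 1 * y powr (- v 1 - 1) * (1 + B y)\<close>,
  where, to the precision needed, \<open>A\<close> and \<open>B\<close> are sums of powers of \<open>y\<close> with exponents \<open>-2\<close> and \<open>-4\<close>
  (from the shape of the first component), \<open>- (v i - v 1)\<close> and \<open>- (v i - v 1 + 2)\<close> (from the other
  components). Since \<open>\<tau> = n * (1 - F (a * x)) = w * (1 + A (a * x))\<close>, taking the logarithm of
  \<open>(1 - \<tau> / n) ^ (n - 1)\<close> shows that the density of the maximum is the Frechet density times
  \<open>(1 + B) * exp (- w * A + (\<tau> - \<tau>\<^sup>2 / 2) / n + (\<tau>\<^sup>2 / 2 - \<tau> ^ 3 / 3) / n\<^sup>2)\<close>,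
  up to an error of smaller order than \<open>1 / n\<^sup>2\<close>. As \<open>1 / n = 2 * \<kappa> * a powr (- v 1)\<close> is again a power
  of \<open>a\<close>, three small quantities compete: the shape correction of order \<open>a powr (- 2)\<close>, the sample
  size correction of order \<open>a powr (- v 1)\<close>, and the correction of order \<open>a powr (- (v 2 - v 1))\<close>
  caused by the second component. The seven parts of the theorem are the seven ways in which one or
  several of them can be the largest: each alone, each pair tied, and all three tied. In every part
  the leading exponent \<open>d\<close> and the next exponent \<open>m\<close> satisfy \<open>d < m \<le> 2 * d\<close>, so products of two
  corrections can matter only when \<open>m = 2 * d\<close>, and products of three never do.

  The analytic input is that the skew-t density integrates to one and that its cdf has it as
  derivative (\<open>nn_integral_skewt_pdf\<close>, \<open>skewt_cdf_has_real_derivative\<close>), followed by a Taylor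
  expansion of the density in the variable \<open>y powr (- 2)\<close> (\<open>skewt_pdf_expansion\<close>) and its integration over
  the tail (\<open>skewt_cdf_expansion\<close>). The locale \<open>two_scale\<close> provides the arithmetic of expansions
  \<open>c1 * a powr (- d) + c2 * a powr (- m)\<close> with an error \<open>o(a powr (- m))\<close>; with it
  \<open>pdf_error_second_order\<close> treats all regimes at once, and \<open>pdf_error_limit\<close> restates the result in terms of the constants \<open>A1\<close>, ..., \<open>K3\<close>. Each regime is then
  a matter of finding which powers coincide with \<open>d\<close> or \<open>m\<close>.
\<close>

section \<open>Distributions given by a continuous density\<close>

lemma
  fixes f :: "real \<Rightarrow> real"
  assumes cont: "continuous_on UNIV f" and nonneg: "\<And>x. 0 \<le> f x"
    and mass: "(\<integral>\<^sup>+x. ennreal (f x) \<partial>lborel) = 1"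
  shows real_distribution_density: "real_distribution (density lborel (\<lambda>x. ennreal (f x)))"
    and cdf_density_has_real_derivative:
      "(cdf (density lborel (\<lambda>x. ennreal (f x))) has_real_derivative f x) (at x)"
proof -
  let ?M = "density lborel (\<lambda>x. ennreal (f x))"
  have meas [measurable]: "f \<in> borel_measurable borel"
    using cont by (rule borel_measurable_continuous_onI)
  interpret prob_space ?M
    by (rule prob_spaceI) (use mass in \<open>simp add: emeasure_density\<close>)
  show rd: "real_distribution ?M"
    by standard simp
  interpret real_distribution ?M by (rule rd)
  \<comment> \<open>An antiderivative on a larger interval has a two-sided derivative throughout the smaller one.\<close>
  obtain G where G: "\<And>t. t \<in> {x-2..x+2} \<Longrightarrow> (G has_vector_derivative f t) (at t within {x-2..x+2})"
    using antiderivative_continuous[of "x-2" "x+2" f] cont continuous_on_subset by blast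
  have G': "(G has_real_derivative f t) (at t)" if "t \<in> {x-1..x+1}" for t
  proof -
    have "(G has_real_derivative f t) (at t within {x-2..x+2})"
      using G[of t] that by (simp add: has_real_derivative_iff_has_vector_derivative)
    moreover have "at t within {x-2..x+2} = at t"
      using that by (intro at_within_interior) auto
    ultimately show ?thesis by simp
  qed
  have eq: "cdf ?M y = cdf ?M (x-1) + (G y - G (x-1))" if "y \<in> {x-1<..<x+1}" for y
  proof -
    have "has_bochner_integral lborel (\<lambda>t. f t * indicator {x-1..y} t) (G y - G (x-1))"
      using that nonneg meas continuous_on_subset[OF cont]
      by (intro has_bochner_integral_FTC_Icc_nonneg G')
         (auto intro: continuous_on_interior[of UNIV] simp: continuous_on_eq_continuous_at)
    then have int: "(\<integral>\<^sup>+t. ennreal (f t * indicator {x-1..y} t) \<partial>lborel) = ennreal (G y - G (x-1))"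
      by (subst nn_integral_eq_integral) (auto simp: has_bochner_integral_iff nonneg)
    have le: "G (x-1) \<le> G y"
      using that G' nonneg by (intro DERIV_nonneg_imp_nondecreasing[of "x-1" y G]) force+
    have "emeasure ?M {x-1<..y} = (\<integral>\<^sup>+t. ennreal (f t * indicator {x-1..y} t) \<partial>lborel)"
      by (subst emeasure_density, simp, simp, rule nn_integral_cong_AE,
          rule AE_mp[OF AE_lborel_singleton[of "x-1"]]) (auto simp: indicator_def)
    then have "measure ?M {x-1<..y} = G y - G (x-1)"
      using int le by (simp add: measure_def)
    then show ?thesis using cdf_diff_eq[of "x-1" y] that by simp
  qed
  have "((\<lambda>y. cdf ?M (x-1) + (G y - G (x-1))) has_real_derivative f x) (at x)"
    by (auto intro!: derivative_eq_intros G')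
  then show "(cdf ?M has_real_derivative f x) (at x)"
    by (rule has_field_derivative_transform_within_open[of _ _ _ "{x-1<..<x+1}"]) (auto simp: eq)
qed

section \<open>The Student t distribution\<close>

text \<open>
  The substitution \<open>s = 1/2 + x / (2 * sqrt (v + x\<^sup>2))\<close> maps the whole line smoothly and increasingly
  onto \<open>(0, 1)\<close>. Since \<open>s * (1 - s) = 1 / (4 * (1 + x\<^sup>2 / v))\<close>, the integral becomes a symmetric Beta
  integral with both parameters \<open>v / 2\<close>.
\<close>

lemma nn_integral_student_kernel:
  fixes v :: real
  assumes v: "v > 0"
  shows "(\<integral>\<^sup>+x. ennreal ((1 + x\<^sup>2 / v) powr (- ((v + 1) / 2))) \<partial>lborel)
         = ennreal (sqrt v * 2 powr (v - 1) * Beta (v / 2) (v / 2))"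
proof -
  define g where "g = (\<lambda>t::real. t powr (v/2 - 1) * (1 - t) powr (v/2 - 1))"
  define B where "B = (\<lambda>y. integral {0..y} g)"
  define s where "s = (\<lambda>x. 1/2 + x / (2 * sqrt (v + x\<^sup>2)))"
  define c where "c = sqrt v * 2 powr (v - 1)"
  define f where "f = (\<lambda>x::real. (1 + x\<^sup>2 / v) powr (- ((v + 1) / 2)))"
  have hi: "(g has_integral Beta (v/2) (v/2)) {0..1}"
    unfolding g_def using has_integral_Beta_real[of "v/2" "v/2"] v by simp
  have pos: "v + x\<^sup>2 > 0" for x using v by (simp add: add_pos_nonneg)
  have sq: "sqrt (v + x\<^sup>2) > \<bar>x\<bar>" for x
    using v by (intro real_less_rsqrt) simp
  have s01: "s x \<in> {0<..<1}" for x
  proof -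
    have "\<bar>x / sqrt (v + x\<^sup>2)\<bar> < 1" using sq[of x] by (simp add: divide_less_eq_1) (use pos[of x] sq[of x]
        in linarith)
    then show ?thesis unfolding s_def by (auto simp: abs_less_iff divide_simps)
  qed
  have s1: "s x * (1 - s x) = (1 + x\<^sup>2 / v) powr (-1) / 4" for x
  proof -
    have "s x * (1 - s x) = (1 - x\<^sup>2 / (sqrt (v + x\<^sup>2))\<^sup>2) / 4"
    proof -
      have "s x = 1/2 + (x / sqrt (v + x\<^sup>2)) / 2" by (simp add: s_def)
      moreover have "(1/2 + q / 2) * (1 - (1/2 + q / 2)) = (1 - q\<^sup>2) / 4" for q :: real
        by (simp add: power2_eq_square field_simps)
      ultimately show ?thesis by (simp only: power_divide[symmetric])
    qed
    also have "(sqrt (v + x\<^sup>2))\<^sup>2 = v + x\<^sup>2" using pos[of x] by simp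
    also have "(1 - x\<^sup>2 / (v + x\<^sup>2)) = (1 + x\<^sup>2 / v) powr (-1)"
    proof -
      have "v + x\<^sup>2 \<noteq> 0" using pos[of x] by linarith
      then show ?thesis using v by (simp add: powr_minus_divide divide_simps add_pos_nonneg)
    qed
    finally show ?thesis .
  qed
  have sd: "(s has_real_derivative ((1 + x\<^sup>2 / v) powr (-3/2) / (2 * sqrt v))) (at x)" for x
  proof -
    have q: "sqrt (v + x\<^sup>2) = sqrt v * (1 + x\<^sup>2/v) powr (1/2)"
    proof -
      have "v + x\<^sup>2 = v * (1 + x\<^sup>2/v)" using v by (simp add: field_simps)
      moreover have "sqrt (1 + x\<^sup>2/v) = (1 + x\<^sup>2/v) powr (1/2)"
        using v by (intro powr_half_sqrt[symmetric]) simp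
      ultimately show ?thesis by (simp add: real_sqrt_mult)
    qed
    have "(s has_real_derivative ((2 * sqrt (v + x\<^sup>2) - x * (2 * (x / sqrt (v + x\<^sup>2)))) / (2
        * sqrt (v + x\<^sup>2))\<^sup>2)) (at x)"
    proof -
      have "((\<lambda>x. 2 * sqrt (v + x\<^sup>2)) has_real_derivative 2 * (x / sqrt (v + x\<^sup>2))) (at x)"
        using pos[of x] by (auto intro!: derivative_eq_intros simp: divide_simps)
      from DERIV_add[OF DERIV_const[of "1/2"] DERIV_divide[OF DERIV_ident this]] pos[of x]
      show ?thesis by (simp add: s_def power2_eq_square)
    qed
    also have "(2 * sqrt (v + x\<^sup>2) - x * (2 * (x / sqrt (v + x\<^sup>2)))) / (2 * sqrt (v + x\<^sup>2))\<^sup>2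
        = v / (2 * sqrt (v + x\<^sup>2) ^ 3)"
    proof -
      have "2 * sqrt (v + x\<^sup>2) - x * (2 * (x / sqrt (v + x\<^sup>2))) = 2 * ((sqrt (v + x\<^sup>2))\<^sup>2 - x\<^sup>2) / sqrt (v
          + x\<^sup>2)"
        using pos[of x] sq[of x] by (simp add: field_simps power2_eq_square)
      also have "(sqrt (v + x\<^sup>2))\<^sup>2 - x\<^sup>2 = v" using pos[of x] by simp
      finally have "2 * sqrt (v + x\<^sup>2) - x * (2 * (x / sqrt (v + x\<^sup>2))) = 2 * v / sqrt (v + x\<^sup>2)" .
      moreover have "2 * v / r / (2 * r)\<^sup>2 = v / (2 * r ^ 3)" if "r > 0" for r :: real
        using that by (simp add: field_simps power2_eq_square power3_eq_cube)
      ultimately show ?thesis using pos[of x] real_sqrt_gt_zero by metis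
    qed
    also have "\<dots> = (1 + x\<^sup>2 / v) powr (-3/2) / (2 * sqrt v)"
    proof -
      have p3: "((1 + x\<^sup>2/v) powr (1/2)) ^ 3 = (1 + x\<^sup>2/v) powr (3/2)"
        using powr_powr[of "1 + x\<^sup>2/v" "1/2" 3] by simp
      have v3: "sqrt v ^ 3 = v * sqrt v" using v by (simp add: power3_eq_cube)
      have "(1 + x\<^sup>2 / v) powr (-3/2) = 1 / (1 + x\<^sup>2/v) powr (3/2)"
        using powr_minus_divide[of "1 + x\<^sup>2/v" "3/2"] by simp
      then show ?thesis unfolding q power_mult_distrib p3 v3 using v by simp
    qed
    finally show ?thesis .
  qed
  have Bd: "(B has_real_derivative g y) (at y)" if "y \<in> {0<..<1}" for y
  proof -
    have "((\<lambda>u. integral {0..u} g) has_vector_derivative g y) (at y within {0..1})"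
    proof (rule integral_has_vector_derivative_continuous_at[where S = "{}", simplified])
      show "continuous (at y within {0..1}) g"
        unfolding g_def using that by (intro continuous_intros) auto
    qed (use that hi in auto)
    moreover have "at y within {0..1} = at y"
      using that by (intro at_within_interior) auto
    ultimately show ?thesis
      by (simp add: B_def has_real_derivative_iff_has_vector_derivative)
  qed
  have Bc: "continuous_on {0..1} B"
    unfolding B_def using hi by (intro indefinite_integral_continuous_1) auto
  have key: "c * (g (s x) * ((1 + x\<^sup>2 / v) powr (-3/2) / (2 * sqrt v))) = f x" for x
  proof -
    have "g (s x) = (s x * (1 - s x)) powr (v/2 - 1)"
      unfolding g_def using s01[of x] by (simp add: powr_mult)
    also have "\<dots> = ((1 + x\<^sup>2 / v) powr (-1)) powr (v/2 - 1) / 4 powr (v/2-1)"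
      unfolding s1 by (rule powr_divide)
    also have "((1 + x\<^sup>2 / v) powr (-1)) powr (v/2 - 1) = (1 + x\<^sup>2 / v) powr (1 - v/2)"
      unfolding powr_powr by simp
    also have "(4::real) powr (v/2-1) = 2 powr (v - 2)"
      using powr_powr[of 2 2 "v/2-1"] by (simp add: algebra_simps)
    finally have g: "g (s x) = (1 + x\<^sup>2 / v) powr (1 - v/2) / 2 powr (v - 2)" .
    have two: "(2::real) powr (v - 1) = 2 * 2 powr (v - 2)"
      using powr_add[of 2 1 "v - 2"] by simp
    have "f x = (1 + x\<^sup>2 / v) powr (1 - v/2) * (1 + x\<^sup>2 / v) powr (-3/2)"
      unfolding f_def powr_add[symmetric] by (rule arg_cong[of _ _ "\<lambda>e. _ powr e"]) (simp add: field_simps)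
    then show ?thesis using v by (simp add: g c_def two)
  qed
  define F where "F = (\<lambda>x. c * B (s x))"
  have Fd: "(F has_real_derivative f x) (at x)" for x
  proof -
    have "((\<lambda>x. B (s x)) has_real_derivative g (s x) * ((1 + x\<^sup>2 / v) powr (-3/2) / (2 * sqrt v))) (at x)"
      by (rule DERIV_chain2[OF Bd[OF s01] sd])
    then show ?thesis unfolding F_def key[symmetric] by (rule DERIV_cmult)
  qed
  have fc: "isCont f x" for x
    unfolding f_def using v pos[of x] by (intro continuous_intros) (auto simp: add_nonneg_eq_0_iff)
  have s_top: "(s \<longlongrightarrow> 1) at_top" unfolding s_def using v by real_asymp
  have s_bot: "(s \<longlongrightarrow> 0) at_bot" unfolding s_def using v by real_asymp
  have B0: "B 0 = 0" and B1: "B 1 = Beta (v/2) (v/2)"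
    using hi by (auto simp: B_def integral_unique)
  have F_top: "(F \<longlongrightarrow> c * Beta (v/2) (v/2)) at_top"
    unfolding F_def B1[symmetric]
    by (intro tendsto_mult tendsto_const continuous_on_tendsto_compose[OF Bc s_top])
       (use s01 in \<open>auto simp: less_imp_le intro!: always_eventually\<close>)
  have F_bot: "(F \<longlongrightarrow> c * B 0) at_bot"
    unfolding F_def
    by (intro tendsto_mult tendsto_const continuous_on_tendsto_compose[OF Bc s_bot])
       (use s01 in \<open>auto simp: less_imp_le intro!: always_eventually\<close>)
  \<comment> \<open>The antiderivative \<open>F\<close> has limits at both ends, so the fundamental theorem applies on the whole line.\<close>
  have int: "set_integrable lborel (einterval (-\<infinity>) \<infinity>) f" "(LBINT x=-\<infinity>..\<infinity>. f x) = c * Beta (v/2) (v/2)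
      - c * B 0"
    by (rule interval_integral_FTC_nonneg[of "-\<infinity>" \<infinity> F f];
        use Fd fc F_top F_bot in \<open>simp add: f_def ereal_tendsto_simps1\<close>)+
  then have "integrable lborel f" "integral\<^sup>L lborel f = c * Beta (v/2) (v/2)"
    using B0 by (auto simp: set_integrable_def interval_lebesgue_integral_def set_lebesgue_integral_def
        einterval_eq_UNIV)
  then show ?thesis
    unfolding f_def[symmetric] c_def by (subst nn_integral_eq_integral) (auto simp: f_def)
qed

text \<open>
  The Beta integral has parameters \<open>v / 2\<close>, \<open>v / 2\<close>, whereas the norming constant contains
  \<open>Gamma ((v + 1) / 2)\<close>; Legendre's duplication formula converts one into the other.
\<close>

lemma student_C_Beta:
  assumes "v > 0"
  shows "student_C v * (sqrt v * 2 powr (v - 1) * Beta (v / 2) (v / 2)) = 1"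
proof -
  let ?z = "complex_of_real (v/2)"
  have z: "?z \<notin> \<int>\<^sub>\<le>\<^sub>0" "?z + 1/2 \<notin> \<int>\<^sub>\<le>\<^sub>0"
    using assms by (auto elim!: nonpos_Ints_cases simp: complex_eq_iff)
  have "complex_of_real (Gamma (v/2) * Gamma ((v+1)/2))
      = complex_of_real (exp ((1 - v) * ln 2) * sqrt pi * Gamma v)"
    using Gamma_legendre_duplication[OF z]
    by (simp flip: Gamma_complex_of_real exp_of_real add: add_divide_distrib)
  then have "Gamma (v/2) * Gamma ((v+1)/2) = exp ((1 - v) * ln 2) * sqrt pi * Gamma v"
    by (simp only: of_real_eq_iff)
  also have "exp ((1 - v) * ln 2) = 1 / 2 powr (v - 1)"
    by (simp add: powr_def exp_minus[symmetric] divide_inverse algebra_simps)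
  finally have dup0: "Gamma (v/2) * Gamma ((v+1)/2) = 1 / 2 powr (v - 1) * sqrt pi * Gamma v" .
  have dup: "Gamma ((v+1)/2) = sqrt pi * Gamma v / (2 powr (v - 1) * Gamma (v/2))"
  proof -
    have rearrange: "G = s * w / (t * g)" if "g * G = 1 / t * s * w" "g > 0" "t > 0" for G g s t w :: real
      using that by (simp add: field_simps)
    show ?thesis by (rule rearrange[OF dup0 Gamma_real_pos]) (use assms in auto)
  qed
  have cancel: "s * w / (t * g) / (g * (q * s)) * (q * t * (g * g / w)) = 1"
    if "g > 0" "w > 0" "t > 0" "s > 0" "q > 0" for g w t s q :: real
    using that by simp
  show ?thesis
    unfolding student_C_def Beta_def dup real_sqrt_mult field_sum_of_halves
    by (rule cancel) (use assms in auto)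
qed

lemma student_C_pos: "v > 0 \<Longrightarrow> student_C v > 0"
  by (simp add: student_C_def)

lemma student_pdf_pos: "v > 0 \<Longrightarrow> student_pdf v x > 0"
  by (auto simp: student_pdf_def student_C_pos add_nonneg_eq_0_iff intro!: mult_pos_pos)

lemma continuous_student_pdf: "v > 0 \<Longrightarrow> continuous_on UNIV (student_pdf v)"
  unfolding student_pdf_def by (intro continuous_intros) (auto simp: add_nonneg_eq_0_iff)

lemma nn_integral_student_pdf:
  assumes "v > 0"
  shows "(\<integral>\<^sup>+x. ennreal (student_pdf v x) \<partial>lborel) = 1"
proof -
  have "(\<integral>\<^sup>+x. ennreal (student_pdf v x) \<partial>lborel)
      = ennreal (student_C v) * (\<integral>\<^sup>+x. ennreal ((1 + x\<^sup>2 / v) powr (- ((v + 1) / 2))) \<partial>lborel)"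
    unfolding student_pdf_def using student_C_pos[OF assms]
    by (subst nn_integral_cmult[symmetric]) (auto simp: ennreal_mult)
  also have "\<dots> = 1"
    using student_C_pos[OF assms] student_C_Beta[OF assms]
    by (simp add: nn_integral_student_kernel[OF assms] ennreal_mult'[symmetric])
  finally show ?thesis .
qed

lemma real_distribution_student:
  "v > 0 \<Longrightarrow> real_distribution (density lborel (\<lambda>x. ennreal (student_pdf v x)))"
  by (intro real_distribution_density continuous_student_pdf nn_integral_student_pdf less_imp_le
      student_pdf_pos)

lemma student_cdf_has_real_derivative:
  "v > 0 \<Longrightarrow> (student_cdf v has_real_derivative student_pdf v x) (at x)"
  unfolding student_cdf_def
  by (intro cdf_density_has_real_derivative continuous_student_pdf nn_integral_student_pdf less_imp_le
      student_pdf_pos)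

lemma student_cdf_pos:
  assumes "v > 0" shows "student_cdf v x > 0"
proof -
  have "student_cdf v (x - 1) < student_cdf v x"
    by (rule DERIV_pos_imp_increasing[of "x-1" x])
       (auto intro!: exI[of _ "student_pdf v _"] student_cdf_has_real_derivative student_pdf_pos assms)
  moreover have "0 \<le> student_cdf v (x - 1)" by (simp add: student_cdf_def cdf_def)
  ultimately show ?thesis by simp
qed

text \<open>
  The density is even, so the sum has derivative zero; its constant value is read off at infinity.
\<close>

lemma student_cdf_symmetric:
  assumes v: "v > 0"
  shows "student_cdf v x + student_cdf v (- x) = 1"
proof -
  interpret real_distribution "density lborel (\<lambda>x. ennreal (student_pdf v x))"
    by (rule real_distribution_student[OF v])
  let ?h = "\<lambda>x. student_cdf v x + student_cdf v (- x)"
  have "(?h has_real_derivative 0) (at y)" for y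
  proof -
    have "(?h has_real_derivative (student_pdf v y + student_pdf v (- y) * (-1))) (at y)"
      by (intro DERIV_add student_cdf_has_real_derivative v
          DERIV_chain2[OF student_cdf_has_real_derivative[OF v]]) (auto intro!: derivative_eq_intros)
    then show ?thesis by (simp add: student_pdf_def)
  qed
  then have const: "?h y = ?h x" for y by (rule DERIV_isconst_all[rule_format])
  have "(?h \<longlongrightarrow> 1 + 0) at_top"
    unfolding student_cdf_def
    by (intro tendsto_add cdf_lim_at_top_prob filterlim_compose[OF cdf_lim_at_bot]
        filterlim_uminus_at_bot_at_top)
  then have "((\<lambda>_. ?h x) \<longlongrightarrow> 1) (at_top :: real filter)"
    by (subst (asm) const) simp
  then show ?thesis by (simp add: tendsto_const_iff)
qed

section \<open>The skew-t distribution\<close>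

lemma skewt_pdf_pos: "v > 0 \<Longrightarrow> skewt_pdf v \<beta> x > 0"
  by (simp add: skewt_pdf_def student_pdf_pos student_cdf_pos)

lemma continuous_skewt_pdf:
  assumes v: "v > 0" shows "continuous_on UNIV (skewt_pdf v \<beta>)"
proof -
  have "continuous_on UNIV (student_cdf (v + 1))"
    by (rule DERIV_continuous_on[of _ _ "student_pdf (v+1)"])
       (use v student_cdf_has_real_derivative[of "v+1"] in \<open>auto intro: has_field_derivative_at_within\<close>)
  moreover have "x\<^sup>2 + v \<noteq> 0" for x :: real using v by (smt (verit) zero_le_power2)
  then have "continuous_on UNIV (\<lambda>x. \<beta> * x * sqrt ((v + 1) / (x\<^sup>2 + v)))"
    by (intro continuous_intros) auto
  ultimately have "continuous_on UNIV (\<lambda>x. student_cdf (v + 1) (\<beta> * x * sqrt ((v + 1) / (x\<^sup>2 + v))))"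
    by (rule continuous_on_compose2) simp
  then show ?thesis
    unfolding skewt_pdf_def by (intro continuous_on_mult continuous_on_const continuous_student_pdf v)
qed

text \<open>
  The values at \<open>x\<close> and \<open>- x\<close> add up to \<open>2 * student_pdf v x\<close>, because the two arguments of the Student cdf
  are opposite. Hence twice the integral is \<open>2\<close>.
\<close>

lemma nn_integral_skewt_pdf:
  assumes v: "v > 0"
  shows "(\<integral>\<^sup>+x. ennreal (skewt_pdf v \<beta> x) \<partial>lborel) = 1" (is "?I = 1")
proof -
  have [measurable]: "skewt_pdf v \<beta> \<in> borel_measurable borel" "student_pdf v \<in> borel_measurable borel"
    using continuous_skewt_pdf[OF v] continuous_student_pdf[OF v]
        by (auto intro: borel_measurable_continuous_onI)
  have "?I = (\<integral>\<^sup>+x. ennreal (skewt_pdf v \<beta> (- x)) \<partial>lborel)"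
    using nn_integral_real_affine[of "\<lambda>x. ennreal (skewt_pdf v \<beta> x)" "-1" 0] by simp
  then have "?I + ?I = (\<integral>\<^sup>+x. ennreal (skewt_pdf v \<beta> x) + ennreal (skewt_pdf v \<beta> (- x)) \<partial>lborel)"
    by (subst nn_integral_add) auto
  also have "\<dots> = (\<integral>\<^sup>+x. 2 * ennreal (student_pdf v x) \<partial>lborel)"
  proof (rule nn_integral_cong)
    fix x
    let ?z = "\<beta> * x * sqrt ((v + 1) / (x\<^sup>2 + v))"
    have "skewt_pdf v \<beta> x + skewt_pdf v \<beta> (- x)
        = 2 * student_pdf v x * (student_cdf (v + 1) ?z + student_cdf (v + 1) (- ?z))"
      by (simp add: skewt_pdf_def student_pdf_def algebra_simps)
    also have "\<dots> = 2 * student_pdf v x" using v by (subst student_cdf_symmetric) auto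
    finally show "ennreal (skewt_pdf v \<beta> x) + ennreal (skewt_pdf v \<beta> (- x)) = 2 * ennreal (student_pdf v x)"
      using skewt_pdf_pos[OF v, of \<beta> x] skewt_pdf_pos[OF v, of \<beta> "-x"] student_pdf_pos[OF v, of x]
      by (simp add: ennreal_plus[symmetric] ennreal_mult' del: ennreal_plus)
  qed
  also have "\<dots> = 2" by (subst nn_integral_cmult) (auto simp: nn_integral_student_pdf[OF v])
  finally have two: "?I + ?I = 2" .
  then obtain i where i: "?I = ennreal i" "i \<ge> 0" by (cases ?I) auto
  with two have "ennreal (i + i) = ennreal 2" by (metis ennreal_plus ennreal_numeral)
  then have "i = 1" using i by (subst (asm) ennreal_inj) auto
  then show ?thesis using i by simp
qed

lemma skewt_cdf_has_real_derivative:
  "v > 0 \<Longrightarrow> (skewt_cdf v \<beta> has_real_derivative skewt_pdf v \<beta> x) (at x)"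
  unfolding skewt_cdf_def
  by (intro cdf_density_has_real_derivative continuous_skewt_pdf nn_integral_skewt_pdf less_imp_le
      skewt_pdf_pos)

lemma skewt_cdf_at_top:
  assumes "v > 0" shows "(skewt_cdf v \<beta> \<longlongrightarrow> 1) at_top"
proof -
  interpret real_distribution "density lborel (\<lambda>x. ennreal (skewt_pdf v \<beta> x))"
    by (intro real_distribution_density continuous_skewt_pdf nn_integral_skewt_pdf less_imp_le skewt_pdf_pos
        assms)
  show ?thesis unfolding skewt_cdf_def by (rule cdf_lim_at_top_prob)
qed

section \<open>Tail expansions of the skew-t distribution\<close>

lemma second_order_peano:
  fixes h h' :: "real \<Rightarrow> real"
  assumes "e > 0" and h: "\<And>u. \<bar>u\<bar> < e \<Longrightarrow> (h has_real_derivative h' u) (at u)"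
    and h': "(h' has_real_derivative D) (at 0)"
  shows "((\<lambda>u. (h u - h 0 - h' 0 * u - D / 2 * u\<^sup>2) / u\<^sup>2) \<longlongrightarrow> 0) (at 0)"
proof (rule lhopital)
  have ev: "eventually (\<lambda>u. \<bar>u\<bar> < e) (at 0)"
    using \<open>e > 0\<close> unfolding eventually_at by (auto intro!: exI[of _ e] simp: dist_real_def)
  have "isCont h 0" using h[of 0] \<open>e > 0\<close> by (auto intro: DERIV_isCont)
  then have "(h \<longlongrightarrow> h 0) (at 0)" by (simp add: isCont_def)
  then have "((\<lambda>u. h u - h 0 - h' 0 * u - D / 2 * u\<^sup>2) \<longlongrightarrow> h 0 - h 0 - h' 0 * 0 - D / 2 * 0\<^sup>2) (at 0)"
    by (intro tendsto_intros)
  then show "((\<lambda>u. h u - h 0 - h' 0 * u - D / 2 * u\<^sup>2) \<longlongrightarrow> 0) (at 0)" by simp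
  show "((\<lambda>u::real. u\<^sup>2) \<longlongrightarrow> 0) (at 0)" by real_asymp
  show "eventually (\<lambda>u::real. u\<^sup>2 \<noteq> 0) (at 0)" "eventually (\<lambda>u::real. 2 * u \<noteq> 0) (at 0)"
    by (auto simp: eventually_at_filter)
  show "eventually (\<lambda>u. ((\<lambda>u. h u - h 0 - h' 0 * u - D / 2 * u\<^sup>2) has_real_derivative h' u - h' 0
      - D * u) (at u)) (at 0)"
    using ev by eventually_elim (auto intro!: derivative_eq_intros h)
  show "eventually (\<lambda>u. ((\<lambda>u. u\<^sup>2) has_real_derivative 2 * u) (at u)) (at 0)"
    by (auto intro!: always_eventually derivative_eq_intros)
  have "((\<lambda>u. ((h' u - h' 0) / u - D) / 2) \<longlongrightarrow> (D - D) / 2) (at 0)"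
    using h' unfolding has_field_derivative_iff by (intro tendsto_intros) simp_all
  then have "((\<lambda>u. ((h' u - h' 0) / u - D) / 2) \<longlongrightarrow> 0) (at 0)" by simp
  then show "((\<lambda>u. (h' u - h' 0 - D * u) / (2 * u)) \<longlongrightarrow> 0) (at 0)"
    by (rule Lim_transform_eventually) (auto simp: eventually_at_filter field_simps)
qed

text \<open>
  A little-o relation between derivatives is integrated from \<open>y\<close> to infinity without integrals: if
  \<open>\<bar>g y\<bar> \<le> \<epsilon> * s * y powr (- s - 1)\<close> from some point on, then \<open>\<epsilon> * y powr (- s) - G y\<close> and
  \<open>\<epsilon> * y powr (- s) + G y\<close> are nonincreasing and tend to zero, hence are nonnegative.
\<close>

lemma antiderivative_tail_smallo:
  fixes G g :: "real \<Rightarrow> real"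
  assumes s: "s > 0" and G: "\<And>y. y > 0 \<Longrightarrow> (G has_real_derivative g y) (at y)"
    and lim: "(G \<longlongrightarrow> 0) at_top" and g: "((\<lambda>y. g y * y powr (s + 1)) \<longlongrightarrow> 0) at_top"
  shows "((\<lambda>y. G y * y powr s) \<longlongrightarrow> 0) at_top"
proof (rule tendstoI)
  fix \<epsilon> :: real assume \<epsilon>: "\<epsilon> > 0"
  then have "eventually (\<lambda>y. \<bar>g y * y powr (s + 1)\<bar> < \<epsilon> / 2 * s) at_top"
    using tendstoD[OF g, of "\<epsilon> / 2 * s"] s by simp
  then obtain Y where Y: "\<And>y. y \<ge> Y \<Longrightarrow> \<bar>g y * y powr (s + 1)\<bar> < \<epsilon> / 2 * s"
    by (auto simp: eventually_at_top_linorder)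
  define Z where "Z = max Y 1"
  have gb: "\<bar>g y\<bar> \<le> \<epsilon> / 2 * s * y powr (- s - 1)" if "y \<ge> Z" for y
  proof -
    have "\<bar>g y\<bar> * y powr (s + 1) \<le> \<epsilon> / 2 * s" using Y[of y] that by (auto simp: Z_def abs_mult)
    then have "\<bar>g y\<bar> * y powr (s + 1) * y powr (- s - 1) \<le> \<epsilon> / 2 * s * y powr (- s - 1)"
      by (rule mult_right_mono) simp
    then show ?thesis using that by (simp add: Z_def mult.assoc powr_add[symmetric])
  qed
  have bound: "c * G y \<le> \<epsilon> / 2 * y powr (- s)" if "y \<ge> Z" "\<bar>c\<bar> = 1" for c y
  proof -
    define K where "K = (\<lambda>y. \<epsilon> / 2 * y powr (- s) - c * G y)"
    have Kd: "(K has_real_derivative (- (\<epsilon> / 2 * s * t powr (- s - 1)) - c * g t)) (at t)" if "t \<ge> Z" for t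
      unfolding K_def using that by (auto intro!: derivative_eq_intros G simp: Z_def)
    have dec: "K z \<le> K y" if "z \<ge> y" for z
    proof (rule DERIV_nonpos_imp_nonincreasing[OF that])
      fix t assume t: "y \<le> t" "t \<le> z"
      have "\<bar>c * g t\<bar> \<le> \<epsilon> / 2 * s * t powr (- s - 1)"
        using gb[of t] t \<open>y \<ge> Z\<close> \<open>\<bar>c\<bar> = 1\<close> by (simp add: abs_mult)
      then have "- (\<epsilon> / 2 * s * t powr (- s - 1)) - c * g t \<le> 0" by linarith
      then show "\<exists>d. (K has_real_derivative d) (at t) \<and> d \<le> 0"
        using Kd[of t] t \<open>y \<ge> Z\<close> by (intro exI conjI) auto
    qed
    have "(K \<longlongrightarrow> \<epsilon> / 2 * 0 - c * 0) at_top"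
      unfolding K_def using s by (intro tendsto_intros lim tendsto_neg_powr filterlim_ident) auto
    then have "(K \<longlongrightarrow> 0) at_top" by simp
    then have "0 \<le> K y"
      by (rule tendsto_upperbound) (use dec in \<open>auto intro: eventually_mono[OF eventually_ge_at_top[of y]]\<close>)
    then show ?thesis by (simp add: K_def)
  qed
  show "eventually (\<lambda>y. dist (G y * y powr s) 0 < \<epsilon>) at_top"
  proof (rule eventually_mono[OF eventually_ge_at_top[of Z]])
    fix y assume y: "y \<ge> Z"
    have "\<bar>G y\<bar> \<le> \<epsilon> / 2 * y powr (- s)" using bound[OF y, of 1] bound[OF y, of "-1"] by auto
    then have "\<bar>G y\<bar> * y powr s \<le> \<epsilon> / 2 * y powr (- s) * y powr s" by (rule mult_right_mono) simp
    also have "\<dots> = \<epsilon> / 2" using y by (simp add: Z_def mult.assoc powr_add[symmetric])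
    finally show "dist (G y * y powr s) 0 < \<epsilon>" using \<epsilon> by (simp add: abs_mult)
  qed
qed

text \<open>
  The logarithmic derivative of the Student cdf at the limit \<open>\<beta> * sqrt (v + 1)\<close> of its argument, up to
  the factor \<open>\<beta> * sqrt (v + 1)\<close>. It is the only way in which the skewness enters the coefficients
  below besides the rational function of \<open>\<beta>\<^sup>2\<close> in \<open>pdf_coeff4\<close>.
\<close>

definition skew_ratio :: "real \<Rightarrow> real \<Rightarrow> real" where
  "skew_ratio v \<beta> = student_C (v + 1) * \<beta> * sqrt (v + 1) * (1 + \<beta>\<^sup>2) powr (- ((v + 2) / 2))
     / student_cdf (v + 1) (\<beta> * sqrt (v + 1))"

text \<open>
  The skew-t tail is asymptotic to \<open>2 * tail_const v \<beta> * y powr (- v)\<close>.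
\<close>

definition tail_const :: "real \<Rightarrow> real \<Rightarrow> real" where
  "tail_const v \<beta> = student_C v * v powr ((v - 1) / 2) * student_cdf (v + 1) (\<beta> * sqrt (v + 1))"

text \<open>
  The relative corrections of the skew-t density at the orders \<open>y powr (- 2)\<close> and \<open>y powr (- 4)\<close>. The corresponding
  corrections of the tail are obtained by integration, which multiplies them by \<open>v / (v + 2)\<close> and
  \<open>v / (v + 4)\<close>.
\<close>

definition pdf_coeff2 :: "real \<Rightarrow> real \<Rightarrow> real" where
  "pdf_coeff2 v \<beta> = - (v / 2) * (v + 1 + skew_ratio v \<beta>)"

definition pdf_coeff4 :: "real \<Rightarrow> real \<Rightarrow> real" where
  "pdf_coeff4 v \<beta> = v\<^sup>2 * (v + 1) * (v + 3) / 8
     + skew_ratio v \<beta> * (v\<^sup>2 * (v + 1) / 4 + 3 * v\<^sup>2 / 8 - v\<^sup>2 * (v + 2) * \<beta>\<^sup>2 / (8 * (1 + \<beta>\<^sup>2)))"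

lemma tail_const_pos: "v > 0 \<Longrightarrow> tail_const v \<beta> > 0"
  by (simp add: tail_const_def student_C_pos student_cdf_pos)

text \<open>
  As a function of \<open>u = y powr (- 2)\<close> the density is, up to a power of \<open>y\<close>, smooth at \<open>u = 0\<close>; this is its
  Taylor expansion of order two there.
\<close>

lemma skew_kernel_peano:
  fixes v \<beta> :: real
  assumes v: "v > 0"
  defines "h \<equiv> (\<lambda>u. (1 + v * u) powr (- ((v + 1) / 2))
      * student_cdf (v + 1) (\<beta> * sqrt (v + 1) * (1 + v * u) powr (- (1/2))))"
  shows "((\<lambda>u. (h u - h 0 * (1 + pdf_coeff2 v \<beta> * u + pdf_coeff4 v \<beta> * u\<^sup>2)) / u\<^sup>2) \<longlongrightarrow> 0) (at 0)"
proof -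
  define T where "T = student_cdf (v + 1) (\<beta> * sqrt (v + 1))"
  define C where "C = student_C (v + 1) * \<beta> * sqrt (v + 1)"
  define P where "P = (1 + \<beta>\<^sup>2) powr (- ((v + 2) / 2))"
  define q where "q = (\<lambda>u. student_cdf (v + 1) (\<beta> * sqrt (v + 1) * (1 + v * u) powr (- (1/2))))"
  define q' where "q' = (\<lambda>u. - (v / 2) * C * (1 + \<beta>\<^sup>2 / (1 + v * u)) powr (- ((v + 2) / 2))
      * (1 + v * u) powr (- (3/2)))"
  define h' where "h' = (\<lambda>u. - (v * (v + 1) / 2) * (1 + v * u) powr (- ((v + 3) / 2)) * q u
      + (1 + v * u) powr (- ((v + 1) / 2)) * q' u)"
  have T0: "T > 0" using v by (simp add: T_def student_cdf_pos)
  have pos: "1 + v * u > 0" if "\<bar>u\<bar> < 1 / v" for u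
  proof -
    have "v * \<bar>u\<bar> < 1" using that v by (simp add: field_simps)
    moreover have "\<bar>v * u\<bar> = v * \<bar>u\<bar>" using v by (simp add: abs_mult)
    ultimately show ?thesis by linarith
  qed
  have q: "(q has_real_derivative q' u) (at u)" if u: "\<bar>u\<bar> < 1 / v" for u
  proof -
    let ?w = "\<beta> * sqrt (v + 1) * (1 + v * u) powr (- (1/2))"
    have "((\<lambda>u. \<beta> * sqrt (v + 1) * (1 + v * u) powr (- (1/2))) has_real_derivative
        (\<beta> * sqrt (v + 1) * (- (v / 2) * (1 + v * u) powr (- (3/2))))) (at u)"
      using pos[OF u] by (auto intro!: derivative_eq_intros)
    from DERIV_chain2[OF student_cdf_has_real_derivative this] v
    have "(q has_real_derivative student_pdf (v + 1) ?w
        * (\<beta> * sqrt (v + 1) * (- (v / 2) * (1 + v * u) powr (- (3/2))))) (at u)"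
      unfolding q_def by simp
    moreover have "student_pdf (v + 1) ?w
        = student_C (v + 1) * (1 + \<beta>\<^sup>2 / (1 + v * u)) powr (- ((v + 2) / 2))"
    proof -
      have "((1 + v * u) powr (- (1/2)))\<^sup>2 = 1 / (1 + v * u)"
        using powr_powr[of "1 + v * u" "- (1/2)" 2] pos[OF u] by simp
      then have "?w\<^sup>2 / (v + 1) = \<beta>\<^sup>2 / (1 + v * u)"
        using v by (simp add: power_mult_distrib)
      moreover have "v + 1 + 1 = v + 2" by simp
      ultimately show ?thesis unfolding student_pdf_def by (simp only:)
    qed
    ultimately show ?thesis unfolding q'_def C_def by (simp add: mult_ac)
  qed
  have h_eq: "h u = (1 + v * u) powr (- ((v + 1) / 2)) * q u" for u
    by (simp add: h_def q_def)
  have h: "(h has_real_derivative h' u) (at u)" if u: "\<bar>u\<bar> < 1 / v" for u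
  proof -
    have e: "- ((v + 1) / 2) - 1 = - ((v + 3) / 2)" by (simp add: field_simps)
    have "((\<lambda>u. (1 + v * u) powr (- ((v + 1) / 2))) has_real_derivative
        - ((v + 1) / 2) * (1 + v * u) powr (- ((v + 1) / 2) - 1) * v) (at u)"
      using pos[OF u] by (auto intro!: derivative_eq_intros)
    from DERIV_mult[OF this[unfolded e] q[OF u]] show ?thesis
      unfolding h_eq[abs_def] by (rule DERIV_cong) (simp only: h'_def, algebra)
  qed
  have b: "1 + \<beta>\<^sup>2 > 0" by (simp add: add_pos_nonneg)
  have q0: "q 0 = T" "q' 0 = - (v / 2) * C * P" by (simp_all add: q_def T_def q'_def P_def)
  have P': "(1 + \<beta>\<^sup>2) powr (- ((v + 2) / 2) - 1) = P / (1 + \<beta>\<^sup>2)"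
    unfolding P_def using b by (simp add: powr_diff)
  have q'd: "(q' has_real_derivative (- (v / 2) * C
      * (P * (v * (v + 2) * \<beta>\<^sup>2 / (2 * (1 + \<beta>\<^sup>2)) - 3 * v / 2)))) (at 0)"
  proof -
    have "(q' has_real_derivative (- (v / 2) * C * ((- ((v + 2) / 2)) * (1 + \<beta>\<^sup>2) powr (- ((v + 2) / 2) - 1)
        * (\<beta>\<^sup>2 * (- v))
         + P * (- (3/2) * v)))) (at 0)"
      unfolding q'_def using b by (auto intro!: derivative_eq_intros simp: P_def) (simp add: algebra_simps)
    also have "(- (v / 2) * C * ((- ((v + 2) / 2)) * (1 + \<beta>\<^sup>2) powr (- ((v + 2) / 2) - 1) * (\<beta>\<^sup>2 * (- v))
         + P * (- (3/2) * v))) = (- (v / 2) * C * (P * (v * (v + 2) * \<beta>\<^sup>2 / (2 * (1 + \<beta>\<^sup>2)) - 3 * v / 2)))"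
      unfolding P' using b by (simp add: field_simps)
    finally show ?thesis .
  qed
  have e: "skew_ratio v \<beta> * T = C * P"
    using T0 by (simp add: skew_ratio_def C_def P_def T_def)
  define D where "D = - (v * (v + 1) / 2) * (- (v * (v + 3) / 2) * T + q' 0)
     + (- (v * (v + 1) / 2) * q' 0
         + (- (v / 2) * C * (P * (v * (v + 2) * \<beta>\<^sup>2 / (2 * (1 + \<beta>\<^sup>2)) - 3 * v / 2))))"
  have "(h' has_real_derivative D) (at 0)"
    unfolding h'_def D_def using v
    by (auto intro!: derivative_eq_intros q[of 0] q'd simp: q0 field_simps)
  then have "((\<lambda>u. (h u - h 0 - h' 0 * u - D / 2 * u\<^sup>2) / u\<^sup>2) \<longlongrightarrow> 0) (at 0)"
    using v by (intro second_order_peano[where e = "1 / v"] h) simp_all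
  moreover have "h 0 = T" unfolding h_eq q0 by simp
  moreover have "h' 0 = T * pdf_coeff2 v \<beta>"
    unfolding h'_def pdf_coeff2_def q0 using e by simp algebra
  moreover have "D / 2 = T * pdf_coeff4 v \<beta>"
  proof -
    define b2 where "b2 = \<beta>\<^sup>2 / (1 + \<beta>\<^sup>2)"
    have b2: "v * (v + 2) * \<beta>\<^sup>2 / (2 * (1 + \<beta>\<^sup>2)) = v * (v + 2) / 2 * b2"
      "v\<^sup>2 * (v + 2) * \<beta>\<^sup>2 / (8 * (1 + \<beta>\<^sup>2)) = v\<^sup>2 * (v + 2) / 8 * b2" by (simp_all add: b2_def)
    have "T * pdf_coeff4 v \<beta> = T * (v\<^sup>2 * (v + 1) * (v + 3) / 8)
        + C * P * (v\<^sup>2 * (v + 1) / 4 + 3 * v\<^sup>2 / 8 - v\<^sup>2 * (v + 2) / 8 * b2)"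
      unfolding pdf_coeff4_def b2 e[symmetric] by (simp add: algebra_simps)
    moreover have "D / 2 = T * (v\<^sup>2 * (v + 1) * (v + 3) / 8)
        + C * P * (v\<^sup>2 * (v + 1) / 4 + 3 * v\<^sup>2 / 8 - v\<^sup>2 * (v + 2) / 8 * b2)"
      unfolding D_def b2 q0 by (simp add: field_simps power2_eq_square)
    ultimately show ?thesis by simp
  qed
  ultimately show ?thesis by (simp add: algebra_simps)
qed

lemma skewt_pdf_kernel:
  fixes v \<beta> y :: real
  assumes v: "v > 0" and y: "y > 0"
  shows "skewt_pdf v \<beta> y = 2 * student_C v * v powr ((v + 1) / 2) * y powr (- v - 1) *
     ((1 + v * y powr (-2)) powr (- ((v + 1) / 2))
      * student_cdf (v + 1) (\<beta> * sqrt (v + 1) * (1 + v * y powr (-2)) powr (- (1/2))))"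
proof -
  have y2: "y powr (-2) = 1 / y\<^sup>2" using y by (simp add: powr_minus_divide)
  have pos: "1 + v * y powr (-2) > 0" using v by (simp add: add_pos_nonneg)
  have "1 + y\<^sup>2 / v = y\<^sup>2 / v * (1 + v * y powr (-2))" unfolding y2 using v y by (simp add: field_simps)
  then have "(1 + y\<^sup>2 / v) powr (- ((v + 1) / 2)) = (y\<^sup>2) powr (- ((v + 1) / 2)) / v powr (- ((v + 1) / 2))
      * (1 + v * y powr (-2)) powr (- ((v + 1) / 2))"
    by (simp only: powr_mult powr_divide)
  also have "(y\<^sup>2) powr (- ((v + 1) / 2)) = y powr (- v - 1)"
  proof -
    have "2 * - ((v + 1) / 2) = - v - 1" by (simp add: field_simps)
    then show ?thesis using powr_powr[of y 2 "- ((v + 1) / 2)"] y by (simp only: powr_numeral)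
  qed
  finally have 1: "student_pdf v y = student_C v * v powr ((v + 1) / 2) * y powr (- v - 1)
      * (1 + v * y powr (-2)) powr (- ((v + 1) / 2))"
    unfolding student_pdf_def using v by (simp add: powr_minus field_simps)
  have "y\<^sup>2 + v = y\<^sup>2 * (1 + v * y powr (-2))" unfolding y2 using y by (simp add: field_simps)
  then have "sqrt (y\<^sup>2 + v) = y * (1 + v * y powr (-2)) powr (1/2)"
    using y pos by (simp add: real_sqrt_mult powr_half_sqrt)
  then have 2: "\<beta> * y * sqrt ((v + 1) / (y\<^sup>2 + v))
      = \<beta> * sqrt (v + 1) * (1 + v * y powr (-2)) powr (- (1/2))"
    using y by (simp add: real_sqrt_divide powr_minus_divide)
  show ?thesis unfolding skewt_pdf_def 1 2 by simp
qed

lemma skewt_pdf_expansion: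
  fixes v \<beta> :: real
  assumes v: "v > 0"
  shows "((\<lambda>y. (skewt_pdf v \<beta> y / (2 * v * tail_const v \<beta> * y powr (- v - 1))
            - (1 + pdf_coeff2 v \<beta> * y powr (-2) + pdf_coeff4 v \<beta> * y powr (-4))) * y powr 4) \<longlongrightarrow> 0) at_top"
proof -
  define h where "h = (\<lambda>u. (1 + v * u) powr (- ((v + 1) / 2))
      * student_cdf (v + 1) (\<beta> * sqrt (v + 1) * (1 + v * u) powr (- (1/2))))"
  have h0: "h 0 = student_cdf (v + 1) (\<beta> * sqrt (v + 1))" by (simp add: h_def)
  then have h0': "h 0 > 0" using v by (simp add: student_cdf_pos)
  have "filterlim (\<lambda>y::real. y powr (-2)) (at 0) at_top"
    unfolding filterlim_at
    by (auto intro!: eventually_mono[OF eventually_gt_at_top[of 0]] tendsto_neg_powr filterlim_ident)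
  from filterlim_compose[OF skew_kernel_peano[OF v, of \<beta>] this]
  have "((\<lambda>y. (h (y powr (-2)) - h 0 * (1 + pdf_coeff2 v \<beta> * y powr (-2) + pdf_coeff4 v \<beta>
      * (y powr (-2))\<^sup>2)) / (y powr (-2))\<^sup>2) \<longlongrightarrow> 0) at_top"
    unfolding h_def .
  then have "((\<lambda>y. (h (y powr (-2)) - h 0 * (1 + pdf_coeff2 v \<beta> * y powr (-2) + pdf_coeff4 v \<beta>
      * (y powr (-2))\<^sup>2)) / (y powr (-2))\<^sup>2 / h 0) \<longlongrightarrow> 0 / h 0) at_top"
    by (intro tendsto_intros) (use h0' in auto)
  then have lim: "((\<lambda>y. (h (y powr (-2)) / h 0 - (1 + pdf_coeff2 v \<beta> * y powr (-2) + pdf_coeff4 v \<beta>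
      * (y powr (-2))\<^sup>2)) / (y powr (-2))\<^sup>2) \<longlongrightarrow> 0) at_top"
    using h0' by (simp add: diff_divide_distrib mult.commute[of _ "h 0"])
  show ?thesis
  proof (rule Lim_transform_eventually[OF lim], rule eventually_mono[OF eventually_gt_at_top[of 0]])
    fix y :: real assume y: "y > 0"
    have sq: "(y powr (-2))\<^sup>2 = y powr (-4)" using powr_powr[of y "-2" 2] by simp
    have inv: "a / y powr (-4) = a * y powr 4" for a using y by (simp add: powr_minus_divide)
    have "v powr ((v + 1) / 2) = v * v powr ((v - 1) / 2)"
      using v powr_add[of v 1 "(v - 1) / 2"] by (simp add: field_simps)
    then have "2 * student_C v * v powr ((v + 1) / 2) * h 0 = 2 * v * tail_const v \<beta>"
      by (simp add: tail_const_def h0)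
    then have "2 * student_C v * v powr ((v + 1) / 2) = 2 * v * tail_const v \<beta> / h 0"
      using h0' by (simp add: field_simps)
    then have "skewt_pdf v \<beta> y = 2 * v * tail_const v \<beta> / h 0 * y powr (- v - 1) * h (y powr (-2))"
      unfolding skewt_pdf_kernel[OF v y] h_def by simp
    then have "skewt_pdf v \<beta> y / (2 * v * tail_const v \<beta> * y powr (- v - 1)) = h (y powr (-2)) / h 0"
      using v y h0' tail_const_pos[OF v, of \<beta>] by simp
    then show "(h (y powr (-2)) / h 0 - (1 + pdf_coeff2 v \<beta> * y powr (-2) + pdf_coeff4 v \<beta>
        * (y powr (-2))\<^sup>2)) / (y powr (-2))\<^sup>2
      = (skewt_pdf v \<beta> y / (2 * v * tail_const v \<beta> * y powr (- v - 1))
            - (1 + pdf_coeff2 v \<beta> * y powr (-2) + pdf_coeff4 v \<beta> * y powr (-4))) * y powr 4"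
      unfolding sq inv by simp
  qed
qed

text \<open>
  The difference between the tail and its claimed expansion tends to zero, and its derivative is
  small by the expansion of the density.
\<close>

lemma skewt_cdf_expansion:
  fixes v \<beta> :: real
  assumes v: "v > 0"
  shows "((\<lambda>y. ((1 - skewt_cdf v \<beta> y) / (2 * tail_const v \<beta> * y powr (- v))
            - (1 + v / (v + 2) * pdf_coeff2 v \<beta> * y powr (-2) + v / (v + 4) * pdf_coeff4 v \<beta> * y powr (-4)))
                * y powr 4) \<longlongrightarrow> 0) at_top"
proof -
  define M where "M = 2 * tail_const v \<beta>"
  have M: "M > 0" unfolding M_def using tail_const_pos[OF v, of \<beta>] by simp
  define G where "G = (\<lambda>y. (1 - skewt_cdf v \<beta> y) / M
     - (y powr (- v) + v / (v + 2) * pdf_coeff2 v \<beta> * y powr (- v - 2) + v / (v + 4) * pdf_coeff4 v \<beta>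
         * y powr (- v - 4)))"
  define g where "g = (\<lambda>y. - (skewt_pdf v \<beta> y / M)
     + v * (y powr (- v - 1) + pdf_coeff2 v \<beta> * y powr (- v - 3) + pdf_coeff4 v \<beta> * y powr (- v - 5)))"
  have "((\<lambda>y. G y * y powr (v + 4)) \<longlongrightarrow> 0) at_top"
  proof (rule antiderivative_tail_smallo)
    show "v + 4 > 0" using v by simp
    show "(G has_real_derivative g y) (at y)" if y: "y > 0" for y
    proof -
      have D: "(G has_real_derivative (- skewt_pdf v \<beta> y / M
        - (- v * y powr (- v - 1) + v / (v + 2) * pdf_coeff2 v \<beta> * ((- v - 2) * y powr (- v - 3))
            + v / (v + 4) * pdf_coeff4 v \<beta> * ((- v - 4) * y powr (- v - 5))))) (at y)"
      proof -
        have d: "((\<lambda>y. y powr a) has_real_derivative a * y powr (a - 1)) (at y)" for a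
          using y by (rule has_real_derivative_powr)
        have e: "- v - 2 - 1 = - v - 3" "- v - 4 - 1 = - v - 5" by simp_all
        show ?thesis unfolding G_def
          using DERIV_diff[OF DERIV_cdivide[OF DERIV_diff[OF DERIV_const skewt_cdf_has_real_derivative[OF
              v]]]
            DERIV_add[OF DERIV_add[OF d DERIV_cmult[OF d]] DERIV_cmult[OF d]], of 1 \<beta> M "-v"
              "v / (v + 2) * pdf_coeff2 v \<beta>" "- v - 2" "v / (v + 4) * pdf_coeff4 v \<beta>" "- v - 4"]
          unfolding e by simp
      qed
      have e: "v / (v + 2) * pdf_coeff2 v \<beta> * ((- v - 2) * y powr (- v - 3))
          = - v * pdf_coeff2 v \<beta> * y powr (- v - 3)"
         "v / (v + 4) * pdf_coeff4 v \<beta> * ((- v - 4) * y powr (- v - 5))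
             = - v * pdf_coeff4 v \<beta> * y powr (- v - 5)"
        using v by (simp_all add: divide_simps) (simp_all add: algebra_simps)
      show ?thesis using D unfolding e by (rule DERIV_cong) (simp add: g_def algebra_simps)
    qed
    have "((\<lambda>y. (1 - skewt_cdf v \<beta> y) / M
     - (y powr (- v) + v / (v + 2) * pdf_coeff2 v \<beta> * y powr (- v - 2) + v / (v + 4) * pdf_coeff4 v \<beta>
         * y powr (- v - 4)))
      \<longlongrightarrow> (1 - 1) / M - (0 + v / (v + 2) * pdf_coeff2 v \<beta> * 0 + v / (v + 4) * pdf_coeff4 v \<beta> * 0)) at_top"
      using v M by (intro tendsto_intros skewt_cdf_at_top tendsto_neg_powr filterlim_ident) auto
    then show "(G \<longlongrightarrow> 0) at_top" unfolding G_def by simp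
    have "((\<lambda>y. - v * ((skewt_pdf v \<beta> y / (2 * v * tail_const v \<beta> * y powr (- v - 1))
            - (1 + pdf_coeff2 v \<beta> * y powr (-2) + pdf_coeff4 v \<beta> * y powr (-4))) * y powr 4))
                \<longlongrightarrow> - v * 0) at_top"
      by (intro tendsto_intros skewt_pdf_expansion v)
    then have lim: "((\<lambda>y. - v * ((skewt_pdf v \<beta> y / (2 * v * tail_const v \<beta> * y powr (- v - 1))
            - (1 + pdf_coeff2 v \<beta> * y powr (-2) + pdf_coeff4 v \<beta> * y powr (-4))) * y powr 4)) \<longlongrightarrow> 0) at_top"
                by simp
    show "((\<lambda>y. g y * y powr (v + 4 + 1)) \<longlongrightarrow> 0) at_top"
    proof (rule Lim_transform_eventually[OF lim], rule eventually_mono[OF eventually_gt_at_top[of 0]])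
      fix y :: real assume y: "y > 0"
      define Q where "Q = skewt_pdf v \<beta> y / (2 * v * tail_const v \<beta> * y powr (- v - 1))"
      have s: "skewt_pdf v \<beta> y / M = v * Q * y powr (- v - 1)"
        using y v tail_const_pos[OF v, of \<beta>] by (simp add: Q_def M_def)
      have p: "y powr (- v - 3) = y powr (- v - 1) * y powr (-2)" "y powr (- v - 5)
          = y powr (- v - 1) * y powr (-4)"
        by (simp_all add: powr_add[symmetric] algebra_simps)
      have p4: "y powr (- v - 1) * y powr (v + 4 + 1) = y powr 4" by (simp add: powr_add[symmetric])
      have "g y * y powr (v + 4 + 1)
          = - v * (Q - (1 + pdf_coeff2 v \<beta> * y powr (-2) + pdf_coeff4 v \<beta> * y powr (-4)))
          * (y powr (- v - 1) * y powr (v + 4 + 1))"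
        unfolding g_def s p by algebra
      then show "- v * ((skewt_pdf v \<beta> y / (2 * v * tail_const v \<beta> * y powr (- v - 1))
            - (1 + pdf_coeff2 v \<beta> * y powr (-2) + pdf_coeff4 v \<beta> * y powr (-4))) * y powr 4)
                = g y * y powr (v + 4 + 1)"
        unfolding p4 Q_def by simp
    qed
  qed
  then show ?thesis
  proof (rule Lim_transform_eventually, intro eventually_mono[OF eventually_gt_at_top[of 0]])
    fix y :: real assume y: "y > 0"
    have p: "y powr (- v - 2) = y powr (- v) * y powr (-2)" "y powr (- v - 4) = y powr (- v) * y powr (-4)"
      by (simp_all add: powr_add[symmetric])
    have p4: "y powr (v + 4) = y powr 4 / y powr (- v)" using y by (simp add: powr_minus_divide powr_add)
    show "G y * y powr (v + 4) = ((1 - skewt_cdf v \<beta> y) / (2 * tail_const v \<beta> * y powr (- v))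
            - (1 + v / (v + 2) * pdf_coeff2 v \<beta> * y powr (-2) + v / (v + 4) * pdf_coeff4 v \<beta> * y powr (-4)))
                * y powr 4"
      unfolding G_def p p4 M_def[symmetric] using y by (simp add: field_simps)
  qed
qed

section \<open>Expansions in two powers of a diverging sequence\<close>

text \<open>
  Fix a sequence \<open>a\<close> tending to infinity and two exponents. The bound \<open>m \<le> 2 * d\<close> says that the square
  of a quantity of the leading order \<open>a powr (- d)\<close> is at most of the second order \<open>a powr (- m)\<close>, so every nonlinear
  effect is confined to the second coefficient and to the case \<open>m = 2 * d\<close>.
\<close>

locale two_scale =
  fixes a :: "'n \<Rightarrow> real" and F :: "'n filter" and d m :: real
  assumes a_top: "filterlim a at_top F"
    and d_pos: "0 < d" and d_less_m: "d < m" and m_le_2d: "m \<le> 2 * d"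
begin

definition expands :: "('n \<Rightarrow> real) \<Rightarrow> real \<Rightarrow> real \<Rightarrow> bool" where
  "expands f c1 c2 \<longleftrightarrow>
     ((\<lambda>n. a n powr m * (f n - c1 * a n powr (- d) - c2 * a n powr (- m))) \<longlongrightarrow> 0) F"

lemma eventually_a_pos: "eventually (\<lambda>n. a n > 0) F"
  using a_top by (simp add: filterlim_at_top_dense)

lemma a_powr_tendsto: "\<theta> \<le> 0 \<Longrightarrow> ((\<lambda>n. a n powr \<theta>) \<longlongrightarrow> of_bool (\<theta> = 0)) F"
proof (cases "\<theta> = 0")
  case True
  have "eventually (\<lambda>n. 1 = a n powr \<theta>) F" using eventually_a_pos by eventually_elim (simp add: True)
  then show ?thesis using True by (auto intro: Lim_transform_eventually[OF tendsto_const])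
next
  case False
  assume "\<theta> \<le> 0"
  then show ?thesis using False by (auto intro!: tendsto_neg_powr a_top)
qed

lemma expands_cong:
  assumes "expands f c1 c2" "eventually (\<lambda>n. f n = g n) F"
  shows "expands g c1 c2"
  using assms(1) unfolding expands_def
  by (rule Lim_transform_eventually) (use assms(2) in eventually_elim, simp)

lemma expands_add: "expands f c1 c2 \<Longrightarrow> expands g c1' c2' \<Longrightarrow> expands (\<lambda>n. f n + g n) (c1 + c1') (c2 + c2')"
  unfolding expands_def by (drule (1) tendsto_add) (simp add: algebra_simps)

lemma expands_cmult: "expands f c1 c2 \<Longrightarrow> expands (\<lambda>n. k * f n) (k * c1) (k * c2)"
  unfolding expands_def by (drule tendsto_mult[OF tendsto_const[of k]]) (simp add: algebra_simps)

lemma expands_zero: "expands (\<lambda>_. 0) 0 0"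
  by (simp add: expands_def)

lemma expands_sum:
  "finite I \<Longrightarrow> (\<And>i. i \<in> I \<Longrightarrow> expands (f i) (c1 i) (c2 i)) \<Longrightarrow>
    expands (\<lambda>n. \<Sum>i\<in>I. f i n) (\<Sum>i\<in>I. c1 i) (\<Sum>i\<in>I. c2 i)"
  by (induction I rule: finite_induct) (auto intro: expands_zero expands_add)

text \<open>
  Without a leading term, an expansion is just a limit; this and its converse \<open>expands_0D\<close> allow
  the use of the limit calculus.
\<close>

lemma expands_0I:
  assumes "((\<lambda>n. a n powr m * f n) \<longlongrightarrow> c) F"
  shows "expands f 0 c"
proof -
  have "((\<lambda>n. a n powr m * f n - c) \<longlongrightarrow> c - c) F" by (intro tendsto_intros assms)
  then have "((\<lambda>n. a n powr m * f n - c) \<longlongrightarrow> 0) F" by simp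
  then show ?thesis unfolding expands_def
    by (rule Lim_transform_eventually)
       (use eventually_a_pos in eventually_elim, simp add: algebra_simps powr_minus)
qed

lemma expands_powr:
  assumes "\<theta> = d \<or> m \<le> \<theta>"
  shows "expands (\<lambda>n. a n powr (- \<theta>)) (of_bool (\<theta> = d)) (of_bool (\<theta> = m))"
proof (cases "\<theta> = d")
  case True
  then show ?thesis using d_less_m by (simp add: expands_def)
next
  case False
  then have "((\<lambda>n. a n powr (m - \<theta>)) \<longlongrightarrow> of_bool (\<theta> = m)) F"
    using a_powr_tendsto[of "m - \<theta>"] assms by (simp add: eq_commute[of \<theta> m])
  then have "expands (\<lambda>n. a n powr (- \<theta>)) 0 (of_bool (\<theta> = m))"
    by (intro expands_0I) (simp add: powr_add[symmetric])
  then show ?thesis using False by simp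
qed

lemma expands_0D:
  assumes "expands f 0 c"
  shows "((\<lambda>n. a n powr m * f n) \<longlongrightarrow> c) F"
proof -
  have "((\<lambda>n. a n powr m * (f n - 0 * a n powr (- d) - c * a n powr (- m)) + c) \<longlongrightarrow> 0 + c) F"
    using assms unfolding expands_def by (intro tendsto_intros)
  then have "((\<lambda>n. a n powr m * (f n - 0 * a n powr (- d) - c * a n powr (- m)) + c) \<longlongrightarrow> c) F" by simp
  then show ?thesis
    by (rule Lim_transform_eventually)
       (use eventually_a_pos in eventually_elim, simp add: algebra_simps powr_minus)
qed

lemma expands_second_order:
  assumes "expands f c1 c2"
  shows "((\<lambda>n. a n powr (m - d) * (a n powr d * f n - c1)) \<longlongrightarrow> c2) F"
proof -
  have "((\<lambda>n. a n powr m * (f n - c1 * a n powr (- d) - c2 * a n powr (- m)) + c2) \<longlongrightarrow> 0 + c2) F"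
    using assms unfolding expands_def by (intro tendsto_intros)
  then have "((\<lambda>n. a n powr m * (f n - c1 * a n powr (- d) - c2 * a n powr (- m)) + c2) \<longlongrightarrow> c2) F" by simp
  then show ?thesis
    by (rule Lim_transform_eventually)
       (use eventually_a_pos in eventually_elim, simp add: powr_minus powr_diff field_simps)
qed

lemma expands_first_order:
  assumes "expands f c1 c2"
  shows "((\<lambda>n. a n powr d * f n) \<longlongrightarrow> c1) F"
proof -
  have "((\<lambda>n. a n powr (d - m) * (a n powr (m - d) * (a n powr d * f n - c1)) + c1) \<longlongrightarrow> 0 * c2 + c1) F"
    using a_powr_tendsto[of "d - m"] d_less_m by (intro tendsto_intros expands_second_order[OF assms]) auto
  then have "((\<lambda>n. a n powr (d - m) * (a n powr (m - d) * (a n powr d * f n - c1)) + c1) \<longlongrightarrow> c1) F" by simp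
  then show ?thesis
    by (rule Lim_transform_eventually)
       (use eventually_a_pos in eventually_elim, simp add: mult.assoc[symmetric] powr_add[symmetric])
qed

lemma expands_tendsto_0:
  assumes "expands f c1 c2"
  shows "(f \<longlongrightarrow> 0) F"
proof -
  have "((\<lambda>n. a n powr (- d) * (a n powr d * f n)) \<longlongrightarrow> 0 * c1) F"
    using a_powr_tendsto[of "- d"] d_pos by (intro tendsto_intros expands_first_order[OF assms]) auto
  then have "((\<lambda>n. a n powr (- d) * (a n powr d * f n)) \<longlongrightarrow> 0) F" by simp
  then show ?thesis
    by (rule Lim_transform_eventually)
       (use eventually_a_pos in eventually_elim, simp add: mult.assoc[symmetric] powr_add[symmetric])
qed

text \<open>
  The product of the leading terms is \<open>a powr (- 2 * d)\<close>, which is the second order if \<open>m = 2 * d\<close> and negligible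
  otherwise.
\<close>

lemma expands_mult:
  assumes f: "expands f c1 c2" and g: "expands g c1' c2'"
  shows "expands (\<lambda>n. f n * g n) 0 (of_bool (m = 2 * d) * c1 * c1')"
proof (rule expands_0I)
  have "((\<lambda>n. a n powr (m - 2 * d) * (a n powr d * f n) * (a n powr d * g n)) \<longlongrightarrow> of_bool (m - 2 * d = 0) * c1
      * c1') F"
    using m_le_2d by (intro tendsto_intros expands_first_order[OF f] expands_first_order[OF g]
        a_powr_tendsto) auto
  then have "((\<lambda>n. a n powr (m - 2 * d) * (a n powr d * f n) * (a n powr d * g n))
      \<longlongrightarrow> of_bool (m = 2 * d) * c1 * c1') F" by simp
  then show "((\<lambda>n. a n powr m * (f n * g n)) \<longlongrightarrow> of_bool (m = 2 * d) * c1 * c1') F"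
  proof (rule Lim_transform_eventually, use eventually_a_pos in eventually_elim)
    fix n assume "a n > 0"
    have "a n powr m = a n powr (m - 2 * d) * a n powr d * a n powr d"
      by (simp add: powr_add[symmetric])
    then show "a n powr (m - 2 * d) * (a n powr d * f n) * (a n powr d * g n) = a n powr m * (f n * g n)"
      by simp
  qed
qed

lemma expands_mult_0:
  assumes f: "expands f 0 c" and g: "expands g c1' c2'"
  shows "expands (\<lambda>n. f n * g n) 0 0"
  using expands_mult[OF f g] by simp

lemma expands_mult_null:
  assumes f: "expands f 0 c" and g: "(g \<longlongrightarrow> 0) F"
  shows "expands (\<lambda>n. f n * g n) 0 0"
proof (rule expands_0I)
  have "((\<lambda>n. a n powr m * f n * g n) \<longlongrightarrow> c * 0) F"
    by (intro tendsto_intros expands_0D[OF f] g)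
  then show "((\<lambda>n. a n powr m * (f n * g n)) \<longlongrightarrow> 0) F" by (simp add: mult.assoc)
qed

lemma expands_exp:
  assumes f: "expands f c1 c2"
  shows "expands (\<lambda>n. exp (f n) - 1) c1 (c2 + of_bool (m = 2 * d) * c1\<^sup>2 / 2)"
proof -
  define \<psi> where "\<psi> = (\<lambda>t::real. if t = 0 then 0 else (exp t - 1 - t - t\<^sup>2 / 2) / t\<^sup>2)"
  have "((\<lambda>t::real. (exp t - 1 - t - t\<^sup>2 / 2) / t\<^sup>2) \<longlongrightarrow> 0) (at 0)" by real_asymp
  then have "(\<psi> \<longlongrightarrow> 0) (at 0)"
    by (rule Lim_transform_eventually) (auto simp: \<psi>_def eventually_at_filter)
  then have "isCont \<psi> 0" by (simp add: isCont_def \<psi>_def)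
  from isCont_tendsto_compose[OF this expands_tendsto_0[OF f]]
  have "((\<lambda>n. \<psi> (f n)) \<longlongrightarrow> 0) F" by (simp add: \<psi>_def)
  from expands_mult_null[OF expands_mult[OF f f] this]
  have "expands (\<lambda>n. f n * f n * \<psi> (f n)) 0 0" .
  \<comment> \<open>A name for the indicator keeps the simplifier from splitting on it.\<close>
  obtain B :: real where B: "B = of_bool (m = 2 * d)" by simp
  from expands_add[OF expands_add[OF f expands_cmult[OF expands_mult[OF f f], of "1/2"]] \<open>expands _ 0 0\<close>]
  have "expands (\<lambda>n. f n + 1/2 * (f n * f n) + f n * f n * \<psi> (f n)) c1 (c2 + of_bool (m = 2 * d)
      * c1\<^sup>2 / 2)"
    unfolding B[symmetric] by (simp add: power2_eq_square mult.assoc)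
  then show ?thesis
    by (rule expands_cong) (auto simp: \<psi>_def power2_eq_square intro!: always_eventually)
qed

text \<open>
  Contribution of one mixture component: \<open>\<theta>\<close> is the distance of its tail exponent from that of the
  leading component, and \<open>g\<close> its tail or density divided by the leading power. For the leading
  component itself the constant term \<open>1\<close> is removed, which is the role of \<open>of_bool (\<theta> = 0)\<close>.
\<close>

lemma expands_perturbed_power:
  assumes x: "x > 0" and g: "((\<lambda>y. (g y - (1 + k2 * y powr (-2) + k4 * y powr (-4))) * y powr 4)
      \<longlongrightarrow> 0) at_top"
    and \<theta>: "\<theta> = 0 \<or> \<theta> = d \<or> m \<le> \<theta>" "\<theta> \<ge> 0" and \<theta>2: "\<theta> + 2 = d \<or> m \<le> \<theta> + 2" and m4: "m \<le> 4"
  defines "coeff_at \<equiv> (\<lambda>\<tau>. x powr (- \<tau>) * (of_bool (\<theta> = \<tau>) + k2 * of_bool (\<theta> + 2 = \<tau>) + k4 * of_bool (\<theta> + 4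
      = \<tau>)))"
  shows "expands (\<lambda>n. (a n * x) powr (- \<theta>) * g (a n * x) - of_bool (\<theta> = 0)) (coeff_at d) (coeff_at m)"
proof -
  have pw: "expands (\<lambda>n. (a n * x) powr (- \<tau>)) (x powr (- d) * of_bool (\<tau> = d)) (x powr (- m) * of_bool (\<tau>
      = m))"
    if "\<tau> = d \<or> m \<le> \<tau>" for \<tau>
  proof -
    have "expands (\<lambda>n. x powr (- \<tau>) * a n powr (- \<tau>)) (x powr (- \<tau>) * of_bool (\<tau> = d)) (x powr (- \<tau>)
        * of_bool (\<tau> = m))"
      by (intro expands_cmult expands_powr that)
    then have "expands (\<lambda>n. x powr (- \<tau>) * a n powr (- \<tau>)) (x powr (- d) * of_bool (\<tau> = d)) (x powr (- m)
        * of_bool (\<tau> = m))"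
      by (simp add: of_bool_def split: if_splits)
    then show ?thesis
      by (rule expands_cong) (use eventually_a_pos in eventually_elim, simp add: powr_mult)
  qed
  have t0: "expands (\<lambda>n. (a n * x) powr (- \<theta>) - of_bool (\<theta> = 0)) (x powr (- d) * of_bool (\<theta>
      = d)) (x powr (- m) * of_bool (\<theta> = m))"
  proof (cases "\<theta> = 0")
    case True
    have "expands (\<lambda>n. (a n * x) powr (- \<theta>) - of_bool (\<theta> = 0)) 0 0"
      using expands_zero
    proof (rule expands_cong)
      show "eventually (\<lambda>n. 0 = (a n * x) powr (- \<theta>) - of_bool (\<theta> = 0)) F"
        using eventually_a_pos by eventually_elim (use x True in simp)
    qed
    then show ?thesis using True d_pos d_less_m by simp
  next
    case False
    then show ?thesis using pw[of \<theta>] \<theta> by simp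
  qed
  have ax: "filterlim (\<lambda>n. a n * x) at_top F"
    using filterlim_at_top_mult_tendsto_pos[OF tendsto_const x a_top] by (simp add: mult.commute)
  define \<epsilon> where "\<epsilon> = (\<lambda>y. (g y - (1 + k2 * y powr (-2) + k4 * y powr (-4))) * y powr 4)"
  have rem: "expands (\<lambda>n. (a n * x) powr (- \<theta> - 4) * \<epsilon> (a n * x)) 0 0"
  proof (rule expands_0I)
    have e: "a n powr (m - \<theta> - 4) = a n powr m * a n powr (- \<theta> - 4)" for n
      by (simp add: powr_add[symmetric] algebra_simps)
    have "((\<lambda>n. x powr (- \<theta> - 4) * a n powr (m - \<theta> - 4) * \<epsilon> (a n * x))
        \<longlongrightarrow> x powr (- \<theta> - 4) * of_bool (m - \<theta> - 4 = 0) * 0) F"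
      using m4 \<theta> filterlim_compose[OF g ax]
      by (intro tendsto_intros a_powr_tendsto) (auto simp: \<epsilon>_def)
    then have "((\<lambda>n. x powr (- \<theta> - 4) * a n powr (m - \<theta> - 4) * \<epsilon> (a n * x)) \<longlongrightarrow> 0) F" by simp
    then show "((\<lambda>n. a n powr m * ((a n * x) powr (- \<theta> - 4) * \<epsilon> (a n * x))) \<longlongrightarrow> 0) F"
      by (rule Lim_transform_eventually)
         (use eventually_a_pos in eventually_elim, use x e in \<open>simp add: powr_mult\<close>)
  qed
  have 4: "\<theta> + 4 = d \<or> m \<le> \<theta> + 4" using m4 \<theta> by auto
  from expands_add[OF expands_add[OF expands_add[OF t0 expands_cmult[OF pw[OF \<theta>2], of k2]] expands_cmult[OF
      pw[OF 4], of k4]] rem]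
  have "expands (\<lambda>n. (a n * x) powr (- \<theta>) - of_bool (\<theta> = 0) + k2 * (a n * x) powr (- (\<theta> + 2))
      + k4 * (a n * x) powr (- (\<theta> + 4))
     + (a n * x) powr (- \<theta> - 4) * \<epsilon> (a n * x)) (coeff_at d) (coeff_at m)"
    by (simp add: coeff_at_def algebra_simps)
  then show ?thesis
  proof (rule expands_cong, use eventually_a_pos in eventually_elim)
    fix n assume "a n > 0"
    define y where "y = a n * x"
    have y: "y > 0" unfolding y_def using \<open>a n > 0\<close> x by simp
    have p: "y powr (- (\<theta> + 2)) = y powr (- \<theta>) * y powr (-2)" "y powr (- (\<theta> + 4))
        = y powr (- \<theta>) * y powr (-4)"
      unfolding powr_add[symmetric] by (simp_all add: algebra_simps)
    have q: "y powr (- \<theta> - 4) * (c * y powr 4) = y powr (- \<theta>) * c" for c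
    proof -
      have "y powr (- \<theta> - 4) * (c * y powr 4) = (y powr (- \<theta> - 4) * y powr 4) * c" by (simp only: mult_ac)
      also have "y powr (- \<theta> - 4) * y powr 4 = y powr (- \<theta>)" unfolding powr_add[symmetric] by simp
      finally show ?thesis .
    qed
    show "(a n * x) powr (- \<theta>) - of_bool (\<theta> = 0) + k2 * (a n * x) powr (- (\<theta> + 2))
        + k4 * (a n * x) powr (- (\<theta> + 4))
     + (a n * x) powr (- \<theta> - 4) * \<epsilon> (a n * x) = (a n * x) powr (- \<theta>) * g (a n * x) - of_bool (\<theta> = 0)"
      unfolding y_def[symmetric] \<epsilon>_def q p by (simp add: algebra_simps)
  qed
qed

text \<open>
  The logarithm of \<open>(1 - \<tau> / n) ^ (n - 1)\<close>, relative to its limit \<open>- w\<close>. With \<open>z = 1 / n\<close> and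
  \<open>s = z * \<tau>\<close>, expanding \<open>ln (1 - s)\<close> to third order gives
  \<open>- \<tau> + z * (\<tau> - \<tau>\<^sup>2 / 2) + z\<^sup>2 * (\<tau>\<^sup>2 / 2 - \<tau> ^ 3 / 3)\<close> up to \<open>o(z\<^sup>2)\<close>. Substituting \<open>\<tau> = w * (1 + A)\<close> leaves
  a polynomial in \<open>A\<close> and \<open>z\<close>; of its nonlinear terms only \<open>z * A\<close> and \<open>z\<^sup>2\<close> have a second-order
  coefficient, because any product of three factors is negligible.
\<close>

lemma expands_log_power:
  fixes n :: "'n \<Rightarrow> real" and \<tau> :: "'n \<Rightarrow> real"
  assumes w: "w > 0" and n_pos: "eventually (\<lambda>i. n i > 0) F"
    and A: "expands (\<lambda>i. \<tau> i / w - 1) \<alpha>1 \<alpha>2" and z: "expands (\<lambda>i. 1 / n i) \<zeta>1 \<zeta>2"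
  shows "expands (\<lambda>i. (n i - 1) * ln (1 - \<tau> i / n i) + w)
     (- w * \<alpha>1 + \<zeta>1 * (w - w\<^sup>2 / 2))
     (- w * \<alpha>2 + \<zeta>2 * (w - w\<^sup>2 / 2)
        + of_bool (m = 2 * d) * (\<zeta>1 * \<alpha>1 * (w - w\<^sup>2) + \<zeta>1\<^sup>2 * (w\<^sup>2 / 2 - w ^ 3 / 3)))"
proof -
  define A where "A = (\<lambda>i. \<tau> i / w - 1)"
  define z where "z = (\<lambda>i. 1 / n i)"
  have eA: "expands A \<alpha>1 \<alpha>2" and ez: "expands z \<zeta>1 \<zeta>2" using assms by (simp_all add: A_def z_def)
  have tau: "\<tau> i = w * (1 + A i)" for i using w by (simp add: A_def)
  have lim_tau: "(\<tau> \<longlongrightarrow> w * (1 + 0)) F"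
    unfolding tau[abs_def] by (intro tendsto_intros expands_tendsto_0[OF eA])
  have lim_z: "(z \<longlongrightarrow> 0) F" by (rule expands_tendsto_0[OF ez])
  define \<psi> where "\<psi> = (\<lambda>s::real. if s = 0 then 0 else (ln (1 - s) + s + s\<^sup>2 / 2 + s ^ 3 / 3) / s ^ 3)"
  have "((\<lambda>s::real. (ln (1 - s) + s + s\<^sup>2 / 2 + s ^ 3 / 3) / s ^ 3) \<longlongrightarrow> 0) (at 0)"
  proof (rule lhopital)
    have "((\<lambda>s::real. ln (1 - s) + s + s\<^sup>2 / 2 + s ^ 3 / 3) \<longlongrightarrow> ln (1 - 0) + 0 + 0\<^sup>2 / 2 + 0 ^ 3 / 3) (at 0)"
      by (intro tendsto_intros) simp_all
    then show "((\<lambda>s::real. ln (1 - s) + s + s\<^sup>2 / 2 + s ^ 3 / 3) \<longlongrightarrow> 0) (at 0)" by simp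
    show "((\<lambda>s::real. s ^ 3) \<longlongrightarrow> 0) (at 0)" by real_asymp
    show "eventually (\<lambda>s::real. s ^ 3 \<noteq> 0) (at 0)" "eventually (\<lambda>s::real. 3 * s\<^sup>2 \<noteq> 0) (at 0)"
      by (auto simp: eventually_at_filter)
    have "eventually (\<lambda>s::real. s < 1) (at 0)"
      unfolding eventually_at by (auto intro!: exI[of _ 1] simp: dist_real_def)
    then show "eventually (\<lambda>s::real. ((\<lambda>s. ln (1 - s) + s + s\<^sup>2 / 2 + s ^ 3 / 3) has_real_derivative
        - (s ^ 3 / (1 - s))) (at s)) (at 0)"
      by eventually_elim
         (auto intro!: derivative_eq_intros simp: divide_simps power2_eq_square power3_eq_cube
             algebra_simps)
    show "eventually (\<lambda>s::real. ((\<lambda>s. s ^ 3) has_real_derivative 3 * s\<^sup>2) (at s)) (at 0)"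
      by (auto intro!: always_eventually derivative_eq_intros)
    have "((\<lambda>s::real. - (s / (1 - s) / 3)) \<longlongrightarrow> - (0 / (1 - 0) / 3)) (at 0)"
      by (intro tendsto_intros) simp_all
    then have "((\<lambda>s::real. - (s / (1 - s) / 3)) \<longlongrightarrow> 0) (at 0)" by simp
    then show "((\<lambda>s::real. - (s ^ 3 / (1 - s)) / (3 * s\<^sup>2)) \<longlongrightarrow> 0) (at 0)"
      by (rule Lim_transform_eventually)
         (auto simp: eventually_at_filter power2_eq_square power3_eq_cube intro!: always_eventually)
  qed
  then have "(\<psi> \<longlongrightarrow> 0) (at 0)"
    by (rule Lim_transform_eventually) (auto simp: \<psi>_def eventually_at_filter)
  then have "isCont \<psi> 0" by (simp add: isCont_def \<psi>_def)
  moreover have "((\<lambda>i. z i * \<tau> i) \<longlongrightarrow> 0) F" using tendsto_mult[OF lim_z lim_tau] by simp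
  ultimately have "((\<lambda>i. \<psi> (z i * \<tau> i)) \<longlongrightarrow> \<psi> 0) F" by (rule isCont_tendsto_compose)
  then have lim_psi: "((\<lambda>i. \<psi> (z i * \<tau> i)) \<longlongrightarrow> 0) F" by (simp add: \<psi>_def)
  \<comment> \<open>The remainder divided by \<open>z\<^sup>2\<close>, where \<open>\<psi> s * s ^ 3\<close> is the error of the cubic for \<open>ln (1 - s)\<close>.\<close>
  define \<rho> where "\<rho> = (\<lambda>i. \<psi> (z i * \<tau> i) * \<tau> i ^ 3 + z i * \<tau> i ^ 3 / 3 - \<psi> (z i * \<tau> i) * z i * \<tau> i ^ 3)"
  have "(\<rho> \<longlongrightarrow> 0 * (w * (1 + 0)) ^ 3 + 0 * (w * (1 + 0)) ^ 3 / 3 - 0 * 0 * (w * (1 + 0)) ^ 3) F"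
    unfolding \<rho>_def by (intro tendsto_intros lim_psi lim_z lim_tau) auto
  then have lim_rho: "(\<rho> \<longlongrightarrow> 0) F" by simp
  note zA = expands_mult[OF ez eA] and zz = expands_mult[OF ez ez]
  note zAA = expands_mult_0[OF zA eA] and zzA = expands_mult_0[OF zz eA]
  note zzAA = expands_mult_0[OF zzA eA]
  note zzAAA = expands_mult_0[OF zzAA eA]
  note rem = expands_mult_null[OF zz lim_rho]
  \<comment> \<open>A name for the indicator keeps the simplifier from splitting on it.\<close>
  obtain B :: real where B: "B = of_bool (m = 2 * d)" by simp
  note total = expands_add[OF expands_add[OF expands_add[OF expands_cmult[OF eA, of "- w"] expands_cmult[OF
      ez, of "w - w\<^sup>2 / 2"]]
      expands_add[OF expands_cmult[OF zA, of "w - w\<^sup>2"] expands_cmult[OF zAA, of "- (w\<^sup>2 / 2)"]]]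
      expands_add[OF expands_add[OF expands_cmult[OF zz, of "w\<^sup>2 / 2
          - w ^ 3 / 3"] expands_cmult[OF zzA, of "w\<^sup>2 - w ^ 3"]]
        expands_add[OF expands_add[OF expands_cmult[OF zzAA, of "w\<^sup>2 / 2
            - w ^ 3"] expands_cmult[OF zzAAA, of "- (w ^ 3 / 3)"]] rem]]]
  show ?thesis
  proof (rule expands_cong)
    show "expands (\<lambda>i. - w * A i + (w - w\<^sup>2 / 2) * z i
        + ((w - w\<^sup>2) * (z i * A i) + - (w\<^sup>2 / 2) * (z i * A i * A i))
       + ((w\<^sup>2 / 2 - w ^ 3 / 3) * (z i * z i) + (w\<^sup>2 - w ^ 3) * (z i * z i * A i)
          + ((w\<^sup>2 / 2 - w ^ 3) * (z i * z i * A i * A i) + - (w ^ 3 / 3) * (z i * z i * A i * A i * A i)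
              + z i * z i * \<rho> i)))
     (- w * \<alpha>1 + \<zeta>1 * (w - w\<^sup>2 / 2))
     (- w * \<alpha>2 + \<zeta>2 * (w - w\<^sup>2 / 2)
        + of_bool (m = 2 * d) * (\<zeta>1 * \<alpha>1 * (w - w\<^sup>2) + \<zeta>1\<^sup>2 * (w\<^sup>2 / 2 - w ^ 3 / 3)))"
      using total unfolding B[symmetric] by (simp add: algebra_simps power2_eq_square)
  next
    show "eventually (\<lambda>i. - w * A i + (w - w\<^sup>2 / 2) * z i
        + ((w - w\<^sup>2) * (z i * A i) + - (w\<^sup>2 / 2) * (z i * A i * A i))
       + ((w\<^sup>2 / 2 - w ^ 3 / 3) * (z i * z i) + (w\<^sup>2 - w ^ 3) * (z i * z i * A i)
          + ((w\<^sup>2 / 2 - w ^ 3) * (z i * z i * A i * A i) + - (w ^ 3 / 3) * (z i * z i * A i * A i * A i)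
              + z i * z i * \<rho> i))
       = (n i - 1) * ln (1 - \<tau> i / n i) + w) F"
      using n_pos
    proof eventually_elim
      case (elim i)
      define s where "s = z i * \<tau> i"
      have ln: "ln (1 - s) = - s - s\<^sup>2 / 2 - s ^ 3 / 3 + \<psi> s * s ^ 3"
        by (simp add: \<psi>_def)
      have z1: "z i * n i = 1" using elim by (simp add: z_def)
      have "\<tau> i / n i = s" by (simp add: s_def z_def)
      then have "(n i - 1) * ln (1 - \<tau> i / n i) = (n i - 1) * (- s - s\<^sup>2 / 2 - s ^ 3 / 3 + \<psi> s * s ^ 3)"
        unfolding ln[symmetric] by simp
      also have "\<dots> = - \<tau> i + z i * (\<tau> i - (\<tau> i)\<^sup>2 / 2) + (z i)\<^sup>2 * ((\<tau> i)\<^sup>2 / 2 - \<tau> i ^ 3 / 3)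
          + (z i)\<^sup>2 * \<rho> i"
        using z1 unfolding \<rho>_def s_def by (simp add: field_simps) algebra
      finally show ?case unfolding tau by (simp add: field_simps) algebra
    qed
  qed
qed

end

section \<open>The density of the normalized maximum\<close>

text \<open>
  For two degrees of freedom \<open>student_C 2 = 1 / (2 * sqrt 2)\<close>, so the constant of the sample size correction
  takes the explicit form that appears in the two regimes with \<open>v 1 = 2\<close>.
\<close>

lemma kappa_two_degrees:
  assumes "v 1 = 2"
  shows "kappa p v \<beta> = p 1 * student_cdf 3 (sqrt 3 * \<beta> 1) / 2"
proof -
  have "Gamma (3/2 :: real) = sqrt pi / 2"
    using Gamma_plus1[of "1/2 :: real"] nonpos_Ints_nonpos[of "1/2 :: real"]
    by (auto simp: Gamma_one_half_real)
  then have C: "student_C 2 * 2 powr (1/2) = 1 / 2"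
    by (simp add: student_C_def real_sqrt_mult powr_half_sqrt)
  have "kappa p v \<beta> = p 1 * (student_C 2 * 2 powr (1/2)) * student_cdf 3 (\<beta> 1 * sqrt 3)"
    unfolding kappa_def assms by simp
  then show ?thesis unfolding C by (simp add: mult.commute)
qed

locale skewt_mixture =
  fixes r :: nat and p v \<beta> :: "nat \<Rightarrow> real"
  assumes params: "mstd_parameters r p v"
begin

(* The constants are written with the index 1, which simplification would turn into Suc 0. *)
declare One_nat_def [simp del]

abbreviation "a \<equiv> norming p v \<beta>"
abbreviation "\<kappa> \<equiv> kappa p v \<beta>"

text \<open>
  The tail constant of component \<open>i\<close> relative to that of the first component; \<open>weight 2\<close> and \<open>weight 3\<close>
  are \<open>A3\<close> and \<open>A5\<close>.
\<close>

definition weight :: "nat \<Rightarrow> real" where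
  "weight i = p i * tail_const (v i) (\<beta> i) / \<kappa>"

text \<open>
  For \<open>\<theta> > 0\<close>, the coefficients of \<open>y powr (- \<theta>)\<close> in the relative corrections of the mixture tail and of the mixture
  density. Several components can contribute to the same power.
\<close>

definition tail_coeff :: "real \<Rightarrow> real" where
  "tail_coeff \<theta> = (\<Sum>i=1..r. weight i * (of_bool (v i - v 1 = \<theta>)
     + v i / (v i + 2) * pdf_coeff2 (v i) (\<beta> i) * of_bool (v i - v 1 + 2 = \<theta>)
     + v i / (v i + 4) * pdf_coeff4 (v i) (\<beta> i) * of_bool (v i - v 1 + 4 = \<theta>)))"

definition density_coeff :: "real \<Rightarrow> real" where
  "density_coeff \<theta> = (\<Sum>i=1..r. weight i * (v i / v 1) * (of_bool (v i - v 1 = \<theta>)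
     + pdf_coeff2 (v i) (\<beta> i) * of_bool (v i - v 1 + 2 = \<theta>)
     + pdf_coeff4 (v i) (\<beta> i) * of_bool (v i - v 1 + 4 = \<theta>)))"

lemma r_pos: "1 \<le> r"
proof (rule ccontr)
  assume "\<not> 1 \<le> r"
  then have "(\<Sum>i=1..r. p i) = 0" by simp
  then show False using params by (simp add: mstd_parameters_def)
qed

lemma v_pos: "i \<in> {1..r} \<Longrightarrow> v i > 0" and p_pos: "i \<in> {1..r} \<Longrightarrow> p i > 0"
  and sum_p: "(\<Sum>i=1..r. p i) = 1"
  using params by (auto simp: mstd_parameters_def)

lemma v_less: "i \<in> {1..r} \<Longrightarrow> j \<in> {1..r} \<Longrightarrow> i < j \<Longrightarrow> v i < v j"
  using params by (auto simp: mstd_parameters_def strict_mono_on_def)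

lemma v1_pos: "v 1 > 0" and p1_pos: "p 1 > 0"
  using v_pos[of 1] p_pos[of 1] r_pos by auto

lemma kappa_eq: "\<kappa> = p 1 * tail_const (v 1) (\<beta> 1)"
  by (simp add: kappa_def tail_const_def)

lemma kappa_pos: "\<kappa> > 0"
  unfolding kappa_eq using p1_pos tail_const_pos[OF v1_pos] by simp

lemma weight_1: "weight 1 = 1"
  using kappa_pos by (simp add: weight_def flip: kappa_eq)

lemma norming_powr: "a n powr v 1 = 2 * \<kappa> * n"
proof -
  have "a n powr v 1 = (2 * p 1 * student_C (v 1) * student_cdf (v 1 + 1) (\<beta> 1 * sqrt (v 1 + 1)))
     * v 1 powr ((v 1 - 1) / 2) * real n"
    using v1_pos p1_pos student_C_pos[OF v1_pos] student_cdf_pos[of "v 1 + 1"]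
    unfolding norming_def by (simp add: powr_mult powr_powr abs_of_pos)
  then show ?thesis by (simp add: kappa_def)
qed

lemma norming_nonneg: "a n \<ge> 0"
  by (simp add: norming_def)

lemma norming_eq: "a n = (2 * \<kappa> * n) powr (1 / v 1)"
  using v1_pos norming_nonneg[of n] unfolding norming_powr[symmetric] by (simp add: powr_powr)

lemma norming_at_top: "filterlim a at_top sequentially"
proof -
  have "filterlim (\<lambda>n. (c * real n) powr q) at_top sequentially" if "c > 0" "q > 0" for c q :: real
    using that by real_asymp
  from this[of "2 * \<kappa>" "1 / v 1"] kappa_pos v1_pos
  have "filterlim (\<lambda>n. (2 * \<kappa> * real n) powr (1 / v 1)) at_top sequentially" by simp
  then show ?thesis unfolding norming_eq[abs_def] .
qed

lemma one_minus_mstd_cdf: "1 - mstd_cdf r p v \<beta> y = (\<Sum>i=1..r. p i * (1 - skewt_cdf (v i) (\<beta> i) y))"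
  using sum_p by (simp add: mstd_cdf_def algebra_simps sum_subtractf)

lemma mstd_pdf_eq: "mstd_pdf r p v \<beta> y = (\<Sum>i=1..r. p i * skewt_pdf (v i) (\<beta> i) y)"
proof -
  have "(mstd_cdf r p v \<beta> has_real_derivative (\<Sum>i=1..r. p i * skewt_pdf (v i) (\<beta> i) y)) (at y)"
    unfolding mstd_cdf_def
    by (intro DERIV_sum DERIV_cmult skewt_cdf_has_real_derivative v_pos)
  then show ?thesis unfolding mstd_pdf_def by (rule DERIV_imp_deriv)
qed

lemma mstd_cdf_at_top: "(mstd_cdf r p v \<beta> \<longlongrightarrow> 1) at_top"
proof -
  have "((\<lambda>y. \<Sum>i=1..r. p i * skewt_cdf (v i) (\<beta> i) y) \<longlongrightarrow> (\<Sum>i=1..r. p i * 1)) at_top"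
    by (intro tendsto_sum tendsto_mult tendsto_const skewt_cdf_at_top v_pos)
  then show ?thesis unfolding mstd_cdf_def[abs_def] using sum_p by simp
qed

text \<open>
  The number \<open>n\<close> is expressed through \<open>y = a * x\<close> by the defining property of the norming sequence, so
  the expected number of exceedances contributed by a component is its weight times a perturbed
  power of \<open>y\<close>.
\<close>

lemma tail_component:
  assumes i: "i \<in> {1..r}" and y: "y > 0" and x: "x > 0" and n: "y powr v 1 = 2 * \<kappa> * n * x powr v 1"
  shows "n * (p i * (1 - skewt_cdf (v i) (\<beta> i) y)) / x powr (- v 1)
    = weight i * (y powr (- (v i - v 1)) * ((1 - skewt_cdf (v i) (\<beta> i) y) / (2 * tail_const (v i) (\<beta> i)
        * y powr (- v i))))"
proof -
  have "y powr (- (v i - v 1)) = y powr (- v i) * (2 * \<kappa> * n * x powr v 1)"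
    unfolding n[symmetric] by (simp add: powr_add[symmetric])
  then show ?thesis
    using tail_const_pos[OF v_pos[OF i], of "\<beta> i"] kappa_pos x y
    by (simp add: weight_def powr_minus field_simps)
qed

lemma density_component:
  assumes i: "i \<in> {1..r}" and s: "s > 0" and x: "x > 0" and n: "s powr v 1 = 2 * \<kappa> * n"
  shows "n * s * (p i * skewt_pdf (v i) (\<beta> i) (s * x)) / (v 1 * x powr (- v 1 - 1))
    = weight i * (v i / v 1) * ((s * x) powr (- (v i - v 1))
        * (skewt_pdf (v i) (\<beta> i) (s * x) / (2 * v i * tail_const (v i) (\<beta> i) * (s * x) powr (- v i - 1))))"
proof -
  have "(s * x) powr (- (v i - v 1)) = (s * x) powr (- v i - 1) * (s * x) powr v 1 * (s * x)"
  proof -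
    have "(s * x) powr (- v i - 1) * (s * x) powr v 1 * (s * x) powr 1 = (s * x) powr (- (v i - v 1))"
      unfolding powr_add[symmetric] by (simp add: algebra_simps)
    then show ?thesis using s x by simp
  qed
  also have "\<dots> = (s * x) powr (- v i - 1) * (2 * \<kappa> * n * x powr v 1) * (s * x)"
    using s x n by (simp add: powr_mult)
  finally have 1: "(s * x) powr (- (v i - v 1)) = (s * x) powr (- v i - 1) * (2 * \<kappa> * n * x powr v 1)
      * (s * x)" .
  have 2: "x powr (- v 1 - 1) = 1 / (x powr v 1 * x)"
    using x by (simp add: powr_diff powr_minus field_simps)
  have "(s * x) powr (- v i - 1) > 0" using s x by simp
  then show ?thesis
    unfolding 1 2 using tail_const_pos[OF v_pos[OF i], of "\<beta> i"] kappa_pos s x v1_pos v_pos[OF i]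
    by (simp add: weight_def)
qed

text \<open>
  All exponents other than \<open>d\<close> are at least \<open>m\<close>, by hypothesis for those of the form \<open>v i - v 1\<close>
  and \<open>2\<close>. For \<open>v i - v 1 + 2\<close> with \<open>i \<ge> 2\<close> this follows from \<open>v i - v 1 \<ge> d\<close> and
  \<open>m \<le> 2 * d \<le> d + 2\<close>, and the remainder \<open>o(y powr (- 4))\<close> is negligible because \<open>m \<le> 4\<close>.
\<close>

lemma expands_mixture:
  fixes g :: "nat \<Rightarrow> real \<Rightarrow> real"
  assumes "two_scale a sequentially d m" and x: "x > 0"
    and d2: "2 = d \<or> m \<le> 2" and di: "\<And>i. i \<in> {2..r} \<Longrightarrow> v i - v 1 = d \<or> m \<le> v i - v 1" and "d \<le> 2"
    and g: "\<And>i. i \<in> {1..r} \<Longrightarrow> ((\<lambda>y. (g i y - (1 + k2 i * y powr (-2) + k4 i * y powr (-4))) * y powr 4)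
        \<longlongrightarrow> 0) at_top"
    and c1: "c 1 = 1"
  defines "coeff_at \<equiv> (\<lambda>\<theta>. x powr (- \<theta>) * (\<Sum>i=1..r. c i * (of_bool (v i - v 1 = \<theta>)
     + k2 i * of_bool (v i - v 1 + 2 = \<theta>) + k4 i * of_bool (v i - v 1 + 4 = \<theta>))))"
  shows "two_scale.expands a sequentially d m
    (\<lambda>n. (\<Sum>i=1..r. c i * ((a n * x) powr (- (v i - v 1)) * g i (a n * x))) - 1) (coeff_at d) (coeff_at m)"
proof -
  interpret two_scale a sequentially d m by fact
  have "expands (\<lambda>n. (a n * x) powr (- (v i - v 1)) * g i (a n * x) - of_bool (v i - v 1 = 0))
     (x powr (- d) * (of_bool (v i - v 1 = d) + k2 i * of_bool (v i - v 1 + 2 = d)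
         + k4 i * of_bool (v i - v 1 + 4 = d)))
     (x powr (- m) * (of_bool (v i - v 1 = m) + k2 i * of_bool (v i - v 1 + 2 = m)
         + k4 i * of_bool (v i - v 1 + 4 = m)))"
    if i: "i \<in> {1..r}" for i
  proof (rule expands_perturbed_power[OF x g[OF i]])
    show "v i - v 1 \<ge> 0" using v_less[of 1 i] i by (cases "i = 1") auto
    show "v i - v 1 = 0 \<or> v i - v 1 = d \<or> m \<le> v i - v 1" using di[of i] i by (cases "i = 1") auto
    show "v i - v 1 + 2 = d \<or> m \<le> v i - v 1 + 2"
      using di[of i] i d2 m_le_2d \<open>d \<le> 2\<close> by (cases "i = 1") auto
    show "m \<le> 4" using m_le_2d \<open>d \<le> 2\<close> by simp
  qed
  then have *: "expands (\<lambda>n. \<Sum>i=1..r. c i * ((a n * x) powr (- (v i - v 1)) * g i (a n * x)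
      - of_bool (v i - v 1 = 0))) (coeff_at d) (coeff_at m)"
    unfolding coeff_at_def sum_distrib_left mult.left_commute[of "x powr _"]
    by (intro expands_sum expands_cmult) auto
  have "(\<Sum>i=1..r. c i * of_bool (v i - v 1 = 0)) = (\<Sum>i=1..r. of_bool (i = 1))"
    using v_less[of 1] by (intro sum.cong) (fastforce simp: c1)+
  also have "\<dots> = 1" using r_pos by (simp add: of_bool_def)
  finally show ?thesis using * by (simp add: right_diff_distrib sum_subtractf)
qed

text \<open>
  The common form of all regimes. The hypotheses say that each of the three competing exponents
  \<open>2\<close>, \<open>v 1\<close>, \<open>v i - v 1\<close> is either the leading one or at least \<open>m\<close>. Here \<open>b d\<close> and \<open>e\<close> are the
  leading coefficients of the density factor and of the exponent in the formula for the density of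
  the maximum; in the second coefficient, the summand with \<open>m = 2 * d\<close> collects the products: the mixed
  and squared sample size terms of the exponent, the product of the two factors, and the square from
  the exponential series.
\<close>

theorem pdf_error_second_order:
  fixes d m x :: real
  assumes x: "x > 0" and d: "0 < d" "d < m" "m \<le> 2 * d" "d \<le> 2"
    and d2: "2 = d \<or> m \<le> 2" and dv: "v 1 = d \<or> m \<le> v 1"
    and di: "\<And>i. i \<in> {2..r} \<Longrightarrow> v i - v 1 = d \<or> m \<le> v i - v 1"
  defines "w \<equiv> x powr (- v 1)"
    and "\<alpha> \<equiv> (\<lambda>\<theta>. x powr (- \<theta>) * tail_coeff \<theta>)"
    and "b \<equiv> (\<lambda>\<theta>. x powr (- \<theta>) * density_coeff \<theta>)"
  defines "e \<equiv> - w * \<alpha> d + of_bool (v 1 = d) * (\<kappa> * (2 * w - w\<^sup>2))"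
  shows "(\<lambda>n. a n powr (m - d) * (a n powr d * pdf_error r p v \<beta> n x - (b d + e) * frechet_pdf (v 1) x))
     \<longlonglongrightarrow> (b m - w * \<alpha> m + of_bool (v 1 = m) * (\<kappa> * (2 * w - w\<^sup>2))
       + of_bool (m = 2 * d) * (of_bool (v 1 = d) * (2 * \<kappa> * \<alpha> d * (w - w\<^sup>2)
           + 4 * \<kappa>\<^sup>2 * (w\<^sup>2 / 2 - w ^ 3 / 3))
            + b d * e + e\<^sup>2 / 2)) * frechet_pdf (v 1) x"
proof -
  interpret two_scale a sequentially d m
    using norming_at_top d by unfold_locales auto
  note ts = two_scale_axioms
  have w: "w > 0" using x by (simp add: w_def)
  let ?F = "mstd_cdf r p v \<beta>" and ?f = "mstd_pdf r p v \<beta>"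
  define \<tau> where "\<tau> = (\<lambda>n. real n * (1 - ?F (a n * x)))"
  define A where "A = (\<lambda>n. \<tau> n / w - 1)"
  define B where "B = (\<lambda>n. real n * a n * ?f (a n * x) / (v 1 * x powr (- v 1 - 1)) - 1)"
  have ax: "(a n * x) powr v 1 = 2 * \<kappa> * real n * x powr v 1" if "a n > 0" for n
    using that x by (simp add: powr_mult norming_powr)
  have A: "expands A (\<alpha> d) (\<alpha> m)"
  proof (rule expands_cong)
    show "expands (\<lambda>n. (\<Sum>i=1..r. weight i * ((a n * x) powr (- (v i - v 1)) *
       ((1 - skewt_cdf (v i) (\<beta> i) (a n * x)) / (2 * tail_const (v i) (\<beta> i) * (a n * x) powr (- v i)))))
           - 1) (\<alpha> d) (\<alpha> m)"
      unfolding \<alpha>_def tail_coeff_def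
      by (rule expands_mixture[OF ts x d2 di d(4), where g
          = "\<lambda>i y. (1 - skewt_cdf (v i) (\<beta> i) y) / (2 * tail_const (v i) (\<beta> i) * y powr (- v i))"])
         (rule skewt_cdf_expansion v_pos weight_1 | assumption)+
    show "eventually (\<lambda>n. (\<Sum>i=1..r. weight i * ((a n * x) powr (- (v i - v 1)) *
       ((1 - skewt_cdf (v i) (\<beta> i) (a n * x)) / (2 * tail_const (v i) (\<beta> i) * (a n * x) powr (- v i))))) - 1
           = A n) sequentially"
      using eventually_a_pos
    proof eventually_elim
      case (elim n)
      have "A n = (\<Sum>i=1..r. real n * (p i * (1 - skewt_cdf (v i) (\<beta> i) (a n * x))) / x powr (- v 1)) - 1"
        by (simp add: A_def \<tau>_def w_def one_minus_mstd_cdf sum_distrib_left sum_divide_distrib)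
      also have "(\<Sum>i=1..r. real n * (p i * (1 - skewt_cdf (v i) (\<beta> i) (a n * x))) / x powr (- v 1))
          = (\<Sum>i=1..r. weight i * ((a n * x) powr (- (v i - v 1)) *
       ((1 - skewt_cdf (v i) (\<beta> i) (a n * x)) / (2 * tail_const (v i) (\<beta> i) * (a n * x) powr (- v i)))))"
        using elim x by (intro sum.cong refl tail_component ax) auto
      finally show ?case by simp
    qed
  qed
  have B: "expands B (b d) (b m)"
  proof (rule expands_cong)
    show "expands (\<lambda>n. (\<Sum>i=1..r. weight i * (v i / v 1) * ((a n * x) powr (- (v i - v 1)) *
       (skewt_pdf (v i) (\<beta> i) (a n * x) / (2 * v i * tail_const (v i) (\<beta> i) * (a n * x) powr (- v i - 1)))))
           - 1) (b d) (b m)"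
      unfolding b_def density_coeff_def
      by (rule expands_mixture[OF ts x d2 di d(4), where g
          = "\<lambda>i y. skewt_pdf (v i) (\<beta> i) y / (2 * v i * tail_const (v i) (\<beta> i) * y powr (- v i - 1))"])
         (rule skewt_pdf_expansion v_pos | assumption | use v1_pos weight_1 in simp)+
    show "eventually (\<lambda>n. (\<Sum>i=1..r. weight i * (v i / v 1) * ((a n * x) powr (- (v i - v 1)) *
       (skewt_pdf (v i) (\<beta> i) (a n * x) / (2 * v i * tail_const (v i) (\<beta> i) * (a n * x) powr (- v i - 1)))))
           - 1 = B n) sequentially"
      using eventually_a_pos
    proof eventually_elim
      case (elim n)
      have "B n = (\<Sum>i=1..r. real n * a n * (p i * skewt_pdf (v i) (\<beta> i) (a n * x)) / (v 1
          * x powr (- v 1 - 1))) - 1"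
        by (simp add: B_def mstd_pdf_eq sum_distrib_left sum_divide_distrib)
      also have "(\<Sum>i=1..r. real n * a n * (p i * skewt_pdf (v i) (\<beta> i) (a n * x)) / (v 1
          * x powr (- v 1 - 1)))
          = (\<Sum>i=1..r. weight i * (v i / v 1) * ((a n * x) powr (- (v i - v 1)) *
       (skewt_pdf (v i) (\<beta> i) (a n * x) / (2 * v i * tail_const (v i) (\<beta> i) * (a n * x) powr (- v i
           - 1)))))"
        using elim x by (intro sum.cong refl density_component) (auto simp: norming_powr)
      finally show ?case by simp
    qed
  qed
  have n_pos: "eventually (\<lambda>n. real n > 0) sequentially"
    using eventually_gt_at_top[of 0] by eventually_elim simp
  have z: "expands (\<lambda>n. 1 / real n) (2 * \<kappa> * of_bool (v 1 = d)) (2 * \<kappa> * of_bool (v 1 = m))"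
    by (rule expands_cong[OF expands_cmult[OF expands_powr[OF dv], of "2 * \<kappa>"]])
       (use n_pos in eventually_elim, use kappa_pos in \<open>simp add: powr_minus norming_powr field_simps\<close>)
  \<comment> \<open>The exponent: \<open>F\<close> to the power \<open>n - 1\<close> is \<open>exp (- w) * exp (E n)\<close>.\<close>
  define E where "E = (\<lambda>n. (real n - 1) * ln (1 - \<tau> n / real n) + w)"
  obtain D V :: real where DV: "D = of_bool (m = 2 * d)" "V = of_bool (v 1 = d)" by simp
  \<comment> \<open>An indicator is idempotent, which merges the squared sample size term with the mixed one.\<close>
  have VV: "V\<^sup>2 = V" by (simp add: DV)
  have e1: "- w * \<alpha> d + 2 * \<kappa> * V * (w - w\<^sup>2 / 2) = e"
    unfolding e_def DV[symmetric] by (simp add: algebra_simps)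
  have E: "expands E e (- w * \<alpha> m + 2 * \<kappa> * of_bool (v 1 = m) * (w - w\<^sup>2 / 2)
     + D * (2 * \<kappa> * V * \<alpha> d * (w - w\<^sup>2) + (2 * \<kappa> * V)\<^sup>2 * (w\<^sup>2 / 2 - w ^ 3 / 3)))"
    using expands_log_power[OF w n_pos A[unfolded A_def] z]
    unfolding E_def DV[symmetric] e1 .
  note X = expands_exp[OF E, folded DV]
  note R = expands_add[OF expands_add[OF B X] expands_mult[OF B X, folded DV]]
  have lim_ax: "filterlim (\<lambda>n. a n * x) at_top sequentially"
    using filterlim_at_top_mult_tendsto_pos[OF tendsto_const x a_top] by (simp add: mult.commute)
  have F_pos: "eventually (\<lambda>n. ?F (a n * x) > 0) sequentially"
    using order_tendstoD(1)[OF filterlim_compose[OF mstd_cdf_at_top lim_ax], of 0] by simp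
  have err: "eventually (\<lambda>n. frechet_pdf (v 1) x * (B n + (exp (E n) - 1) + B n * (exp (E n) - 1))
      = pdf_error r p v \<beta> n x) sequentially"
    using n_pos F_pos
  proof eventually_elim
    case (elim n)
    have "1 - \<tau> n / real n = ?F (a n * x)" using elim by (simp add: \<tau>_def)
    moreover have "?F (a n * x) ^ (n - 1) = exp ((real n - 1) * ln (?F (a n * x)))"
      using elim by (simp add: powr_realpow[symmetric] powr_def of_nat_diff)
    ultimately have P: "?F (a n * x) ^ (n - 1) = exp (E n) * exp (- w)"
      by (simp add: E_def exp_add[symmetric])
    have fr: "frechet_pdf (v 1) x = v 1 * x powr (- v 1 - 1) * exp (- w)"
      using x by (simp add: frechet_pdf_def frechet_cdf_def w_def)
    have f: "real n * a n * ?f (a n * x) = v 1 * x powr (- v 1 - 1) * (1 + B n)"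
      using v1_pos x by (simp add: B_def)
    have "pdf_error r p v \<beta> n x = ?F (a n * x) ^ (n - 1) * (real n * a n * ?f (a n * x))
        - frechet_pdf (v 1) x"
      by (simp add: pdf_error_def normalized_max_pdf_def)
    also have "\<dots> = frechet_pdf (v 1) x * (B n + (exp (E n) - 1) + B n * (exp (E n) - 1))"
      unfolding P f fr by (simp add: algebra_simps)
    finally show ?case by simp
  qed
  define c2 where "c2 = b m - w * \<alpha> m + of_bool (v 1 = m) * (\<kappa> * (2 * w - w\<^sup>2))
       + D * (V * (2 * \<kappa> * \<alpha> d * (w - w\<^sup>2) + 4 * \<kappa>\<^sup>2 * (w\<^sup>2 / 2 - w ^ 3 / 3))
            + b d * e + e\<^sup>2 / 2)"
  have "b d + e + 0 = b d + e" by simp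
  moreover have "b m + (- w * \<alpha> m + 2 * \<kappa> * of_bool (v 1 = m) * (w - w\<^sup>2 / 2)
     + D * (2 * \<kappa> * V * \<alpha> d * (w - w\<^sup>2) + (2 * \<kappa> * V)\<^sup>2 * (w\<^sup>2 / 2 - w ^ 3 / 3)) + D * e\<^sup>2 / 2)
         + D * b d * e = c2"
    unfolding c2_def power_mult_distrib VV by (simp add: algebra_simps)
  ultimately have "expands (\<lambda>n. B n + (exp (E n) - 1) + B n * (exp (E n) - 1)) (b d + e) c2"
    using R by simp
  from expands_second_order[OF expands_cong[OF expands_cmult[OF this, of "frechet_pdf (v 1) x"] err]]
  show ?thesis unfolding c2_def DV by (simp add: mult.commute)
qed

text \<open>
  The constants \<open>A1\<close>, ..., \<open>A5\<close> and \<open>K1\<close>, \<open>K2\<close>, \<open>K3\<close> are the expansion coefficients of the first two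
  components and the weights of the second and third.
\<close>

lemma A1_eq: "A1 v \<beta> = v 1 / (v 1 + 2) * pdf_coeff2 (v 1) (\<beta> 1)"
proof -
  define T where "T = student_cdf (v 1 + 1) (\<beta> 1 * sqrt (v 1 + 1))"
  have "T > 0" "v 1 > 0" using v1_pos by (simp_all add: T_def student_cdf_pos)
  then show ?thesis unfolding A1_def pdf_coeff2_def skew_ratio_def T_def[symmetric]
    by (simp add: divide_simps) (simp add: algebra_simps power2_eq_square)
qed

lemma K1_eq: "K1 v \<beta> = pdf_coeff2 (v 1) (\<beta> 1)"
proof -
  define T where "T = student_cdf (v 1 + 1) (\<beta> 1 * sqrt (v 1 + 1))"
  have "T > 0" "v 1 > 0" using v1_pos by (simp_all add: T_def student_cdf_pos)
  then show ?thesis unfolding K1_def pdf_coeff2_def skew_ratio_def T_def[symmetric]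
    by (simp add: divide_simps)
qed

lemma A2_eq: "A2 v \<beta> = v 1 / (v 1 + 4) * pdf_coeff4 (v 1) (\<beta> 1)"
proof -
  define T where "T = student_cdf (v 1 + 1) (\<beta> 1 * sqrt (v 1 + 1))"
  define N where "N = student_C (v 1 + 1) * sqrt (v 1 + 1) * \<beta> 1 * (1 + (\<beta> 1)\<^sup>2) powr (- ((v 1 + 2) / 2))"
  define b where "b = (\<beta> 1)\<^sup>2 / (1 + (\<beta> 1)\<^sup>2)"
  define u where "u = v 1"
  have u: "u > 0" using v1_pos by (simp add: u_def)
  have ratio: "skew_ratio u (\<beta> 1) = N / T" by (simp add: skew_ratio_def N_def T_def u_def)
  have b: "(u + 2) * (\<beta> 1)\<^sup>2 * u ^ 3 / (8 * (u + 4) * (1 + (\<beta> 1)\<^sup>2)) = (u + 2) * u ^ 3 / (8 * (u + 4)) * b"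
    "u\<^sup>2 * (u + 2) * (\<beta> 1)\<^sup>2 / (8 * (1 + (\<beta> 1)\<^sup>2)) = u\<^sup>2 * (u + 2) / 8 * b"
    by (simp_all add: b_def)
  have skew: "u ^ 3 * (u - 1) / (4 * (u + 2)) + 3 * u\<^sup>2 / 8 - 3 * u\<^sup>2 / ((u + 2) * (u + 4))
      - (u + 2) * u ^ 3 / (8 * (u + 4)) * b
     = u / (u + 4) * (u\<^sup>2 * (u + 1) / 4 + 3 * u\<^sup>2 / 8 - u\<^sup>2 * (u + 2) / 8 * b)"
    using u by (simp add: divide_simps) algebra
  have sym: "u\<^sup>2 * (u\<^sup>2 - 1) / 8 + 3 * u\<^sup>2 / ((u + 2) * (u + 4)) + u\<^sup>2 * (u - 1) / (2 * (u + 2))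
     = u / (u + 4) * (u\<^sup>2 * (u + 1) * (u + 3) / 8)"
    using u by (simp add: divide_simps) algebra
  have "A2 v \<beta> = N / T * (u ^ 3 * (u - 1) / (4 * (u + 2)) + 3 * u\<^sup>2 / 8 - 3 * u\<^sup>2 / ((u + 2) * (u + 4))
        - (u + 2) * (\<beta> 1)\<^sup>2 * u ^ 3 / (8 * (u + 4) * (1 + (\<beta> 1)\<^sup>2)))
      + (u\<^sup>2 * (u\<^sup>2 - 1) / 8 + 3 * u\<^sup>2 / ((u + 2) * (u + 4)) + u\<^sup>2 * (u - 1) / (2 * (u + 2)))"
    by (simp only: A2_def N_def T_def u_def add.assoc)
  also have "\<dots> = N / T * (u / (u + 4) * (u\<^sup>2 * (u + 1) / 4 + 3 * u\<^sup>2 / 8 - u\<^sup>2 * (u + 2) / 8 * b))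
      + u / (u + 4) * (u\<^sup>2 * (u + 1) * (u + 3) / 8)"
    unfolding b skew sym ..
  finally show ?thesis
    unfolding pdf_coeff4_def ratio u_def[symmetric] b by (simp add: algebra_simps)
qed

lemma K3_eq: "K3 v \<beta> = pdf_coeff4 (v 1) (\<beta> 1)"
proof -
  define T where "T = student_cdf (v 1 + 1) (\<beta> 1 * sqrt (v 1 + 1))"
  define N where "N = student_C (v 1 + 1) * \<beta> 1 * sqrt (v 1 + 1) * (1 + (\<beta> 1)\<^sup>2) powr (- ((v 1 + 2) / 2))"
  define B where "B = (\<beta> 1)\<^sup>2"
  define u where "u = v 1"
  have T: "T > 0" using v1_pos by (simp add: T_def student_cdf_pos)
  have B: "1 + B > 0" by (simp add: B_def add_pos_nonneg)
  have poly: "(2 * u ^ 3 + u ^ 3 * B + 3 * u\<^sup>2 * B + 5 * u\<^sup>2) / (8 * (1 + B))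
     = u\<^sup>2 * (u + 1) / 4 + 3 * u\<^sup>2 / 8 - u\<^sup>2 * (u + 2) * B / (8 * (1 + B))"
    using B by (simp add: divide_simps) algebra
  have "K3 v \<beta> = (u\<^sup>2 * (u + 3) * (u + 1) / 8 * T
      + N * ((2 * u ^ 3 + u ^ 3 * B + 3 * u\<^sup>2 * B + 5 * u\<^sup>2) / (8 * (1 + B)))) / T"
    by (simp add: K3_def N_def T_def u_def B_def)
  also have "\<dots> = u\<^sup>2 * (u + 1) * (u + 3) / 8 + N / T * (u\<^sup>2 * (u + 1) / 4 + 3 * u\<^sup>2 / 8 - u\<^sup>2 * (u + 2)
      * B / (8 * (1 + B)))"
    unfolding poly using T by (simp add: add_divide_distrib mult_ac)
  finally show ?thesis
    by (simp add: pdf_coeff4_def skew_ratio_def N_def T_def u_def B_def)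
qed

lemma A3_eq: "A3 p v \<beta> = weight 2" and A5_eq: "A5 p v \<beta> = weight 3"
  by (simp_all add: A3_def A5_def weight_def tail_const_def kappa_def mult.assoc)

lemma A4_eq:
  assumes "2 \<le> r"
  shows "A4 p v \<beta> = weight 2 * (v 2 / (v 2 + 2) * pdf_coeff2 (v 2) (\<beta> 2))"
proof -
  define T where "T = student_cdf (v 2 + 1) (\<beta> 2 * sqrt (v 2 + 1))"
  have "v 2 > 0" using v_pos[of 2] assms by simp
  then have "T > 0" "v 2 > 0" by (simp_all add: T_def student_cdf_pos)
  then show ?thesis unfolding A4_def A3_eq pdf_coeff2_def skew_ratio_def T_def[symmetric]
    by (simp add: divide_simps) (simp add: algebra_simps power2_eq_square)
qed

lemma K2_eq:
  assumes "2 \<le> r"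
  shows "K2 p v \<beta> = weight 2 * (v 2 / v 1) * pdf_coeff2 (v 2) (\<beta> 2)"
proof -
  define T where "T = student_cdf (v 2 + 1) (\<beta> 2 * sqrt (v 2 + 1))"
  define T1 where "T1 = student_cdf (v 1 + 1) (\<beta> 1 * sqrt (v 1 + 1))"
  have v2: "v 2 > 0" using v_pos[of 2] assms by simp
  then have pos: "T > 0" "T1 > 0" "p 1 > 0" "student_C (v 1) > 0" "v 1 powr ((v 1
      - 1) / 2) > 0" "v 2 powr ((v 2 - 1) / 2) > 0"
    using v1_pos p1_pos by (simp_all add: T_def T1_def student_cdf_pos student_C_pos)
  have 1: "v 2 powr ((v 2 + 3) / 2) = (v 2)\<^sup>2 * v 2 powr ((v 2 - 1) / 2)"
    using powr_add[of "v 2" 2 "(v 2 - 1) / 2"] v2 by (simp add: field_simps)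
  have 2: "v 1 powr ((v 1 + 1) / 2) = v 1 * v 1 powr ((v 1 - 1) / 2)"
    using powr_add[of "v 1" 1 "(v 1 - 1) / 2"] v1_pos by (simp add: field_simps)
  show ?thesis
    unfolding K2_def weight_def tail_const_def kappa_def pdf_coeff2_def skew_ratio_def T_def[symmetric]
        T1_def[symmetric] 1 2
    using pos v2 v1_pos by (simp add: divide_simps) (simp add: algebra_simps power2_eq_square)
qed

text \<open>
  Up to the order \<open>v 2 - v 1 + 2\<close>, and not beyond the leading order of the third component, the first
  component contributes its two shape corrections, the second its leading term and one shape
  correction, and the third at most its leading term; all later components decay faster.
\<close>

lemma coefficient_sum:
  fixes c k2 k4 :: "nat \<Rightarrow> real"
  assumes r: "2 \<le> r" and c1: "c 1 = 1" and \<theta>: "0 < \<theta>" "\<theta> \<le> v 2 - v 1 + 2" "3 \<le> r \<Longrightarrow> \<theta> \<le> v 3 - v 1"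
  shows "x powr (- \<theta>) * (\<Sum>i=1..r. c i * (of_bool (v i - v 1 = \<theta>)
     + k2 i * of_bool (v i - v 1 + 2 = \<theta>) + k4 i * of_bool (v i - v 1 + 4 = \<theta>)))
   = k2 1 * x powr (- 2) * of_bool (\<theta> = 2) + k4 1 * x powr (- 4) * of_bool (\<theta> = 4)
     + c 2 * x powr (- (v 2 - v 1)) * of_bool (\<theta> = v 2 - v 1)
     + c 2 * k2 2 * x powr (- (v 2 - v 1) - 2) * of_bool (\<theta> = v 2 - v 1 + 2)
     + of_bool (3 \<le> r) * c 3 * x powr (- (v 3 - v 1)) * of_bool (\<theta> = v 3 - v 1)"
proof -
  define t where "t = (\<lambda>i. c i * (of_bool (v i - v 1 = \<theta>)
     + k2 i * of_bool (v i - v 1 + 2 = \<theta>) + k4 i * of_bool (v i - v 1 + 4 = \<theta>)))"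
  have split: "{1..r} = {1, 2} \<union> {3..r}" using r by auto
  have "sum t {1..r} = t 1 + t 2 + sum t {3..r}"
    unfolding split by (subst sum.union_disjoint) auto
  also have "sum t {3..r} = (\<Sum>i=3..r. if i = 3 then c 3 * of_bool (v 3 - v 1 = \<theta>) else 0)"
  proof (rule sum.cong[OF refl])
    fix i assume i: "i \<in> {3..r}"
    have v3: "\<theta> \<le> v 3 - v 1" using \<theta> i by simp
    show "t i = (if i = 3 then c 3 * of_bool (v 3 - v 1 = \<theta>) else 0)"
    proof (cases "i = 3")
      case True
      then show ?thesis using v3 by (simp add: t_def)
    next
      case False
      then have "v 3 < v i" using v_less[of 3 i] i by simp
      then show ?thesis using v3 False by (simp add: t_def)
    qed
  qed
  also have "\<dots> = of_bool (3 \<le> r) * c 3 * of_bool (v 3 - v 1 = \<theta>)" by (simp add: sum.delta)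
  also have "t 1 = k2 1 * of_bool (2 = \<theta>) + k4 1 * of_bool (4 = \<theta>)" using \<theta> by (simp add: t_def c1)
  also have "t 2 = c 2 * (of_bool (v 2 - v 1 = \<theta>) + k2 2 * of_bool (v 2 - v 1 + 2 = \<theta>))"
    using \<theta> by (simp add: t_def)
  finally have s: "sum t {1..r} = k2 1 * of_bool (2 = \<theta>) + k4 1 * of_bool (4 = \<theta>)
    + c 2 * (of_bool (v 2 - v 1 = \<theta>) + k2 2 * of_bool (v 2 - v 1 + 2 = \<theta>))
    + of_bool (3 \<le> r) * c 3 * of_bool (v 3 - v 1 = \<theta>)" .
  have ob: "x powr (- \<theta>) * of_bool (\<tau> = \<theta>) = x powr (- \<tau>) * of_bool (\<theta> = \<tau>)" for \<tau> by auto
  have e: "- (v 2 - v 1 + 2) = - (v 2 - v 1) - 2" by simp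
  show ?thesis
    unfolding t_def[symmetric] s
    using ob[of 2] ob[of 4] ob[of "v 2 - v 1"] ob[of "v 2 - v 1 + 2"] ob[of "v 3 - v 1"] unfolding e
    by algebra
qed

text \<open>
  The monomials of the relative corrections, evaluated at \<open>x\<close>, that carry the power \<open>\<theta>\<close> of the norming
  sequence. Each monomial keeps its own exponent in place of \<open>\<theta>\<close>, so that the indicators can be treated
  as opaque numbers in the regimes below.
\<close>

definition tail_term :: "real \<Rightarrow> real \<Rightarrow> real" where
  "tail_term x \<theta> = A1 v \<beta> * x powr (- 2) * of_bool (\<theta> = 2) + A2 v \<beta> * x powr (- 4) * of_bool (\<theta> = 4)
     + A3 p v \<beta> * x powr (- (v 2 - v 1)) * of_bool (\<theta> = v 2 - v 1)
     + A4 p v \<beta> * x powr (- (v 2 - v 1) - 2) * of_bool (\<theta> = v 2 - v 1 + 2)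
     + of_bool (3 \<le> r) * A5 p v \<beta> * x powr (- (v 3 - v 1)) * of_bool (\<theta> = v 3 - v 1)"

definition density_term :: "real \<Rightarrow> real \<Rightarrow> real" where
  "density_term x \<theta> = K1 v \<beta> * x powr (- 2) * of_bool (\<theta> = 2) + K3 v \<beta> * x powr (- 4) * of_bool (\<theta> = 4)
     + A3 p v \<beta> * (v 2 / v 1) * x powr (- (v 2 - v 1)) * of_bool (\<theta> = v 2 - v 1)
     + K2 p v \<beta> * x powr (- (v 2 - v 1) - 2) * of_bool (\<theta> = v 2 - v 1 + 2)
     + of_bool (3 \<le> r) * (A5 p v \<beta> * (v 3 / v 1)) * x powr (- (v 3 - v 1)) * of_bool (\<theta> = v 3 - v 1)"

text \<open>
  The general result with the sums over components evaluated. The variables for the terms at \<open>d\<close> and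
  \<open>m\<close> are to be instantiated with the few monomials present in a given regime.
\<close>

theorem pdf_error_limit:
  fixes d m x s q :: real
  assumes r: "2 \<le> r" and x: "x > 0" and d: "0 < d" "d < m" "m \<le> 2 * d" "d \<le> 2"
    and d2: "2 = d \<or> m \<le> 2" and dv: "v 1 = d \<or> m \<le> v 1"
    and dv2: "v 2 - v 1 = d \<or> m \<le> v 2 - v 1" and dv3: "3 \<le> r \<Longrightarrow> m \<le> v 3 - v 1"
    and terms: "tail_term x d = Td" "density_term x d = Ud" "tail_term x m = Tm" "density_term x m = Um"
    and w: "x powr (- v 1) = w"
    and e: "e = - w * Td + of_bool (v 1 = d) * (\<kappa> * (2 * w - w\<^sup>2))"
    and s: "s = Ud + e"
    and q: "q = Um - w * Tm + of_bool (v 1 = m) * (\<kappa> * (2 * w - w\<^sup>2))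
       + of_bool (m = 2 * d)
           * (of_bool (v 1 = d) * (2 * \<kappa> * Td * (w - w\<^sup>2) + 4 * \<kappa>\<^sup>2 * (w\<^sup>2 / 2 - w ^ 3 / 3))
            + Ud * e + e\<^sup>2 / 2)"
  shows "(\<lambda>n. a n powr (m - d) * (a n powr d * pdf_error r p v \<beta> n x - s * frechet_pdf (v 1) x))
     \<longlonglongrightarrow> q * frechet_pdf (v 1) x"
proof -
  have di: "v i - v 1 = d \<or> m \<le> v i - v 1" if i: "i \<in> {2..r}" for i
  proof -
    consider "i = 2" | "i = 3" "3 \<le> r" | "3 < i" "3 \<le> r" using i by fastforce
    then show ?thesis
    proof cases
      case 3
      then have "v 3 < v i" using v_less[of 3 i] i by simp
      then show ?thesis using dv3 3 by simp
    qed (use dv2 dv3 in auto)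
  qed
  have m2: "m \<le> v 2 - v 1 + 2" using dv2 d by auto
  have T: "x powr (- \<theta>) * tail_coeff \<theta> = tail_term x \<theta>" if "\<theta> = d \<or> \<theta> = m" for \<theta>
    unfolding tail_coeff_def tail_term_def A1_eq A2_eq A3_eq A4_eq[OF r] A5_eq
    using that d m2 dv3
    by (subst coefficient_sum[OF r, of weight]) (auto simp: weight_1 mult_ac)
  have U: "x powr (- \<theta>) * density_coeff \<theta> = density_term x \<theta>" if "\<theta> = d \<or> \<theta> = m" for \<theta>
    unfolding density_coeff_def density_term_def K1_eq K3_eq A3_eq K2_eq[OF r] A5_eq
    using that d m2 dv3 weight_1 v1_pos
    by (subst coefficient_sum[OF r, of "\<lambda>i. weight i * (v i / v 1)"]) (auto simp: mult_ac)
  have T': "x powr (- d) * tail_coeff d = Td" "x powr (- m) * tail_coeff m = Tm"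
    unfolding terms[symmetric] by (rule T, simp)+
  have U': "x powr (- d) * density_coeff d = Ud" "x powr (- m) * density_coeff m = Um"
    unfolding terms[symmetric] by (rule U, simp)+
  show ?thesis
    using pdf_error_second_order[OF x d d2 dv di]
    unfolding T' U' w e[symmetric] q[symmetric] s[symmetric] .
qed

section \<open>The seven regimes\<close>

text \<open>
  Only \<open>1 / n\<close> has order \<open>d = v 1\<close>. In this and the following proofs the indicators in the limit are
  first identified with the statements that a given exponent attains the minimum \<open>m\<close>; then both sides
  are polynomials in these indicators, the constants and a few powers of \<open>x\<close>.
\<close>

lemma limit_sample_size_dominant:
  assumes r: "2 \<le> r" and x: "x > 0" and v: "v 1 < 2" "v 2 > 2 * v 1"
  shows "(\<lambda>n. a n powr (Min {2, v 2 - v 1, 2 * v 1} - v 1) *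
             (a n powr v 1 * pdf_error r p v \<beta> n x - s1 p v \<beta> x * frechet_pdf (v 1) x))
        \<longlonglongrightarrow> q1 p v \<beta> x * frechet_pdf (v 1) x"
proof -
  define m where "m = Min {2, v 2 - v 1, 2 * v 1}"
  have m: "m = min 2 (min (v 2 - v 1) (2 * v 1))" by (simp add: m_def)
  have v3: "3 \<le> r \<Longrightarrow> v 2 < v 3" using v_less[of 2 3] by simp
  note facts = v1_pos v v3
  obtain P Q R :: real where PQR: "P = of_bool (m = 2)" "Q = of_bool (m = v 2 - v 1)" "R
      = of_bool (m = 2 * v 1)" by simp
  have I: "of_bool (0 < v 1 \<and> v 1 < 1 \<and> 2 * v 1 < v 2 \<and> v 2 \<le> 3 * v 1)
      + of_bool (1 \<le> v 1 \<and> v 1 < 2 \<and> 2 * v 1 < v 2 \<and> v 2 \<le> v 1 + 2) = Q"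
    "of_bool (1 \<le> v 1 \<and> v 1 < 2 \<and> v 2 \<ge> v 1 + 2) = P"
    "of_bool (0 < v 1 \<and> v 1 \<le> 1 \<and> v 2 \<ge> 3 * v 1) = R"
    unfolding PQR using facts by (auto simp: m min_def)
  define w Y W where "w = x powr (- v 1)" and "Y = x powr (- (v 2 - v 1))" and "W = x powr (-2)"
  have mono: "x powr (- v 2) = w * Y" "x powr (- v 1 - 2) = w * W" "x powr (- 2 * v 1) = w * w"
    by (simp_all add: w_def Y_def W_def powr_add[symmetric])
  have d: "0 < v 1" "v 1 < m" "m \<le> 2 * v 1" "v 1 \<le> 2" "2 = v 1 \<or> m \<le> 2" "v 1 = v 1 \<or> m \<le> v 1"
    "v 2 - v 1 = v 1 \<or> m \<le> v 2 - v 1"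
    using facts by (auto simp: m)
  have dv3: "3 \<le> r \<Longrightarrow> m \<le> v 3 - v 1" using facts by (auto simp: m)
  have ne: "v 1 \<noteq> 2" "v 1 \<noteq> 4" "v 1 \<noteq> v 2 - v 1" "v 1 \<noteq> v 2 - v 1 + 2" "3 \<le> r \<Longrightarrow> v 1 \<noteq> v 3 - v 1"
     "m \<noteq> 4" "m \<noteq> v 2 - v 1 + 2" "3 \<le> r \<Longrightarrow> m \<noteq> v 3 - v 1" "v 1 \<noteq> m"
    using facts d by (auto simp: m)
  have terms: "tail_term x (v 1) = 0" "density_term x (v 1) = 0"
    "tail_term x m = P * A1 v \<beta> * W + Q * A3 p v \<beta> * Y"
    "density_term x m = P * K1 v \<beta> * W + Q * A3 p v \<beta> * (v 2 / v 1) * Y"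
    using ne by (auto simp: tail_term_def density_term_def PQR Y_def W_def)
  have s: "s1 p v \<beta> x = \<kappa> * (2 - w) * w"
    unfolding s1_def w_def[symmetric] ..
  have q: "q1 p v \<beta> x = Q * (v 2 / v 1 * Y - w * Y) * A3 p v \<beta> + P * (K1 v \<beta> * W - A1 v \<beta> * (w * W))
      + R * \<kappa>\<^sup>2 * (4 - 10 / 3 * w + 1 / 2 * (w * w)) * (w * w)"
    unfolding q1_def I mono w_def[symmetric] Y_def[symmetric] W_def[symmetric] ..
  show ?thesis
    unfolding m_def[symmetric]
    by (rule pdf_error_limit[OF r x d dv3 terms w_def[symmetric] refl])
       (unfold s q PQR(3)[symmetric], use ne in \<open>simp_all add: field_simps power2_eq_square power3_eq_cube\<close>)
qed

text \<open>
  Only the shape correction has order \<open>d = 2\<close>.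
\<close>

lemma limit_tail_shape_dominant:
  assumes r: "2 \<le> r" and x: "x > 0" and v: "v 1 > 2" "v 2 > v 1 + 2"
  shows "(\<lambda>n. a n powr (Min {4, v 2 - v 1, v 1} - 2) *
             (a n powr 2 * pdf_error r p v \<beta> n x - s2 v \<beta> x * frechet_pdf (v 1) x))
        \<longlonglongrightarrow> q2 p v \<beta> x * frechet_pdf (v 1) x"
proof -
  define m where "m = Min {4, v 2 - v 1, v 1}"
  have m: "m = min 4 (min (v 2 - v 1) (v 1))" by (simp add: m_def)
  have v3: "3 \<le> r \<Longrightarrow> v 2 < v 3" using v_less[of 2 3] by simp
  note facts = v1_pos v v3
  obtain P Q R :: real where PQR: "P = of_bool (m = 4)" "Q = of_bool (m = v 2 - v 1)" "R
      = of_bool (v 1 = m)" by simp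
  have I: "of_bool (v 1 \<ge> 4 \<and> v 1 + 2 < v 2 \<and> v 2 \<le> v 1 + 4)
        + of_bool (2 < v 1 \<and> v 1 < 4 \<and> v 1 + 2 < v 2 \<and> v 2 \<le> 2 * v 1) = Q"
    "of_bool (v 1 \<ge> 4 \<and> v 2 \<ge> v 1 + 4) = P"
    "of_bool (2 < v 1 \<and> v 1 \<le> 4 \<and> v 2 \<ge> 2 * v 1) = R"
    unfolding PQR using facts by (auto simp: m min_def)
  define w Y W where "w = x powr (- v 1)" and "Y = x powr (- (v 2 - v 1))" and "W = x powr (-2)"
  have mono: "x powr (- v 2) = w * Y" "x powr (- v 1 - 2) = w * W" "x powr (- v 1 - 4) = w * (W * W)"
    "x powr (- 2 * v 1 - 4) = w * w * (W * W)" "x powr (- 4) = W * W"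
    by (simp_all add: w_def Y_def W_def powr_add[symmetric])
  have d: "0 < (2::real)" "2 < m" "m \<le> 2 * 2" "2 \<le> (2::real)" "2 = 2 \<or> m \<le> 2" "v 1 = 2 \<or> m \<le> v 1"
    "v 2 - v 1 = 2 \<or> m \<le> v 2 - v 1"
    using facts by (auto simp: m)
  have dv3: "3 \<le> r \<Longrightarrow> m \<le> v 3 - v 1" using facts by (auto simp: m)
  have ne: "v 1 \<noteq> 2" "2 \<noteq> v 2 - v 1" "2 \<noteq> v 2 - v 1 + 2" "3 \<le> r \<Longrightarrow> 2 \<noteq> v 3 - v 1"
     "m \<noteq> 2" "m \<noteq> v 2 - v 1 + 2" "3 \<le> r \<Longrightarrow> m \<noteq> v 3 - v 1"
    using facts d by (auto simp: m)
  have terms: "tail_term x 2 = A1 v \<beta> * W" "density_term x 2 = K1 v \<beta> * W"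
    "tail_term x m = P * A2 v \<beta> * (W * W) + Q * A3 p v \<beta> * Y"
    "density_term x m = P * K3 v \<beta> * (W * W) + Q * A3 p v \<beta> * (v 2 / v 1) * Y"
    unfolding tail_term_def density_term_def mono(5)
    using ne by (auto simp: PQR Y_def W_def)
  have D: "of_bool (m = 2 * 2) = P" by (simp add: PQR)
  have s: "s2 v \<beta> x = K1 v \<beta> * W - A1 v \<beta> * (w * W)"
    unfolding s2_def mono W_def[symmetric] ..
  have q: "q2 p v \<beta> x = P * (K3 v \<beta> * (W * W) - (A2 v \<beta> + K1 v \<beta> * A1 v \<beta>) * (w * (W * W))
      + 1 / 2 * (A1 v \<beta>)\<^sup>2 * (w * w * (W * W)))
     + Q * A3 p v \<beta> * (v 2 / v 1 * Y - w * Y) + R * \<kappa> * (2 - w) * w"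
    unfolding q2_def I mono w_def[symmetric] Y_def[symmetric] ..
  show ?thesis
    unfolding m_def[symmetric]
    by (rule pdf_error_limit[OF r x d dv3 terms w_def[symmetric] refl])
       (unfold s q PQR(3)[symmetric] D, use ne
           in \<open>simp_all add: field_simps power2_eq_square power3_eq_cube\<close>)
qed

text \<open>
  Only the second component has order \<open>d = v 2 - v 1\<close>.
\<close>

lemma limit_second_component_dominant:
  assumes r: "3 \<le> r" and x: "x > 0" and v: "v 2 < min (v 1 + 2) (2 * v 1)"
  shows "(\<lambda>n. a n powr (Min {2, v 1, 2 * (v 2 - v 1), v 3 - v 1} - v 2 + v 1) *
             (a n powr (v 2 - v 1) * pdf_error r p v \<beta> n x - s3 p v \<beta> x * frechet_pdf (v 1) x))
        \<longlonglongrightarrow> q3 p v \<beta> x * frechet_pdf (v 1) x"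
proof -
  define m where "m = Min {2, v 1, 2 * (v 2 - v 1), v 3 - v 1}"
  have m: "m = min 2 (min (v 1) (min (2 * (v 2 - v 1)) (v 3 - v 1)))" by (simp add: m_def)
  have v12: "v 1 < v 2" using v_less[of 1 2] r by simp
  have v23: "v 2 < v 3" using v_less[of 2 3] r by simp
  note facts = v1_pos v v12 v23
  obtain P Q R S :: real where PQR: "P = of_bool (m = 2)" "Q = of_bool (m = v 3 - v 1)"
    "R = of_bool (v 1 = m)" "S = of_bool (m = 2 * (v 2 - v 1))" by simp
  have I: "of_bool (0 < v 1 \<and> v 1 < 2 \<and> (v 1 + v 3) / 2 \<le> v 2 \<and> v 2 < 2 * v 1 \<and> v 3 \<le> 2 * v 1)
      + of_bool (v 1 \<ge> 2 \<and> (v 1 + v 3) / 2 \<le> v 2 \<and> v 2 < v 1 + 2 \<and> v 3 \<le> 2 + v 1) = Q"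
    "of_bool (0 < v 1 \<and> v 1 \<le> 2 \<and> 3 / 2 * v 1 \<le> v 2 \<and> v 2 < 2 * v 1 \<and> v 3 \<ge> 2 * v 1) = R"
    "of_bool (v 1 \<ge> 2 \<and> v 1 + 1 \<le> v 2 \<and> v 2 < v 1 + 2 \<and> v 3 \<ge> v 1 + 2) = P"
    "of_bool (0 < v 1 \<and> v 1 < 2 \<and> v 1 < v 2 \<and> v 2 \<le> 3 / 2 * v 1 \<and> v 3 \<ge> 2 * v 1)
        + of_bool (0 < v 1 \<and> v 1 < 2 \<and> v 1 < v 2 \<and> v 2 \<le> (v 1 + v 3) / 2 \<and> v 2 < v 3 \<and> v 3 < 2 * v 1)
        + of_bool (v 1 \<ge> 2 \<and> v 1 < v 2 \<and> v 2 \<le> v 1 + 1 \<and> v 3 \<ge> 2 + v 1)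
        + of_bool (v 1 \<ge> 2 \<and> v 1 < v 2 \<and> v 2 \<le> (v 1 + v 3) / 2 \<and> v 2 < v 3 \<and> v 3 < v 1 + 2) = S"
    unfolding PQR using facts by (auto simp: m min_def)
  define w Y W Z where "w = x powr (- v 1)" and "Y = x powr (- (v 2 - v 1))" and "W = x powr (-2)"
    and "Z = x powr (- (v 3 - v 1))"
  have mono: "x powr (- v 2) = w * Y" "x powr (- v 3) = w * Z" "x powr (- v 1 - 2) = w * W"
    "x powr (- 2 * v 2) = w * w * (Y * Y)" "x powr (- 2 * v 2 + v 1) = w * (Y * Y)"
    by (simp_all add: w_def Y_def W_def Z_def powr_add[symmetric])
  have d: "0 < v 2 - v 1" "v 2 - v 1 < m" "m \<le> 2 * (v 2 - v 1)" "v 2 - v 1 \<le> 2" "2 = v 2 - v 1 \<or> m \<le> 2"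
    "v 1 = v 2 - v 1 \<or> m \<le> v 1" "v 2 - v 1 = v 2 - v 1 \<or> m \<le> v 2 - v 1"
    using facts by (auto simp: m)
  have dv3: "3 \<le> r \<Longrightarrow> m \<le> v 3 - v 1" by (simp add: m)
  have ne: "v 2 - v 1 \<noteq> 2" "v 2 - v 1 \<noteq> 4" "v 2 - v 1 \<noteq> v 3 - v 1" "v 1 \<noteq> v 2 - v 1"
     "m \<noteq> 4" "m \<noteq> v 2 - v 1" "m \<noteq> v 2 - v 1 + 2"
    using facts d by (auto simp: m)
  have terms: "tail_term x (v 2 - v 1) = A3 p v \<beta> * Y" "density_term x (v 2 - v 1) = A3 p v \<beta> * (v 2 / v 1)
      * Y"
    "tail_term x m = P * A1 v \<beta> * W + Q * A5 p v \<beta> * Z"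
    "density_term x m = P * K1 v \<beta> * W + Q * A5 p v \<beta> * (v 3 / v 1) * Z"
    using ne r by (auto simp: tail_term_def density_term_def PQR Y_def W_def Z_def)
  have s: "s3 p v \<beta> x = (v 2 / v 1 * Y - w * Y) * A3 p v \<beta>"
    unfolding s3_def mono Y_def[symmetric] ..
  have q: "q3 p v \<beta> x = Q * (v 3 / v 1 * Z - w * Z) * A5 p v \<beta> + R * \<kappa> * (2 - w) * w
      + P * (K1 v \<beta> * W - A1 v \<beta> * (w * W))
      + S * (w * w * (Y * Y) / 2 - v 2 / v 1 * (w * (Y * Y))) * (A3 p v \<beta>)\<^sup>2"
    unfolding q3_def I mono w_def[symmetric] Z_def[symmetric] W_def[symmetric] ..
  have exponent: "m - v 2 + v 1 = m - (v 2 - v 1)" by simp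
  show ?thesis
    unfolding m_def[symmetric] exponent
    by (rule pdf_error_limit[OF _ x d dv3 terms w_def[symmetric] refl])
       (unfold s q PQR(3,4)[symmetric], use ne r
           in \<open>simp_all add: field_simps power2_eq_square power3_eq_cube\<close>)
qed

text \<open>
  The sample size and the shape corrections both have order \<open>d = 2\<close>.
\<close>

lemma limit_sample_size_tail_shape_tie:
  assumes r: "2 \<le> r" and x: "x > 0" and v: "v 1 = 2" "v 2 > 4"
  shows "(\<lambda>n. a n powr (Min {v 2 - 2, 4} - 2) *
             (a n powr 2 * pdf_error r p v \<beta> n x - s4 p v \<beta> x * frechet_pdf (v 1) x))
        \<longlonglongrightarrow> q4 p v \<beta> x * frechet_pdf (v 1) x"
proof -
  define m where "m = Min {v 2 - 2, 4}"
  have m: "m = min (v 2 - 2) 4" by (simp add: m_def)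
  have v3: "3 \<le> r \<Longrightarrow> v 2 < v 3" using v_less[of 2 3] by simp
  note facts = v v3
  obtain P Q :: real where PQR: "P = of_bool (m = 4)" "Q = of_bool (m = v 2 - v 1)" by simp
  have I: "of_bool (4 < v 2 \<and> v 2 \<le> 6) = Q" "of_bool (v 2 \<ge> 6) = P"
    unfolding PQR using facts by (auto simp: m min_def)
  define w Y t where "w = x powr (- v 1)" and "Y = x powr (- (v 2 - v 1))"
    and "t = student_cdf 3 (sqrt 3 * \<beta> 1)"
  have mono: "x powr (- v 2) = w * Y" "x powr (- (v 2 - 2)) = Y" "x powr (- 2) = w" "x powr (- 4) = w * w"
    "x powr (- 6) = w * w * w" "x powr (- 8) = w * w * (w * w)"
    by (simp_all add: w_def Y_def v(1) powr_add[symmetric])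
  have d: "0 < (2::real)" "2 < m" "m \<le> 2 * 2" "2 \<le> (2::real)" "2 = 2 \<or> m \<le> 2" "v 1 = 2 \<or> m \<le> v 1"
    "v 2 - v 1 = 2 \<or> m \<le> v 2 - v 1"
    using facts by (auto simp: m)
  have dv3: "3 \<le> r \<Longrightarrow> m \<le> v 3 - v 1" using facts by (auto simp: m)
  have ne: "2 \<noteq> v 2 - v 1" "2 \<noteq> v 2 - v 1 + 2" "3 \<le> r \<Longrightarrow> 2 \<noteq> v 3 - v 1"
     "m \<noteq> 2" "m \<noteq> v 2 - v 1 + 2" "3 \<le> r \<Longrightarrow> m \<noteq> v 3 - v 1"
    using facts d by (auto simp: m)
  have terms: "tail_term x 2 = A1 v \<beta> * w" "density_term x 2 = K1 v \<beta> * w"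
    "tail_term x m = P * A2 v \<beta> * (w * w) + Q * A3 p v \<beta> * Y"
    "density_term x m = P * K3 v \<beta> * (w * w) + Q * A3 p v \<beta> * (v 2 / 2) * Y"
    unfolding tail_term_def density_term_def mono
    using ne by (auto simp: PQR Y_def v(1))
  have D: "of_bool (m = 2 * 2) = P" by (simp add: PQR)
  have kap: "\<kappa> = p 1 * t / 2" unfolding t_def using v(1) by (rule kappa_two_degrees)
  have s: "s4 p v \<beta> x = - A1 v \<beta> * (w * w) - 1 / 2 * p 1 * t * (w * w) + K1 v \<beta> * w + p 1 * t * w"
    unfolding s4_def mono t_def[symmetric] ..
  have q: "q4 p v \<beta> x = Q * A3 p v \<beta> * (v 2 / 2 * Y - w * Y)
     + P * (- (A2 v \<beta> + A1 v \<beta> * K1 v \<beta> + (2 * A1 v \<beta> + K1 v \<beta> / 2) * p 1 * t + 5 / 6 * (p 1)\<^sup>2 * t\<^sup>2)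
         * (w * w * w)
          + (K3 v \<beta> + (A1 v \<beta> + K1 v \<beta>) * p 1 * t + (p 1)\<^sup>2 * t\<^sup>2) * (w * w)
          + 1 / 8 * (2 * A1 v \<beta> + p 1 * t)\<^sup>2 * (w * w * (w * w)))"
    unfolding q4_def I mono t_def[symmetric] ..
  show ?thesis
    unfolding m_def[symmetric]
    by (rule pdf_error_limit[OF r x d dv3 terms w_def[symmetric] refl])
       (unfold s q kap D, use ne v(1) in \<open>simp_all add: field_simps power2_eq_square power3_eq_cube\<close>)
qed

text \<open>
  The second component and the shape correction both have order \<open>d = 2\<close>. The shape correction of the
  second component, with constants \<open>A4\<close> and \<open>K2\<close>, then has order \<open>4\<close> and joins that of the first.
\<close>

lemma limit_second_component_tail_shape_tie:
  assumes r: "3 \<le> r" and x: "x > 0" and v: "v 1 > 2" "v 2 = v 1 + 2"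
  shows "(\<lambda>n. a n powr (Min {v 1, 4, v 3 - v 1} - 2) *
             (a n powr 2 * pdf_error r p v \<beta> n x - s5 p v \<beta> x * frechet_pdf (v 1) x))
        \<longlonglongrightarrow> q5 p v \<beta> x * frechet_pdf (v 1) x"
proof -
  define m where "m = Min {v 1, 4, v 3 - v 1}"
  have m: "m = min (v 1) (min 4 (v 3 - v 1))" by (simp add: m_def)
  have v23: "v 2 < v 3" using v_less[of 2 3] r by simp
  note facts = v v23
  obtain P Q R :: real where PQR: "P = of_bool (m = 4)" "Q = of_bool (m = v 3 - v 1)" "R
      = of_bool (v 1 = m)" by simp
  have I: "of_bool (2 < v 1 \<and> v 1 \<le> 4 \<and> v 3 \<ge> 2 * v 1) = R"
    "of_bool (2 < v 1 \<and> v 1 < 4 \<and> v 1 + 2 < v 3 \<and> v 3 \<le> 2 * v 1)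
        + of_bool (v 1 \<ge> 4 \<and> v 1 + 2 < v 3 \<and> v 3 \<le> v 1 + 4) = Q"
    "of_bool (v 1 \<ge> 4 \<and> v 3 \<ge> v 1 + 4) = P"
    unfolding PQR using facts by (auto simp: m min_def)
  define w W Z where "w = x powr (- v 1)" and "W = x powr (-2)" and "Z = x powr (- (v 3 - v 1))"
  have mono: "x powr (- v 3) = w * Z" "x powr (- v 1 - 2) = w * W" "x powr (- v 1 - 4) = w * (W * W)"
    "x powr (- 2 * v 1 - 4) = w * w * (W * W)" "x powr (- 2 * v 1) = w * w" "x powr (- 4) = W * W"
    by (simp_all add: w_def W_def Z_def powr_add[symmetric])
  have mono': "x powr (- (v 2 - v 1)) = W" "x powr (- (v 2 - v 1) - 2) = W * W"
    by (simp_all add: W_def v(2) powr_add[symmetric])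
  have d: "0 < (2::real)" "2 < m" "m \<le> 2 * 2" "2 \<le> (2::real)" "2 = 2 \<or> m \<le> 2" "v 1 = 2 \<or> m \<le> v 1"
    "v 2 - v 1 = 2 \<or> m \<le> v 2 - v 1"
    using facts by (auto simp: m)
  have dv3: "3 \<le> r \<Longrightarrow> m \<le> v 3 - v 1" by (simp add: m)
  have ne: "v 1 \<noteq> 2" "v 2 - v 1 = 2" "2 \<noteq> v 2 - v 1 + 2" "2 \<noteq> v 3 - v 1" "m \<noteq> 2" "m \<noteq> v 2 - v 1"
    using facts d by (auto simp: m)
  have D: "of_bool (m = 2 * 2) = P" "of_bool (m = v 2 - v 1 + 2) = P" using v by (simp_all add: PQR)
  have v21: "v 2 / v 1 = 1 + 2 / v 1" using v by (simp add: field_simps)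
  have terms: "tail_term x 2 = (A1 v \<beta> + A3 p v \<beta>) * W" "density_term x 2
      = (K1 v \<beta> + A3 p v \<beta> * (1 + 2 / v 1)) * W"
    "tail_term x m = P * (A2 v \<beta> + A4 p v \<beta>) * (W * W) + Q * A5 p v \<beta> * Z"
    "density_term x m = P * (K3 v \<beta> + K2 p v \<beta>) * (W * W) + Q * A5 p v \<beta> * (v 3 / v 1) * Z"
    unfolding tail_term_def density_term_def mono mono' D v21 W_def[symmetric] Z_def[symmetric]
        PQR(1,2)[symmetric]
    using ne r by (simp_all add: algebra_simps)
  have s: "s5 p v \<beta> x = (K1 v \<beta> + A3 p v \<beta> * (1 + 2 / v 1)) * W - (A1 v \<beta> + A3 p v \<beta>) * (w * W)"
    unfolding s5_def mono W_def[symmetric] ..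
  have q: "q5 p v \<beta> x = R * \<kappa> * (2 * w - w * w) + Q * (v 3 / v 1 * Z - w * Z) * A5 p v \<beta>
     + P * (1 / 2 * (A1 v \<beta> + A3 p v \<beta>)\<^sup>2 * (w * w * (W * W)) + (K2 p v \<beta> + K3 v \<beta>) * (W * W)
          - (((1 + 2 / v 1) * A3 p v \<beta> + K1 v \<beta>) * (A1 v \<beta> + A3 p v \<beta>) + A2 v \<beta> + A4 p v \<beta>)
              * (w * (W * W)))"
    unfolding q5_def I mono w_def[symmetric] Z_def[symmetric] ..
  show ?thesis
    unfolding m_def[symmetric]
    by (rule pdf_error_limit[OF _ x d dv3 terms w_def[symmetric] refl])
       (unfold s q PQR(3)[symmetric] D(1), use ne(1) r v(1) in \<open>simp_all add: field_simps power2_eq_square\<close>)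
qed

text \<open>
  The sample size and the second component both have order \<open>d = v 1\<close>.
\<close>

lemma limit_sample_size_second_component_tie:
  assumes r: "3 \<le> r" and x: "x > 0" and v: "v 1 < 2" "v 2 = 2 * v 1"
  shows "(\<lambda>n. a n powr (Min {2, 2 * v 1, v 3 - v 1} - v 1) *
             (a n powr v 1 * pdf_error r p v \<beta> n x - s6 p v \<beta> x * frechet_pdf (v 1) x))
        \<longlonglongrightarrow> q6 p v \<beta> x * frechet_pdf (v 1) x"
proof -
  define m where "m = Min {2, 2 * v 1, v 3 - v 1}"
  have m: "m = min 2 (min (2 * v 1) (v 3 - v 1))" by (simp add: m_def)
  have v23: "v 2 < v 3" using v_less[of 2 3] r by simp
  note facts = v1_pos v v23
  obtain P Q R :: real where PQR: "P = of_bool (m = 2)" "Q = of_bool (m = v 3 - v 1)" "R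
      = of_bool (m = 2 * v 1)" by simp
  have I: "of_bool (1 \<le> v 1 \<and> v 1 < 2 \<and> v 3 \<ge> v 1 + 2) = P"
    "of_bool (0 < v 1 \<and> v 1 < 1 \<and> 2 * v 1 < v 3 \<and> v 3 \<le> 3 * v 1)
        + of_bool (1 \<le> v 1 \<and> v 1 < 2 \<and> 2 * v 1 < v 3 \<and> v 3 \<le> v 1 + 2) = Q"
    "of_bool (0 < v 1 \<and> v 1 \<le> 1 \<and> v 3 \<ge> 3 * v 1) = R"
    unfolding PQR using facts by (auto simp: m min_def)
  define w W Z where "w = x powr (- v 1)" and "W = x powr (-2)" and "Z = x powr (- (v 3 - v 1))"
  have mono: "x powr (- v 3) = w * Z" "x powr (- v 1 - 2) = w * W" "x powr (- 2 * v 1) = w * w"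
    "x powr (- 3 * v 1) = w * w * w" "x powr (- 4 * v 1) = w * w * (w * w)"
    by (simp_all add: w_def W_def Z_def powr_add[symmetric])
  have mono': "x powr (- (v 2 - v 1)) = w" by (simp add: w_def v(2))
  have d: "0 < v 1" "v 1 < m" "m \<le> 2 * v 1" "v 1 \<le> 2" "2 = v 1 \<or> m \<le> 2" "v 1 = v 1 \<or> m \<le> v 1"
    "v 2 - v 1 = v 1 \<or> m \<le> v 2 - v 1"
    using facts by (auto simp: m)
  have dv3: "3 \<le> r \<Longrightarrow> m \<le> v 3 - v 1" by (simp add: m)
  have ne: "v 1 \<noteq> 2" "v 1 \<noteq> 4" "v 2 - v 1 = v 1" "v 1 \<noteq> v 2 - v 1 + 2" "v 1 \<noteq> v 3 - v 1" "v 1 \<noteq> m"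
     "m \<noteq> 4" "m \<noteq> v 2 - v 1" "m \<noteq> v 2 - v 1 + 2"
    using facts d by (auto simp: m)
  have v21: "v 2 / v 1 = 2" using facts by simp
  have terms: "tail_term x (v 1) = A3 p v \<beta> * w" "density_term x (v 1) = A3 p v \<beta> * 2 * w"
    "tail_term x m = P * A1 v \<beta> * W + Q * A5 p v \<beta> * Z"
    "density_term x m = P * K1 v \<beta> * W + Q * A5 p v \<beta> * (v 3 / v 1) * Z"
    unfolding tail_term_def density_term_def mono' v21 W_def[symmetric] Z_def[symmetric] PQR(1,2)[symmetric]
    using ne r by simp_all
  have s: "s6 p v \<beta> x = \<kappa> * (2 * w - w * w) + A3 p v \<beta> * (2 * w - w * w)"
    unfolding s6_def mono w_def[symmetric] ..
  have q: "q6 p v \<beta> x = P * (K1 v \<beta> * W - A1 v \<beta> * (w * W)) + Q * A5 p v \<beta> * (v 3 / v 1 * Z - w * Z)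
     + R * (\<kappa>\<^sup>2 * (w * w) * (4 - 10 / 3 * w) + 6 * \<kappa> * A3 p v \<beta> * (- (w * w * w) + w * w)
          - 2 * (A3 p v \<beta>)\<^sup>2 * (w * w * w) + 1 / 2 * (A3 p v \<beta> + \<kappa>)\<^sup>2 * (w * w * (w * w)))"
    unfolding q6_def I mono w_def[symmetric] Z_def[symmetric] W_def[symmetric] ..
  show ?thesis
    unfolding m_def[symmetric]
    by (rule pdf_error_limit[OF _ x d dv3 terms w_def[symmetric] refl])
       (unfold s q PQR(3)[symmetric], use ne(1,6) r
           in \<open>simp_all add: field_simps power2_eq_square power3_eq_cube\<close>)
qed

text \<open>
  All three corrections have order \<open>d = 2\<close>.
\<close>

lemma limit_triple_tie:
  assumes r: "3 \<le> r" and x: "x > 0" and v: "v 1 = 2" "v 2 = 4"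
  shows "(\<lambda>n. a n powr (Min {v 3 - v 1, 4} - 2) *
             (a n powr 2 * pdf_error r p v \<beta> n x - s7 p v \<beta> x * frechet_pdf (v 1) x))
        \<longlonglongrightarrow> q7 p v \<beta> x * frechet_pdf (v 1) x"
proof -
  define m where "m = Min {v 3 - v 1, 4}"
  have m: "m = min (v 3 - v 1) 4" by (simp add: m_def)
  have v23: "v 2 < v 3" using v_less[of 2 3] r by simp
  note facts = v v23
  obtain P Q :: real where PQR: "P = of_bool (m = 4)" "Q = of_bool (m = v 3 - v 1)" by simp
  have I: "of_bool (4 < v 3 \<and> v 3 \<le> 6) = Q" "of_bool (v 3 \<ge> 6) = P"
    unfolding PQR using facts by (auto simp: m min_def)
  define w Z t where "w = x powr (- v 1)" and "Z = x powr (- (v 3 - v 1))"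
    and "t = student_cdf 3 (sqrt 3 * \<beta> 1)"
  have mono: "x powr (- v 3) = w * Z" "x powr (- (v 3 - 2)) = Z" "x powr (- 2) = w" "x powr (- 4) = w * w"
    "x powr (- 6) = w * w * w" "x powr (- 8) = w * w * (w * w)"
    "x powr (- (v 2 - v 1)) = w" "x powr (- (v 2 - v 1) - 2) = w * w"
    by (simp_all add: w_def Z_def v powr_add[symmetric])
  have d: "0 < (2::real)" "2 < m" "m \<le> 2 * 2" "2 \<le> (2::real)" "2 = 2 \<or> m \<le> 2" "v 1 = 2 \<or> m \<le> v 1"
    "v 2 - v 1 = 2 \<or> m \<le> v 2 - v 1"
    using facts by (auto simp: m)
  have dv3: "3 \<le> r \<Longrightarrow> m \<le> v 3 - v 1" by (simp add: m)
  have ne: "v 2 - v 1 = 2" "2 \<noteq> v 2 - v 1 + 2" "2 \<noteq> v 3 - v 1" "m \<noteq> 2" "m \<noteq> v 2 - v 1"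
    using facts d by (auto simp: m)
  have D: "of_bool (m = 2 * 2) = P" "of_bool (m = v 2 - v 1 + 2) = P" using v by (simp_all add: PQR)
  have v21: "v 2 / v 1 = 2" "v 3 / v 1 = v 3 / 2" using v by simp_all
  have terms: "tail_term x 2 = (A1 v \<beta> + A3 p v \<beta>) * w" "density_term x 2 = (K1 v \<beta> + 2 * A3 p v \<beta>) * w"
    "tail_term x m = P * (A2 v \<beta> + A4 p v \<beta>) * (w * w) + Q * A5 p v \<beta> * Z"
    "density_term x m = P * (K3 v \<beta> + K2 p v \<beta>) * (w * w) + Q * A5 p v \<beta> * (v 3 / 2) * Z"
    unfolding tail_term_def density_term_def mono D v21 Z_def[symmetric] PQR[symmetric]
    using ne r by (simp_all add: algebra_simps)
  have kap: "\<kappa> = p 1 * t / 2" unfolding t_def using v(1) by (rule kappa_two_degrees)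
  have s: "s7 p v \<beta> x = (K1 v \<beta> + 2 * A3 p v \<beta> + p 1 * t) * w - (A1 v \<beta> + A3 p v \<beta> + 1 / 2 * p 1 * t)
      * (w * w)"
    unfolding s7_def mono t_def[symmetric] ..
  have q: "q7 p v \<beta> x = Q * A5 p v \<beta> * (v 3 / 2 * Z - w * Z)
     + P * (1 / 2 * (A1 v \<beta> + A3 p v \<beta> + 1 / 2 * p 1 * t)\<^sup>2 * (w * w * (w * w))
          - (A4 p v \<beta> + A2 v \<beta> + 2 * (A3 p v \<beta>)\<^sup>2 + 2 * A1 v \<beta> * A3 p v \<beta> + A1 v \<beta> * K1 v \<beta>
              + A3 p v \<beta> * K1 v \<beta>
             + (2 * A1 v \<beta> + 3 * A3 p v \<beta> + K1 v \<beta> / 2) * p 1 * t + 5 / 6 * (p 1)\<^sup>2 * t\<^sup>2) * (w * w * w)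
          + (K2 p v \<beta> + K3 v \<beta> + (A1 v \<beta> + K1 v \<beta> + 3 * A3 p v \<beta>) * p 1 * t + (p 1)\<^sup>2 * t\<^sup>2) * (w * w))"
    unfolding q7_def I mono t_def[symmetric] ..
  show ?thesis
    unfolding m_def[symmetric]
    by (rule pdf_error_limit[OF _ x d dv3 terms w_def[symmetric] refl])
       (unfold s q kap D(1), use r v(1) ne(4)
           in \<open>simp_all add: field_simps power2_eq_square power3_eq_cube\<close>)
qed

end

theorem theorem3p2:
  fixes r :: nat and p v \<beta> :: "nat \<Rightarrow> real" and x :: real
  assumes params: "mstd_parameters r p v"
    and x: "x > 0"
  shows
    "(r \<ge> 2 \<and> 0 < v 1 \<and> v 1 < 2 \<and> v 2 > 2 * v 1 \<longrightarrow>
        (\<lambda>n. norming p v \<beta> n powr (Min {2, v 2 - v 1, 2 * v 1} - v 1) *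
             (norming p v \<beta> n powr v 1 * pdf_error r p v \<beta> n x - s1 p v \<beta> x * frechet_pdf (v 1) x))
        \<longlonglongrightarrow> q1 p v \<beta> x * frechet_pdf (v 1) x) \<and>
     (r \<ge> 2 \<and> v 1 > 2 \<and> v 2 > v 1 + 2 \<longrightarrow>
        (\<lambda>n. norming p v \<beta> n powr (Min {4, v 2 - v 1, v 1} - 2) *
             (norming p v \<beta> n powr 2 * pdf_error r p v \<beta> n x - s2 v \<beta> x * frechet_pdf (v 1) x))
        \<longlonglongrightarrow> q2 p v \<beta> x * frechet_pdf (v 1) x) \<and>
     (r \<ge> 3 \<and> 0 < v 1 \<and> v 1 < v 2 \<and> v 2 < min (v 1 + 2) (2 * v 1) \<longrightarrow>
        (\<lambda>n. norming p v \<beta> n powr (Min {2, v 1, 2 * (v 2 - v 1), v 3 - v 1} - v 2 + v 1) *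
             (norming p v \<beta> n powr (v 2 - v 1) * pdf_error r p v \<beta> n x - s3 p v \<beta> x * frechet_pdf (v 1) x))
        \<longlonglongrightarrow> q3 p v \<beta> x * frechet_pdf (v 1) x) \<and>
     (r \<ge> 2 \<and> v 1 = 2 \<and> v 2 > 4 \<longrightarrow>
        (\<lambda>n. norming p v \<beta> n powr (Min {v 2 - 2, 4} - 2) *
             (norming p v \<beta> n powr 2 * pdf_error r p v \<beta> n x - s4 p v \<beta> x * frechet_pdf (v 1) x))
        \<longlonglongrightarrow> q4 p v \<beta> x * frechet_pdf (v 1) x) \<and>
     (r \<ge> 3 \<and> v 1 > 2 \<and> v 2 = v 1 + 2 \<longrightarrow>
        (\<lambda>n. norming p v \<beta> n powr (Min {v 1, 4, v 3 - v 1} - 2) *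
             (norming p v \<beta> n powr 2 * pdf_error r p v \<beta> n x - s5 p v \<beta> x * frechet_pdf (v 1) x))
        \<longlonglongrightarrow> q5 p v \<beta> x * frechet_pdf (v 1) x) \<and>
     (r \<ge> 3 \<and> 0 < v 1 \<and> v 1 < 2 \<and> v 2 = 2 * v 1 \<longrightarrow>
        (\<lambda>n. norming p v \<beta> n powr (Min {2, 2 * v 1, v 3 - v 1} - v 1) *
             (norming p v \<beta> n powr v 1 * pdf_error r p v \<beta> n x - s6 p v \<beta> x * frechet_pdf (v 1) x))
        \<longlonglongrightarrow> q6 p v \<beta> x * frechet_pdf (v 1) x) \<and>
     (r \<ge> 3 \<and> v 1 = 2 \<and> v 2 = 4 \<longrightarrow>
        (\<lambda>n. norming p v \<beta> n powr (Min {v 3 - v 1, 4} - 2) *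
             (norming p v \<beta> n powr 2 * pdf_error r p v \<beta> n x - s7 p v \<beta> x * frechet_pdf (v 1) x))
        \<longlonglongrightarrow> q7 p v \<beta> x * frechet_pdf (v 1) x)"
proof -
  interpret skewt_mixture r p v \<beta>
    by (rule skewt_mixture.intro[OF params])
  show ?thesis
    by (intro conjI impI; elim conjE)
       (rule limit_sample_size_dominant limit_tail_shape_dominant limit_second_component_dominant
          limit_sample_size_tail_shape_tie limit_second_component_tail_shape_tie
          limit_sample_size_second_component_tie limit_triple_tie; (assumption | rule x))+
qed

end
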